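(* Let $A=\Bbbk Q/I$ and let $R$ be any reduction system satisfying $(\diamond)$ for $I$. Then the Hochschild cohomology $\mathrm{HH}^2(A,A)$ is isomorphic to the space of first-order deformations of $R$ modulo equivalence.
   Context: $\Bbbk$ is a field of characteristic $0$, $Q$ a finite quiver, $I\subset\Bbbk Q$ a two-sided ideal, $\pi:\Bbbk Q\to A$ the projection; $e_i$ is the length-$0$ path at $i\in Q_0$; $pq$ is concatenation if the target of $p$ is the source of $q$, else $0$. $\mathrm{Hom}=\mathrm{Hom}_{\Bbbk Q_0^e}$ ($\Bbbk Q_0$-bimodule maps). Reduction systems: $R=\{(s,\varphi_s)\mid s\in S\}$ with $S$ a set of paths of length $\ge2$, $s$ not a subpath of $s'$ for $s\ne s'\in S$, $\varphi_s$ a linear combination of irreducible paths parallel to $s$; a path is irreducible if it has no subpath in $S$; $\mathrm{Irr}_S$ is the set of irreducible paths. A basic reduction is a linear map sending one path $qsr$ ($s\in S$) to $q\varphi_sr$ and fixing all other paths; a reduction is a finite composition. A path $p$ is reduction-finite if for any infinite sequence of reductions $\mathfrak r_n\cdots\mathfrak r_1(p)$ is eventually constant, reduction-unique if moreover all irreducible $\mathfrak r(p)$ coincide. $R$ satisfies $(\diamond)$ for $I$ if $I=\langle s-\varphi_s\rangle_{s\in S}$ and all paths are reduction-unique. Then $\pi|_{\Bbbk\mathrm{Irr}_S}:\Bbbk\mathrm{Irr}_S\to A$ is an isomorphism; $\mathrm{Hom}(\Bbbk S,A)=\mathrm{Hom}(\Bbbk S,\Bbbk\mathrm{Irr}_S)$.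 A first-order deformation of $R$ is $\{(s,\varphi_s+\widetilde\varphi_st)\}_{s\in S}$ with $\widetilde\varphi\in\mathrm{Hom}(\Bbbk S,\Bbbk\mathrm{Irr}_S)$ such that every path in $Q$ is reduction-unique with respect to this reduction system for $\Bbbk Q[t]/(t^2)$ (reductions being $\Bbbk[t]/(t^2)$-linear); vector space operations are those of $\widetilde\varphi\in\mathrm{Hom}(\Bbbk S,\Bbbk\mathrm{Irr}_S)$. Two first-order deformations given by $\widetilde\varphi,\widetilde\varphi'$ are equivalent if there is a $\Bbbk[t]/(t^2)$-linear $\Bbbk Q_0$-bimodule automorphism $T$ of $\Bbbk\mathrm{Irr}_S[t]/(t^2)$, identity modulo $t$, with $T(e_i)=e_i$ for all $i\in Q_0$, such that $T(\mathrm{red}^{(\infty)}_{\varphi+\widetilde\varphi't}(p))=\mathrm{red}^{(\infty)}_{\varphi+\widetilde\varphi t}(T(p_1)\cdots T(p_m))$ for every path $p=p_1\cdots p_m$ with $p_i\in Q_1$, where $\mathrm{red}^{(\infty)}_{\varphi+\widetilde\varphi t}$ reduces elements, by iterating rightmost reductions $qsr\mapsto q(\varphi_s+\widetilde\varphi_st)r$ ($s$ the rightmost subpath in $S$), to linear combinations of irreducible paths. *)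

theory Defs
  imports
    "HOL-Library.Poly_Mapping"
    "HOL-Library.FuncSet"
    "HOL-Computational_Algebra.Polynomial"
    "HOL-Algebra.Module"
    "HOL-Algebra.QuotRing"
    "HOL-Algebra.Algebraic_Closure_Type"
    "Graph_Theory.Arc_Walk"
begin

section \<open>The ring \<open>k[t]/(t^2)\<close>\<close>

text \<open>\<open>Dual a b\<close> stands for the class of \<open>a + b t\<close>; that this is \<open>k[t]/(t^2)\<close> is checked in
  \<open>dual_of_poly_hom\<close> and \<open>dual_of_poly_kernel\<close> below.\<close>

datatype 'a dual = Dual (std_part: 'a) (eps_part: 'a)

instantiation dual :: (comm_ring_1) comm_ring_1
begin

definition "0 = Dual 0 0"
definition "1 = Dual 1 0"
definition "x + y = Dual (std_part x + std_part y) (eps_part x + eps_part y)"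
definition "x - y = Dual (std_part x - std_part y) (eps_part x - eps_part y)"
definition "- x = Dual (- std_part x) (- eps_part x)"
definition "x * y = Dual (std_part x * std_part y) (std_part x * eps_part y + eps_part x * std_part y)"

instance
  by standard
    (auto simp: zero_dual_def one_dual_def plus_dual_def minus_dual_def uminus_dual_def
      times_dual_def algebra_simps intro: dual.expand)

end

definition dual_of_poly :: "'a::comm_ring_1 poly \<Rightarrow> 'a dual"
  where "dual_of_poly f = Dual (coeff f 0) (coeff f 1)"

lemma dual_of_poly_hom:
  "dual_of_poly 1 = 1"
  "dual_of_poly (f + g) = dual_of_poly f + dual_of_poly g"
  "dual_of_poly (f * g) = dual_of_poly f * dual_of_poly g"
  by (simp_all add: dual_of_poly_def one_dual_def plus_dual_def times_dual_def coeff_mult add.commute)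

lemma surj_dual_of_poly: "surj (dual_of_poly :: 'a::comm_ring_1 poly \<Rightarrow> _)"
proof (rule surjI)
  show "dual_of_poly [:std_part x, eps_part x:] = x" for x :: "'a dual"
    by (simp add: dual_of_poly_def)
qed

lemma dual_of_poly_kernel:
  fixes f :: "'a::comm_ring_1 poly"
  shows "dual_of_poly f = 0 \<longleftrightarrow> monom 1 2 dvd f"
proof
  assume "dual_of_poly f = 0"
  then have "coeff f 0 = 0" "coeff f (Suc 0) = 0"
    by (simp_all add: dual_of_poly_def zero_dual_def)
  then have "\<forall>k<2. coeff f k = 0"
    by (auto simp: less_2_cases_iff)
  then have "f = monom 1 2 * poly_shift 2 f"
    by (intro poly_eqI) (auto simp: coeff_monom_mult coeff_poly_shift not_less dest!: le_Suc_ex)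
  then show "monom 1 2 dvd f" by (rule dvdI)
next
  assume "monom 1 2 dvd f"
  then show "dual_of_poly f = 0"
    by (auto simp: dual_of_poly_def zero_dual_def coeff_monom_mult elim!: dvdE)
qed


section \<open>Modules of functions and quotient modules\<close>

text \<open>In the records \<open>fun_module\<close> and \<open>quot_module\<close>, the fields \<open>mult\<close> and \<open>one\<close> play no role.\<close>

definition fun_module ::
  "('x \<Rightarrow> 'b) set \<Rightarrow> 'x set \<Rightarrow> ('k, 'b, 'c) module_scheme \<Rightarrow> ('k, 'x \<Rightarrow> 'b) module"
  where "fun_module F D M =
    \<lparr>carrier = F, monoid.mult = undefined, one = undefined,
     ring.zero = (\<lambda>x\<in>D. \<zero>\<^bsub>M\<^esub>),
     add = (\<lambda>f g. \<lambda>x\<in>D. f x \<oplus>\<^bsub>M\<^esub> g x),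
     module.smult = (\<lambda>c f. \<lambda>x\<in>D. c \<odot>\<^bsub>M\<^esub> f x)\<rparr>"

definition module_congruence :: "('k, 'b, 'c) module_scheme \<Rightarrow> ('b \<times> 'b) set \<Rightarrow> bool"
  where "module_congruence M r \<longleftrightarrow>
    equiv (carrier M) r \<and>
    (\<forall>(x, x')\<in>r. \<forall>(y, y')\<in>r. (x \<oplus>\<^bsub>M\<^esub> y, x' \<oplus>\<^bsub>M\<^esub> y') \<in> r) \<and>
    (\<forall>c. \<forall>(x, x')\<in>r. (c \<odot>\<^bsub>M\<^esub> x, c \<odot>\<^bsub>M\<^esub> x') \<in> r)"

definition quot_module ::
  "('k, 'b, 'c) module_scheme \<Rightarrow> ('b \<times> 'b) set \<Rightarrow> ('k, 'b set) module"
  where "quot_module M r =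
    \<lparr>carrier = carrier M // r, monoid.mult = undefined, one = undefined,
     ring.zero = r `` {\<zero>\<^bsub>M\<^esub>},
     add = (\<lambda>U V. \<Union>x\<in>U. \<Union>y\<in>V. r `` {x \<oplus>\<^bsub>M\<^esub> y}),
     module.smult = (\<lambda>c U. \<Union>x\<in>U. r `` {c \<odot>\<^bsub>M\<^esub> x})\<rparr>"

definition linear_iso ::
  "('k, 'b, 'c) module_scheme \<Rightarrow> ('k, 'd, 'e) module_scheme \<Rightarrow> ('b \<Rightarrow> 'd) \<Rightarrow> bool"
  where "linear_iso M N h \<longleftrightarrow>
    bij_betw h (carrier M) (carrier N) \<and>
    (\<forall>x\<in>carrier M. \<forall>y\<in>carrier M. h (x \<oplus>\<^bsub>M\<^esub> y) = h x \<oplus>\<^bsub>N\<^esub> h y) \<and>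
    (\<forall>c. \<forall>x\<in>carrier M. h (c \<odot>\<^bsub>M\<^esub> x) = c \<odot>\<^bsub>N\<^esub> h x)"


section \<open>Hochschild cohomology\<close>

text \<open>A \<open>k\<close>-algebra is given by a \<open>module\<close> record, whose \<open>mult\<close> and \<open>one\<close> are now relevant. The
  locale \<open>algebra\<close> is not used, as it requires \<open>A\<close> to be commutative.

  \<open>n\<close>-cochains, i.e. linear maps from the \<open>n\<close>-th tensor power of \<open>A\<close> to \<open>A\<close>, are multilinear
  maps on \<open>n\<close>-tuples.\<close>

definition tuples :: "('k, 'b, 'c) module_scheme \<Rightarrow> nat \<Rightarrow> 'b list set"
  where "tuples A n = {as. length as = n \<and> set as \<subseteq> carrier A}"

definition hoch_cochains :: "('k, 'b, 'c) module_scheme \<Rightarrow> nat \<Rightarrow> ('b list \<Rightarrow> 'b) set"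
  where "hoch_cochains A n =
    {f \<in> tuples A n \<rightarrow>\<^sub>E carrier A. \<forall>as\<in>tuples A n. \<forall>i<n.
      (\<forall>x\<in>carrier A. \<forall>y\<in>carrier A. f (as[i := x \<oplus>\<^bsub>A\<^esub> y]) = f (as[i := x]) \<oplus>\<^bsub>A\<^esub> f (as[i := y])) \<and>
      (\<forall>c. \<forall>x\<in>carrier A. f (as[i := c \<odot>\<^bsub>A\<^esub> x]) = c \<odot>\<^bsub>A\<^esub> f (as[i := x]))}"

definition hoch_diff ::
  "('k::comm_ring_1, 'b, 'c) module_scheme \<Rightarrow> nat \<Rightarrow> ('b list \<Rightarrow> 'b) \<Rightarrow> 'b list \<Rightarrow> 'b"
  where "hoch_diff A n f = (\<lambda>as\<in>tuples A (Suc n).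
    hd as \<otimes>\<^bsub>A\<^esub> f (tl as)
    \<oplus>\<^bsub>A\<^esub> (\<Oplus>\<^bsub>A\<^esub>i\<in>{..<n}. (- 1) ^ Suc i \<odot>\<^bsub>A\<^esub>
          f (take i as @ (as ! i \<otimes>\<^bsub>A\<^esub> as ! Suc i) # drop (i + 2) as))
    \<oplus>\<^bsub>A\<^esub> (- 1) ^ Suc n \<odot>\<^bsub>A\<^esub> (f (butlast as) \<otimes>\<^bsub>A\<^esub> last as))"

definition hoch_cocycles ::
  "('k::comm_ring_1, 'b, 'c) module_scheme \<Rightarrow> nat \<Rightarrow> ('b list \<Rightarrow> 'b) set"
  where "hoch_cocycles A n =
    {f \<in> hoch_cochains A n. hoch_diff A n f = (\<lambda>as\<in>tuples A (Suc n). \<zero>\<^bsub>A\<^esub>)}"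

definition hoch_coboundaries ::
  "('k::comm_ring_1, 'b, 'c) module_scheme \<Rightarrow> nat \<Rightarrow> ('b list \<Rightarrow> 'b) set"
  where "hoch_coboundaries A n =
    (case n of 0 \<Rightarrow> {\<lambda>as\<in>tuples A 0. \<zero>\<^bsub>A\<^esub>} | Suc m \<Rightarrow> hoch_diff A m ` hoch_cochains A m)"

definition HH ::
  "nat \<Rightarrow> ('k::comm_ring_1, 'b, 'c) module_scheme \<Rightarrow> ('k, ('b list \<Rightarrow> 'b) set) module"
  where "HH n A = (let Z = fun_module (hoch_cocycles A n) (tuples A n) A in
    quot_module Z {(f, g). f \<in> carrier Z \<and> g \<in> carrier Z \<and>
      (\<exists>h\<in>hoch_coboundaries A n. f = g \<oplus>\<^bsub>Z\<^esub> h)})"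


section \<open>Path algebras\<close>

text \<open>A finite quiver is a \<open>fin_digraph\<close>, with \<open>tail\<close> the source and \<open>head\<close> the target of an
  arrow. A path is given by its source and the list of its arrows, so that \<open>(v, [])\<close> is the path
  of length 0 at \<open>v\<close>.\<close>

type_synonym ('v, 'a) qpath = "'v \<times> 'a list"

definition qpaths :: "('v, 'a) pre_digraph \<Rightarrow> ('v, 'a) qpath set"
  where "qpaths G = {(u, as). \<exists>v. pre_digraph.awalk G u as v}"

abbreviation src :: "('v, 'a) qpath \<Rightarrow> 'v"
  where "src p \<equiv> fst p"

definition tgt :: "('v, 'a) pre_digraph \<Rightarrow> ('v, 'a) qpath \<Rightarrow> 'v"
  where "tgt G p = pre_digraph.awlast G (fst p) (snd p)"

abbreviation plen :: "('v, 'a) qpath \<Rightarrow> nat"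
  where "plen p \<equiv> length (snd p)"

definition pcat :: "('v, 'a) qpath \<Rightarrow> ('v, 'a) qpath \<Rightarrow> ('v, 'a) qpath"
  where "pcat p q = (fst p, snd p @ snd q)"

definition factors ::
  "('v, 'a) pre_digraph \<Rightarrow> ('v, 'a) qpath \<Rightarrow> ('v, 'a) qpath \<Rightarrow> ('v, 'a) qpath \<Rightarrow> ('v, 'a) qpath \<Rightarrow> bool"
  where "factors G p q s r \<longleftrightarrow>
    q \<in> qpaths G \<and> s \<in> qpaths G \<and> r \<in> qpaths G \<and> tgt G q = src s \<and> tgt G s = src r \<and>
    p = pcat (pcat q s) r"

definition subpath :: "('v, 'a) pre_digraph \<Rightarrow> ('v, 'a) qpath \<Rightarrow> ('v, 'a) qpath \<Rightarrow> bool"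
  where "subpath G s p \<longleftrightarrow> (\<exists>q r. factors G p q s r)"

definition parallel :: "('v, 'a) pre_digraph \<Rightarrow> ('v, 'a) qpath \<Rightarrow> ('v, 'a) qpath \<Rightarrow> bool"
  where "parallel G p q \<longleftrightarrow> src p = src q \<and> tgt G p = tgt G q"

text \<open>The elements of the path algebra over the coefficient ring \<open>'r\<close> are finitely supported
  functions on paths. Both \<open>'r = k\<close> and \<open>'r = k[t]/(t^2)\<close> will be used.\<close>

type_synonym ('v, 'a, 'r) pelem = "('v, 'a) qpath \<Rightarrow>\<^sub>0 'r"

abbreviation path_elem :: "('v, 'a) qpath \<Rightarrow> ('v, 'a, 'r::comm_ring_1) pelem"
  where "path_elem p \<equiv> Poly_Mapping.single p 1"

definition scal :: "'r::comm_ring_1 \<Rightarrow> ('v, 'a, 'r) pelem \<Rightarrow> ('v, 'a, 'r) pelem"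
  where "scal c x = Poly_Mapping.map ((*) c) x"

definition pmul ::
  "('v, 'a) pre_digraph \<Rightarrow> ('v, 'a, 'r::comm_ring_1) pelem \<Rightarrow> ('v, 'a, 'r) pelem \<Rightarrow> ('v, 'a, 'r) pelem"
  where "pmul G x y = (\<Sum>p\<in>Poly_Mapping.keys x. \<Sum>q\<in>Poly_Mapping.keys y.
    if tgt G p = src q
    then Poly_Mapping.single (pcat p q) (Poly_Mapping.lookup x p * Poly_Mapping.lookup y q)
    else 0)"

definition pspan :: "('v, 'a) qpath set \<Rightarrow> ('v, 'a, 'r::comm_ring_1) pelem set"
  where "pspan P = {x. Poly_Mapping.keys x \<subseteq> P}"

definition path_algebra ::
  "('v, 'a) pre_digraph \<Rightarrow> ('r::comm_ring_1, ('v, 'a, 'r) pelem) module"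
  where "path_algebra G =
    \<lparr>carrier = pspan (qpaths G), monoid.mult = pmul G, one = (\<Sum>v\<in>verts G. path_elem (v, [])),
     ring.zero = 0, add = (+), module.smult = scal\<rparr>"

text \<open>The factor ring \<open>M Quot I\<close>, together with its scalar multiplication.\<close>

definition quot_algebra ::
  "('k, 'b, 'c) module_scheme \<Rightarrow> 'b set \<Rightarrow> ('k, 'b set) module"
  where "quot_algebra M I =
    ring.extend (M Quot I) (module.fields (\<lambda>c U. \<Union>x\<in>U. I +>\<^bsub>M\<^esub> (c \<odot>\<^bsub>M\<^esub> x)))"

definition linear_ext ::
  "(('v, 'a) qpath \<Rightarrow> ('v, 'a, 'r::comm_ring_1) pelem) \<Rightarrow> ('v, 'a, 'r) pelem \<Rightarrow> ('v, 'a, 'r) pelem"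
  where "linear_ext f x = (\<Sum>p\<in>Poly_Mapping.keys x. scal (Poly_Mapping.lookup x p) (f p))"

text \<open>Homomorphisms of bimodules over \<open>kQ_0\<close>, where \<open>M\<close> and \<open>N\<close> are subbimodules of the path
  algebra.\<close>

definition bimod_hom ::
  "('v, 'a) pre_digraph \<Rightarrow> ('v, 'a, 'r::comm_ring_1) pelem set \<Rightarrow> ('v, 'a, 'r) pelem set
    \<Rightarrow> (('v, 'a, 'r) pelem \<Rightarrow> ('v, 'a, 'r) pelem) set"
  where "bimod_hom G M N =
    {f \<in> M \<rightarrow>\<^sub>E N.
      (\<forall>x\<in>M. \<forall>y\<in>M. f (x + y) = f x + f y) \<and>
      (\<forall>c. \<forall>x\<in>M. f (scal c x) = scal c (f x)) \<and>
      (\<forall>u\<in>verts G. \<forall>v\<in>verts G. \<forall>x\<in>M.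
        f (pmul G (pmul G (path_elem (u, [])) x) (path_elem (v, []))) =
        pmul G (pmul G (path_elem (u, [])) (f x)) (path_elem (v, [])))}"


section \<open>Reduction systems\<close>

text \<open>A reduction system is given by the set \<open>S\<close> and a function \<open>\<phi>\<close>, of which only the values on
  \<open>S\<close> matter. The notions concerning reductions are defined for arbitrary coefficients.\<close>

definition irr :: "('v, 'a) pre_digraph \<Rightarrow> ('v, 'a) qpath set \<Rightarrow> ('v, 'a) qpath set"
  where "irr G S = {p \<in> qpaths G. \<not> (\<exists>s\<in>S. subpath G s p)}"

definition reduction_system ::
  "('v, 'a) pre_digraph \<Rightarrow> ('v, 'a) qpath set \<Rightarrow> (('v, 'a) qpath \<Rightarrow> ('v, 'a, 'r::comm_ring_1) pelem) \<Rightarrow> bool"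
  where "reduction_system G S \<phi> \<longleftrightarrow>
    S \<subseteq> {p \<in> qpaths G. plen p \<ge> 2} \<and>
    (\<forall>s\<in>S. \<forall>s'\<in>S. s \<noteq> s' \<longrightarrow> \<not> subpath G s s') \<and>
    (\<forall>s\<in>S. \<phi> s \<in> pspan {p \<in> irr G S. parallel G p s})"

definition replace ::
  "('v, 'a) pre_digraph \<Rightarrow> (('v, 'a) qpath \<Rightarrow> ('v, 'a, 'r::comm_ring_1) pelem)
    \<Rightarrow> ('v, 'a) qpath \<Rightarrow> ('v, 'a) qpath \<Rightarrow> ('v, 'a) qpath \<Rightarrow> ('v, 'a, 'r) pelem"
  where "replace G \<phi> q s r = pmul G (pmul G (path_elem q) (\<phi> s)) (path_elem r)"

definition basic_reductions ::
  "('v, 'a) pre_digraph \<Rightarrow> ('v, 'a) qpath set \<Rightarrow> (('v, 'a) qpath \<Rightarrow> ('v, 'a, 'r::comm_ring_1) pelem)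
    \<Rightarrow> (('v, 'a, 'r) pelem \<Rightarrow> ('v, 'a, 'r) pelem) set"
  where "basic_reductions G S \<phi> =
    {linear_ext (\<lambda>p'. if p' = p then replace G \<phi> q s r else path_elem p') | p q s r.
      s \<in> S \<and> factors G p q s r}"

inductive_set reductions ::
  "('v, 'a) pre_digraph \<Rightarrow> ('v, 'a) qpath set \<Rightarrow> (('v, 'a) qpath \<Rightarrow> ('v, 'a, 'r::comm_ring_1) pelem)
    \<Rightarrow> (('v, 'a, 'r) pelem \<Rightarrow> ('v, 'a, 'r) pelem) set"
  for G S \<phi> where
  id: "id \<in> reductions G S \<phi>"
| comp: "\<rho> \<in> reductions G S \<phi> \<Longrightarrow> \<beta> \<in> basic_reductions G S \<phi> \<Longrightarrow> \<beta> \<circ> \<rho> \<in> reductions G S \<phi>"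

text \<open>The value \<open>y n\<close> is the result of applying the first \<open>n\<close> members of the sequence of
  reductions \<open>\<rho>\<close> to \<open>p\<close>.\<close>

definition reduction_finite ::
  "('v, 'a) pre_digraph \<Rightarrow> ('v, 'a) qpath set \<Rightarrow> (('v, 'a) qpath \<Rightarrow> ('v, 'a, 'r::comm_ring_1) pelem)
    \<Rightarrow> ('v, 'a) qpath \<Rightarrow> bool"
  where "reduction_finite G S \<phi> p \<longleftrightarrow>
    (\<forall>\<rho> y. (\<forall>n. \<rho> n \<in> reductions G S \<phi>) \<and> y 0 = path_elem p \<and> (\<forall>n::nat. y (Suc n) = \<rho> n (y n))
      \<longrightarrow> (\<exists>N. \<forall>n\<ge>N. y n = y N))"

definition reduction_unique ::
  "('v, 'a) pre_digraph \<Rightarrow> ('v, 'a) qpath set \<Rightarrow> (('v, 'a) qpath \<Rightarrow> ('v, 'a, 'r::comm_ring_1) pelem)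
    \<Rightarrow> ('v, 'a) qpath \<Rightarrow> bool"
  where "reduction_unique G S \<phi> p \<longleftrightarrow>
    reduction_finite G S \<phi> p \<and>
    (\<forall>\<rho>\<in>reductions G S \<phi>. \<forall>\<rho>'\<in>reductions G S \<phi>.
      \<rho> (path_elem p) \<in> pspan (irr G S) \<longrightarrow> \<rho>' (path_elem p) \<in> pspan (irr G S) \<longrightarrow>
      \<rho> (path_elem p) = \<rho>' (path_elem p))"

definition diamond ::
  "('v, 'a) pre_digraph \<Rightarrow> ('v, 'a) qpath set \<Rightarrow> (('v, 'a) qpath \<Rightarrow> ('v, 'a, 'r::comm_ring_1) pelem)
    \<Rightarrow> ('v, 'a, 'r) pelem set \<Rightarrow> bool"
  where "diamond G S \<phi> I \<longleftrightarrow>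
    I = genideal (path_algebra G) {path_elem s - \<phi> s | s. s \<in> S} \<and>
    (\<forall>p\<in>qpaths G. reduction_unique G S \<phi> p)"

definition rightmost_factors ::
  "('v, 'a) pre_digraph \<Rightarrow> ('v, 'a) qpath set \<Rightarrow> ('v, 'a) qpath
    \<Rightarrow> ('v, 'a) qpath \<times> ('v, 'a) qpath \<times> ('v, 'a) qpath \<Rightarrow> bool"
  where "rightmost_factors G S p = (\<lambda>(q, s, r). s \<in> S \<and> factors G p q s r \<and>
    (\<forall>q' s' r'. s' \<in> S \<and> factors G p q' s' r' \<longrightarrow> plen q' \<le> plen q))"

text \<open>For a reduction system, the rightmost factorization is unique, as no member of \<open>S\<close> is a
  subpath of another one.\<close>

definition red ::
  "('v, 'a) pre_digraph \<Rightarrow> ('v, 'a) qpath set \<Rightarrow> (('v, 'a) qpath \<Rightarrow> ('v, 'a, 'r::comm_ring_1) pelem)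
    \<Rightarrow> ('v, 'a, 'r) pelem \<Rightarrow> ('v, 'a, 'r) pelem"
  where "red G S \<phi> = linear_ext (\<lambda>p.
    if p \<in> irr G S then path_elem p
    else (case (THE f. rightmost_factors G S p f) of (q, s, r) \<Rightarrow> replace G \<phi> q s r))"

text \<open>\<open>red\<close> fixes linear combinations of irreducible paths, so that iterating it reaches at most one
  such combination; it reaches one if all paths are reduction-finite.\<close>

definition red_inf ::
  "('v, 'a) pre_digraph \<Rightarrow> ('v, 'a) qpath set \<Rightarrow> (('v, 'a) qpath \<Rightarrow> ('v, 'a, 'r::comm_ring_1) pelem)
    \<Rightarrow> ('v, 'a, 'r) pelem \<Rightarrow> ('v, 'a, 'r) pelem"
  where "red_inf G S \<phi> x = (THE y. y \<in> pspan (irr G S) \<and> (\<exists>n. y = (red G S \<phi> ^^ n) x))"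


section \<open>First-order deformations\<close>

definition deform ::
  "(('v, 'a) qpath \<Rightarrow> ('v, 'a, 'k::comm_ring_1) pelem)
    \<Rightarrow> (('v, 'a, 'k) pelem \<Rightarrow> ('v, 'a, 'k) pelem) \<Rightarrow> ('v, 'a) qpath \<Rightarrow> ('v, 'a, 'k dual) pelem"
  where "deform \<phi> \<psi> s =
    Poly_Mapping.map (\<lambda>c. Dual c 0) (\<phi> s) + Poly_Mapping.map (\<lambda>c. Dual 0 c) (\<psi> (path_elem s))"

definition deformation_homs ::
  "('v, 'a) pre_digraph \<Rightarrow> ('v, 'a) qpath set
    \<Rightarrow> ('k::comm_ring_1, ('v, 'a, 'k) pelem \<Rightarrow> ('v, 'a, 'k) pelem) module"
  where "deformation_homs G S =
    fun_module (bimod_hom G (pspan S) (pspan (irr G S))) (pspan S) (path_algebra G)"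

definition first_order_deformations ::
  "('v, 'a) pre_digraph \<Rightarrow> ('v, 'a) qpath set \<Rightarrow> (('v, 'a) qpath \<Rightarrow> ('v, 'a, 'k::comm_ring_1) pelem)
    \<Rightarrow> (('v, 'a, 'k) pelem \<Rightarrow> ('v, 'a, 'k) pelem) set"
  where "first_order_deformations G S \<phi> =
    {\<psi> \<in> carrier (deformation_homs G S). \<forall>p\<in>qpaths G. reduction_unique G S (deform \<phi> \<psi>) p}"

text \<open>The product of the \<open>T (p_i)\<close> for \<open>p = p_1 ... p_m\<close> starts with the idempotent at the source of
  \<open>p\<close>. For \<open>m > 0\<close> this makes no difference, since \<open>T\<close> is a bimodule homomorphism, and for \<open>m = 0\<close>
  the condition follows from \<open>T (e_i) = e_i\<close>.\<close>

definition deformation_equiv ::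
  "('v, 'a) pre_digraph \<Rightarrow> ('v, 'a) qpath set \<Rightarrow> (('v, 'a) qpath \<Rightarrow> ('v, 'a, 'k::comm_ring_1) pelem)
    \<Rightarrow> ((('v, 'a, 'k) pelem \<Rightarrow> ('v, 'a, 'k) pelem) \<times> (('v, 'a, 'k) pelem \<Rightarrow> ('v, 'a, 'k) pelem)) set"
  where "deformation_equiv G S \<phi> = {(\<psi>, \<psi>').
    \<psi> \<in> first_order_deformations G S \<phi> \<and> \<psi>' \<in> first_order_deformations G S \<phi> \<and>
    (\<exists>T \<in> bimod_hom G (pspan (irr G S)) (pspan (irr G S)).
      bij_betw T (pspan (irr G S)) (pspan (irr G S)) \<and>
      (\<forall>x\<in>pspan (irr G S). \<forall>p.
        std_part (Poly_Mapping.lookup (T x) p) = std_part (Poly_Mapping.lookup x p)) \<and>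
      (\<forall>v\<in>verts G. T (path_elem (v, [])) = path_elem (v, [])) \<and>
      (\<forall>(u, as)\<in>qpaths G.
        T (red_inf G S (deform \<phi> \<psi>') (path_elem (u, as))) =
        red_inf G S (deform \<phi> \<psi>)
          (foldl (pmul G) (path_elem (u, [])) (map (\<lambda>a. T (path_elem (tail G a, [a]))) as))))}"

definition deformation_space ::
  "('v, 'a) pre_digraph \<Rightarrow> ('v, 'a) qpath set \<Rightarrow> (('v, 'a) qpath \<Rightarrow> ('v, 'a, 'k::comm_ring_1) pelem)
    \<Rightarrow> ('k, ('v, 'a, 'k) pelem \<Rightarrow> ('v, 'a, 'k) pelem) module"
  where "deformation_space G S \<phi> =
    (deformation_homs G S)\<lparr>carrier := first_order_deformations G S \<phi>\<rparr>"

end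

theory Submission
  imports Defs
begin

text \<open>Let \<open>N\<close> denote the normal form map from \<open>kQ\<close> onto the span of the irreducible paths. Its kernel is
  \<open>I\<close>, so that \<open>A\<close> is identified with this span, with the product \<open>x \<star> y = N(x y)\<close>.

  A first-order deformation \<open>\<psi>\<close> is described by the \<open>t\<close>-part \<open>D\<close> of the normal form map of the deformed
  reduction system, which is \<open>x \<mapsto> N(x) + D(x) t\<close> on \<open>kQ\<close>. The map \<open>D\<close> vanishes on irreducible paths and
  satisfies \<open>D(q s r) = D(q \<phi>\<^sub>s r) + N(q \<psi>\<^sub>s r)\<close>. Conversely, a map \<open>D\<close> with these properties makes all
  paths reduction-unique for the deformed system (\<open>deform_complete\<close>). Only termination has to be
  discussed here: in a sequence of reductions, the constant part becomes stationary first, and then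
  the \<open>t\<close>-part is reduced with respect to the original system.

  As normal forms are compatible with products, \<open>D(x y) = D(N x N y) + N x \<star> D y + D x \<star> N y\<close>. In other
  words, \<open>D\<close> is a 1-cochain of \<open>kQ\<close> that turns the Hochschild 2-cocycle \<open>(x, y) \<mapsto> D(x y)\<close> of \<open>A\<close> into a
  coboundary on \<open>kQ\<close>. Such a map \<open>D\<close> is called a trivialization below, and first-order deformations
  are the restrictions of trivializations to the span of \<open>S\<close> (\<open>first_order_deformations_iff\<close>). In
  particular they form a vector space, and the class of the cocycle depends linearly on \<open>\<psi>\<close>.

  Every class in \<open>HH\<^sup>2(A, A)\<close> arises in this way (\<open>cocycle_cohomologous_trivialization\<close>): as \<open>kQ\<^sub>0\<close> is
  separable, a 2-cocycle may be assumed to vanish if one argument is a vertex, and such a cocycle can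
  be trivialized on \<open>kQ\<close> by recursion on the length of paths, starting with \<open>0\<close> on the arrows. To make
  the trivialization vanish on irreducible paths, the cocycle is changed by a coboundary.

  It remains to compare the two equivalence relations (\<open>equiv_imp_cohomologous\<close> and
  \<open>cohomologous_imp_equiv\<close>). An automorphism \<open>T\<close> as in the definition of equivalence is of the form
  \<open>x \<mapsto> x + g(x) t\<close>, and the condition on it says that \<open>D' - D + g N\<close> is a derivation of \<open>kQ\<close> with values
  in \<open>A\<close>, because derivations vanishing on the vertices are given by their values on the arrows. By
  the product formulas for \<open>D\<close> and \<open>D'\<close>, this means that the cocycles of \<open>D'\<close> and \<open>D\<close> differ by the
  coboundary of \<open>g\<close>. Conversely, a cochain \<open>g\<close> whose coboundary is this difference can be modified by an
  inner derivation so that it vanishes on the vertices and defines a map \<open>T\<close>.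

  The definition of equivalence refers to iterated rightmost reduction. That this process stops
  (\<open>Red_terminates\<close>) requires a well-founded relation on paths, which is obtained from
  reduction-finiteness over a field (\<open>wf_succ_rel\<close>).\<close>

section \<open>Linear maps on finitely supported functions\<close>

lemma lookup_scal [simp]: "Poly_Mapping.lookup (scal c x) p = c * Poly_Mapping.lookup x p"
  by (auto simp: scal_def map.rep_eq when_def)

lemma scal_simps [simp]:
  "scal c 0 = 0" "scal 0 x = 0" "scal 1 x = x" "scal c (scal d x) = scal (c * d) x"
  "scal (- 1) x = - x" "scal c (- x) = - scal c x"
  "scal c (Poly_Mapping.single p a) = Poly_Mapping.single p (c * a)"
  by (auto intro!: poly_mapping_eqI simp: lookup_single when_def mult.assoc)

lemma scal_add: "scal c (x + y) = scal c x + scal c y"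
  and scal_diff: "scal c (x - y) = scal c x - scal c y"
  and scal_add_left: "scal (c + d) x = scal c x + scal d x"
  by (auto intro!: poly_mapping_eqI simp: lookup_add lookup_minus algebra_simps)

lemma scal_sum: "scal c (sum f A) = (\<Sum>a\<in>A. scal c (f a))"
  by (induction A rule: infinite_finite_induct) (auto simp: scal_add)

lemma keys_scal: "Poly_Mapping.keys (scal c x) \<subseteq> Poly_Mapping.keys x"
  by (auto simp: in_keys_iff)

text \<open>Linear maps are total, also where only their restriction to the span of some paths is of interest, so
  that they can be composed and added without side conditions. A map on such a span is extended to
  all elements by composing it with a projection.\<close>

definition linmap :: "(('v, 'a, 'r::comm_ring_1) pelem \<Rightarrow> ('v, 'a, 'r) pelem) \<Rightarrow> bool"
  where "linmap f \<longleftrightarrow> (\<forall>x y. f (x + y) = f x + f y) \<and> (\<forall>c x. f (scal c x) = scal c (f x))"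

lemma linmapI:
  "(\<And>x y. f (x + y) = f x + f y) \<Longrightarrow> (\<And>c x. f (scal c x) = scal c (f x)) \<Longrightarrow> linmap f"
  by (simp add: linmap_def)

lemma linmap_simps:
  assumes "linmap f"
  shows "f (x + y) = f x + f y" "f (scal c x) = scal c (f x)" "f 0 = 0" "f (- x) = - f x"
    "f (x - y) = f x - f y"
proof -
  show *: "f (x + y) = f x + f y" "f (scal c x) = scal c (f x)" for x y c
    using assms by (auto simp: linmap_def)
  show "f 0 = 0" using *(2)[of 0 0] by simp
  show **: "f (- x) = - f x" for x using *(2)[of "-1" x] by simp
  show "f (x - y) = f x - f y" using *(1)[of x "- y"] ** by simp
qed

lemma linmap_sum: "linmap f \<Longrightarrow> f (sum g A) = (\<Sum>a\<in>A. f (g a))"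
  by (induction A rule: infinite_finite_induct) (auto simp: linmap_simps)

lemma linmap_id [intro, simp]: "linmap (\<lambda>x. x)" and linmap_id' [intro, simp]: "linmap id"
  by (auto simp: linmap_def)

lemma linmap_zero [intro, simp]: "linmap (\<lambda>x. 0)"
  by (auto simp: linmap_def)

lemma linmap_comp: "linmap f \<Longrightarrow> linmap g \<Longrightarrow> linmap (\<lambda>x. f (g x))"
  by (auto simp: linmap_def)

lemma linmap_add: "linmap f \<Longrightarrow> linmap g \<Longrightarrow> linmap (\<lambda>x. f x + g x)"
  by (auto simp: linmap_def scal_add algebra_simps)

lemma linmap_diff: "linmap f \<Longrightarrow> linmap g \<Longrightarrow> linmap (\<lambda>x. f x - g x)"
  by (auto simp: linmap_def scal_diff algebra_simps)

lemma linmap_scal: "linmap f \<Longrightarrow> linmap (\<lambda>x. scal c (f x))"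
  by (auto simp: linmap_def scal_add mult.commute)

lemma linmap_setsum: "(\<And>a. a \<in> A \<Longrightarrow> linmap (f a)) \<Longrightarrow> linmap (\<lambda>x. \<Sum>a\<in>A. f a x)"
  by (induction A rule: infinite_finite_induct) (auto intro: linmap_add)

lemma linmap_funpow: "linmap f \<Longrightarrow> linmap (f ^^ n)"
  by (induction n) (auto simp: linmap_def)

lemma pelem_expand: "x = (\<Sum>p\<in>Poly_Mapping.keys x. scal (Poly_Mapping.lookup x p) (path_elem p))"
  by (rule poly_mapping_eqI)
    (auto simp: lookup_sum lookup_single when_def in_keys_iff sum.If_cases cong: if_cong)

lemma pspan_iff: "x \<in> pspan P \<longleftrightarrow> (\<forall>p. p \<notin> P \<longrightarrow> Poly_Mapping.lookup x p = 0)"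
  by (auto simp: pspan_def in_keys_iff)

lemma pspan_closed [simp, intro]:
  "0 \<in> pspan P" "x \<in> pspan P \<Longrightarrow> y \<in> pspan P \<Longrightarrow> x + y \<in> pspan P"
  "x \<in> pspan P \<Longrightarrow> y \<in> pspan P \<Longrightarrow> x - y \<in> pspan P" "x \<in> pspan P \<Longrightarrow> - x \<in> pspan P"
  "x \<in> pspan P \<Longrightarrow> scal c x \<in> pspan P"
  by (auto simp: pspan_iff lookup_add lookup_minus)

lemma pspan_single [intro]: "p \<in> P \<Longrightarrow> Poly_Mapping.single p c \<in> pspan P"
  by (auto simp: pspan_iff lookup_single when_def)

lemma path_elem_pspan_iff [simp]: "path_elem p \<in> pspan P \<longleftrightarrow> p \<in> P"
  by (simp add: pspan_def)

lemma pspan_sum [intro]: "(\<And>a. a \<in> A \<Longrightarrow> f a \<in> pspan P) \<Longrightarrow> sum f A \<in> pspan P"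
  by (induction A rule: infinite_finite_induct) auto

lemma pspan_mono: "P \<subseteq> P' \<Longrightarrow> x \<in> pspan P \<Longrightarrow> x \<in> pspan P'"
  by (auto simp: pspan_def)

lemma pspan_UNIV [simp]: "x \<in> pspan UNIV"
  by (auto simp: pspan_def)

lemma pspan_induct [consumes 1, case_names zero step]:
  assumes "x \<in> pspan P" "R 0"
    and "\<And>c p y. p \<in> P \<Longrightarrow> y \<in> pspan P \<Longrightarrow> R y \<Longrightarrow> R (scal c (path_elem p) + y)"
  shows "R x"
proof -
  have "finite K \<Longrightarrow> K \<subseteq> P \<Longrightarrow> R (\<Sum>p\<in>K. scal (Poly_Mapping.lookup x p) (path_elem p))" for K
  proof (induction K rule: finite_induct)
    case (insert p K)
    then show ?case
      using assms(3)[of p "\<Sum>p\<in>K. scal (Poly_Mapping.lookup x p) (path_elem p)" "Poly_Mapping.lookup x p"]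
      by (auto intro!: pspan_sum pspan_single)
  qed (simp add: assms)
  from this[of "Poly_Mapping.keys x"] assms(1) show ?thesis
    unfolding pspan_def by (subst pelem_expand) auto
qed

lemma linmap_eq_on:
  assumes "linmap f" "linmap g" "\<And>p. p \<in> P \<Longrightarrow> f (path_elem p) = g (path_elem p)" "x \<in> pspan P"
  shows "f x = g x"
  using assms(4)
  by (induction rule: pspan_induct) (simp_all only: linmap_simps[OF assms(1)] linmap_simps[OF assms(2)] assms(3))

lemma linmap_pspan:
  assumes "linmap f" "\<And>p. p \<in> P \<Longrightarrow> f (path_elem p) \<in> pspan P'" "x \<in> pspan P"
  shows "f x \<in> pspan P'"
  using assms(3)
  by (induction rule: pspan_induct) (use assms(1,2) in \<open>auto simp only: linmap_simps intro!: pspan_closed\<close>)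

lemma linear_ext_superset:
  assumes "finite K" "Poly_Mapping.keys x \<subseteq> K"
  shows "linear_ext f x = (\<Sum>p\<in>K. scal (Poly_Mapping.lookup x p) (f p))"
  unfolding linear_ext_def using assms
  by (intro sum.mono_neutral_left) (auto simp: in_keys_iff)

lemma linmap_linear_ext [intro, simp]: "linmap (linear_ext f)"
proof (rule linmapI)
  fix x y :: "('a, 'b, 'c) pelem" and c
  let ?K = "Poly_Mapping.keys x \<union> Poly_Mapping.keys y"
  show "linear_ext f (x + y) = linear_ext f x + linear_ext f y"
    using keys_add[of x y]
    by (subst (1 2 3) linear_ext_superset[of ?K]) (auto simp: lookup_add scal_add_left sum.distrib)
  show "linear_ext f (scal c x) = scal c (linear_ext f x)"
    using keys_scal[of c x]
    by (subst (1 2) linear_ext_superset[of "Poly_Mapping.keys x"]) (auto simp: scal_sum)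
qed

lemma linear_ext_path [simp]: "linear_ext f (path_elem p) = f p"
  by (simp add: linear_ext_def)


section \<open>The path algebra\<close>

lemma fst_pcat [simp]: "fst (pcat p q) = fst p"
  and snd_pcat [simp]: "snd (pcat p q) = snd p @ snd q"
  by (simp_all add: pcat_def)

lemma tgt_simps [simp]:
  "tgt G (u, []) = u" "tgt G (u, a # as) = tgt G (head G a, as)" "tgt G (u, as @ [a]) = head G a"
  by (auto simp: tgt_def pre_digraph.awalk_verts_conv)

lemma tgt_pcat [simp]: "tgt G p = fst q \<Longrightarrow> tgt G (pcat p q) = tgt G q"
  by (cases p; cases q) (auto simp: tgt_def pcat_def pre_digraph.awalk_verts_conv)

lemma pcat_assoc: "pcat (pcat p q) r = pcat p (pcat q r)"
  by (simp add: pcat_def)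

lemma pcat_vertex [simp]: "pcat p (v, []) = p"
  and vertex_pcat: "fst p = v \<Longrightarrow> pcat (v, []) p = p"
  by (cases p; simp add: pcat_def)+

lemma pmul_superset:
  assumes "finite K" "Poly_Mapping.keys x \<subseteq> K" "finite L" "Poly_Mapping.keys y \<subseteq> L"
  shows "pmul G x y = (\<Sum>p\<in>K. \<Sum>q\<in>L. if tgt G p = src q
    then Poly_Mapping.single (pcat p q) (Poly_Mapping.lookup x p * Poly_Mapping.lookup y q) else 0)"
proof -
  have "pmul G x y = (\<Sum>p\<in>K. \<Sum>q\<in>Poly_Mapping.keys y. if tgt G p = src q
    then Poly_Mapping.single (pcat p q) (Poly_Mapping.lookup x p * Poly_Mapping.lookup y q) else 0)"
    unfolding pmul_def using assms
    by (intro sum.mono_neutral_left) (simp_all add: in_keys_iff cong: if_cong)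
  also have "\<dots> = (\<Sum>p\<in>K. \<Sum>q\<in>L. if tgt G p = src q
    then Poly_Mapping.single (pcat p q) (Poly_Mapping.lookup x p * Poly_Mapping.lookup y q) else 0)"
    using assms by (intro sum.cong sum.mono_neutral_left) (auto simp: in_keys_iff)
  finally show ?thesis .
qed

lemma pmul_add_left: "pmul G (x + x') y = pmul G x y + pmul G x' y"
  using keys_add[of x x']
  by (subst (1 2 3) pmul_superset[of "Poly_Mapping.keys x \<union> Poly_Mapping.keys x'" _ "Poly_Mapping.keys y"])
    (auto simp: lookup_add algebra_simps single_add sum.distrib[symmetric] intro!: sum.cong)

lemma pmul_add_right: "pmul G x (y + y') = pmul G x y + pmul G x y'"
  using keys_add[of y y']
  by (subst (1 2 3) pmul_superset[of "Poly_Mapping.keys x" _ "Poly_Mapping.keys y \<union> Poly_Mapping.keys y'"])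
    (auto simp: lookup_add algebra_simps single_add sum.distrib[symmetric] intro!: sum.cong)

lemma pmul_scal_left: "pmul G (scal c x) y = scal c (pmul G x y)"
  using keys_scal[of c x]
  by (subst (1 2) pmul_superset[of "Poly_Mapping.keys x" _ "Poly_Mapping.keys y"])
    (auto simp: scal_sum mult.assoc intro!: sum.cong)

lemma pmul_scal_right: "pmul G x (scal c y) = scal c (pmul G x y)"
  using keys_scal[of c y]
  by (subst (1 2) pmul_superset[of "Poly_Mapping.keys x" _ "Poly_Mapping.keys y"])
    (auto simp: scal_sum mult.left_commute intro!: sum.cong)

lemma linmap_pmul_left: "linmap (\<lambda>x. pmul G x y)"
  and linmap_pmul_right: "linmap (\<lambda>y. pmul G x y)"
  by (auto intro!: linmapI simp: pmul_add_left pmul_add_right pmul_scal_left pmul_scal_right)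

lemmas pmul_linear = pmul_add_left pmul_add_right pmul_scal_left pmul_scal_right
  linmap_simps(3-5)[OF linmap_pmul_left] linmap_simps(3-5)[OF linmap_pmul_right]

lemma pmul_path:
  "pmul G (path_elem p) (path_elem q) = (if tgt G p = src q then path_elem (pcat p q) else 0)"
  by (simp add: pmul_def)

lemma bilinear_eq_on:
  assumes "\<And>y. linmap (\<lambda>x. f x y)" "\<And>x. linmap (f x)" "\<And>y. linmap (\<lambda>x. g x y)" "\<And>x. linmap (g x)"
    and "\<And>p q. p \<in> P \<Longrightarrow> q \<in> P' \<Longrightarrow> f (path_elem p) (path_elem q) = g (path_elem p) (path_elem q)"
    and "x \<in> pspan P" "y \<in> pspan P'"
  shows "f x y = g x y"
proof -
  have "f x (path_elem q) = g x (path_elem q)" if "q \<in> P'" for q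
    using linmap_eq_on[OF assms(1)[of "path_elem q"] assms(3)[of "path_elem q"] _ assms(6)] assms(5) that by blast
  then show ?thesis
    using linmap_eq_on[OF assms(2,4) _ assms(7)] by blast
qed

text \<open>This is an identity of finitely supported functions on all pairs, not only on the paths of \<open>G\<close>:
  whether two pairs can be concatenated depends on their ends only, and the ends of a concatenation
  are those of its factors even if the arrows inside do not fit together.\<close>

lemma pmul_assoc: "pmul G (pmul G x y) z = pmul G x (pmul G y z)"
proof -
  have l: "linmap (\<lambda>x. pmul G (pmul G x y) z)" "linmap (\<lambda>x. pmul G (pmul G y x) z)"
    "linmap (\<lambda>x. pmul G y (pmul G z x))" "linmap (\<lambda>x. pmul G y (pmul G x z))"
    "linmap (\<lambda>x. pmul G x z)" "linmap (pmul G z)" for y z :: "('a, 'b, 'c) pelem"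
    by (simp_all add: linmap_def pmul_linear)
  have 1: "pmul G (pmul G (path_elem p) (path_elem q)) (path_elem r) =
      pmul G (path_elem p) (pmul G (path_elem q) (path_elem r :: ('a, 'b, 'c) pelem))" for p q r
    by (simp add: pmul_path pcat_assoc pmul_linear)
  have 2: "pmul G (pmul G x y) (path_elem r) = pmul G x (pmul G y (path_elem r))" for r
    by (rule bilinear_eq_on[where f = "\<lambda>x y. pmul G (pmul G x y) (path_elem r)" and P = UNIV and P' = UNIV])
      (rule l 1 pspan_UNIV)+
  show ?thesis
    by (rule linmap_eq_on[where P = UNIV]) (rule l 2 pspan_UNIV)+
qed

lemma pmul_pspan:
  assumes "x \<in> pspan P" "y \<in> pspan P'"
    and "\<And>p q. p \<in> P \<Longrightarrow> q \<in> P' \<Longrightarrow> tgt G p = src q \<Longrightarrow> pcat p q \<in> P''"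
  shows "pmul G x y \<in> pspan P''"
  using assms unfolding pmul_def
  by (intro pspan_sum) (simp add: pspan_def subset_iff del: split_paired_All)

lemma Nil_in_qpaths: "(v, []) \<in> qpaths G \<longleftrightarrow> v \<in> verts G"
  by (auto simp: qpaths_def pre_digraph.awalk_def pre_digraph.cas.simps)

context wf_digraph
begin

lemma Cons_in_qpaths:
  "(u, a # as) \<in> qpaths G \<longleftrightarrow> a \<in> arcs G \<and> tail G a = u \<and> (head G a, as) \<in> qpaths G"
  by (auto simp: qpaths_def awalk_Cons_iff)

lemma tgt_awalk: "awalk (fst p) (snd p) v \<Longrightarrow> tgt G p = v"
  by (auto simp: tgt_def)

lemma qpaths_iff: "p \<in> qpaths G \<longleftrightarrow> awalk (fst p) (snd p) (tgt G p)"
  by (cases p) (auto simp: qpaths_def tgt_awalk)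

lemma qpaths_verts: "p \<in> qpaths G \<Longrightarrow> src p \<in> verts G" "p \<in> qpaths G \<Longrightarrow> tgt G p \<in> verts G"
  by (auto simp: qpaths_iff)

lemma pcat_in_qpaths: "p \<in> qpaths G \<Longrightarrow> q \<in> qpaths G \<Longrightarrow> tgt G p = src q \<Longrightarrow> pcat p q \<in> qpaths G"
  by (auto simp: qpaths_iff intro: awalk_appendI)

lemma arrow_in_qpaths: "a \<in> arcs G \<Longrightarrow> (tail G a, [a]) \<in> qpaths G"
  by (simp add: Cons_in_qpaths Nil_in_qpaths)

lemma snoc_in_qpaths:
  "(u, as @ [a]) \<in> qpaths G \<longleftrightarrow> (u, as) \<in> qpaths G \<and> a \<in> arcs G \<and> tail G a = tgt G (u, as)"
proof
  assume "(u, as @ [a]) \<in> qpaths G"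
  then obtain v where "awalk u (as @ [a]) v" unfolding qpaths_def by blast
  then obtain w where w: "awalk u as w" "awalk w [a] v"
    unfolding awalk_append_iff by blast
  then have "tgt G (u, as) = w" using tgt_awalk[of "(u, as)" w] by simp
  with w show "(u, as) \<in> qpaths G \<and> a \<in> arcs G \<and> tail G a = tgt G (u, as)"
    unfolding qpaths_def by (simp only: awalk_Cons_iff) blast
next
  assume "(u, as) \<in> qpaths G \<and> a \<in> arcs G \<and> tail G a = tgt G (u, as)"
  then have "pcat (u, as) (tail G a, [a]) \<in> qpaths G"
    by (intro pcat_in_qpaths arrow_in_qpaths) simp_all
  then show "(u, as @ [a]) \<in> qpaths G" unfolding pcat_def by simp
qed

lemma qpaths_induct [consumes 1, case_names vertex arrow]:
  assumes "p \<in> qpaths G" "\<And>v. v \<in> verts G \<Longrightarrow> R (v, [])"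
    and "\<And>a p. a \<in> arcs G \<Longrightarrow> p \<in> qpaths G \<Longrightarrow> src p = head G a \<Longrightarrow> R p \<Longrightarrow> R (tail G a, a # snd p)"
  shows "R p"
proof -
  have "(u, as) \<in> qpaths G \<Longrightarrow> R (u, as)" for u as
  proof (induction as arbitrary: u)
    case (Cons a as)
    then show ?case using assms(3)[of a "(head G a, as)"] by (auto simp: Cons_in_qpaths)
  qed (simp add: assms(2) Nil_in_qpaths)
  with assms(1) show ?thesis by (cases p) auto
qed

lemma qpaths_rev_induct [consumes 1, case_names vertex arrow]:
  assumes "p \<in> qpaths G" "\<And>v. v \<in> verts G \<Longrightarrow> R (v, [])"
    and "\<And>a p. a \<in> arcs G \<Longrightarrow> p \<in> qpaths G \<Longrightarrow> tgt G p = tail G a \<Longrightarrow> R p \<Longrightarrow> R (pcat p (tail G a, [a]))"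
  shows "R p"
proof -
  have "(u, as) \<in> qpaths G \<Longrightarrow> R (u, as)" for u as
  proof (induction as arbitrary: u rule: rev_induct)
    case (snoc a as)
    then show ?case using assms(3)[of a "(u, as)"] by (auto simp: snoc_in_qpaths pcat_def)
  qed (simp add: assms(2) Nil_in_qpaths)
  with assms(1) show ?thesis by (cases p) auto
qed

lemma pmul_in_pspan_qpaths:
  "x \<in> pspan (qpaths G) \<Longrightarrow> y \<in> pspan (qpaths G) \<Longrightarrow> pmul G x y \<in> pspan (qpaths G)"
  by (rule pmul_pspan) (auto intro: pcat_in_qpaths)

end

section \<open>Reductions and normal forms\<close>

definition reduce_at ::
  "('v, 'a) qpath \<Rightarrow> ('v, 'a, 'r::comm_ring_1) pelem \<Rightarrow> ('v, 'a, 'r) pelem \<Rightarrow> ('v, 'a, 'r) pelem"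
  where "reduce_at p y = linear_ext (\<lambda>p'. if p' = p then y else path_elem p')"

lemma linmap_reduce_at [simp, intro]: "linmap (reduce_at p y)"
  by (simp add: reduce_at_def)

lemma reduce_at_path: "reduce_at p y (path_elem p') = (if p' = p then y else path_elem p')"
  by (simp add: reduce_at_def)

lemma reduce_at_eq: "reduce_at p y x = x + scal (Poly_Mapping.lookup x p) (y - path_elem p)"
proof -
  have l: "linmap (\<lambda>x. x + scal (Poly_Mapping.lookup x p) (y - path_elem p))"
    by (rule linmapI) (simp_all add: lookup_add scal_add_left scal_add)
  show ?thesis
    by (rule linmap_eq_on[OF linmap_reduce_at l, of UNIV])
      (auto simp: reduce_at_path lookup_single when_def)
qed

text \<open>The coefficient ring is left open, since the notions below are used for the given system \<open>\<phi>\<close> over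
  the field as well as for its deformations, over the dual numbers.\<close>

locale red_system = wf_digraph Q for Q :: "('v, 'a) pre_digraph" +
  fixes S :: "('v, 'a) qpath set" and \<phi> :: "('v, 'a) qpath \<Rightarrow> ('v, 'a, 'r::comm_ring_1) pelem"
  assumes reduction_system: "reduction_system Q S \<phi>"
begin

abbreviation mul (infixl "\<cdot>" 70) where "x \<cdot> y \<equiv> pmul Q x y"
abbreviation "paths \<equiv> qpaths Q"
abbreviation "Irr \<equiv> irr Q S"
abbreviation "kQ \<equiv> pspan (qpaths Q)"
abbreviation "kIrr \<equiv> pspan (irr Q S)"

lemma S_paths: "s \<in> S \<Longrightarrow> s \<in> paths"
  and S_length: "s \<in> S \<Longrightarrow> plen s \<ge> 2"
  and \<phi>_pspan: "s \<in> S \<Longrightarrow> \<phi> s \<in> pspan {p \<in> Irr. parallel Q p s}"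
  using reduction_system unfolding reduction_system_def by blast+

lemma Irr_paths: "p \<in> Irr \<Longrightarrow> p \<in> paths"
  by (simp add: irr_def)

lemma pspan_Irr_paths: "x \<in> kIrr \<Longrightarrow> x \<in> kQ"
  using Irr_paths by (auto simp: pspan_def)

lemma factorsD:
  assumes "factors Q p q s r"
  shows "p \<in> paths" "path_elem p = path_elem q \<cdot> path_elem s \<cdot> (path_elem r :: ('v, 'a, 'r) pelem)"
  using assms unfolding factors_def by (auto simp: pmul_path intro!: pcat_in_qpaths)

lemma short_irr: "p \<in> paths \<Longrightarrow> plen p < 2 \<Longrightarrow> p \<in> Irr"
  using S_length by (fastforce simp: irr_def subpath_def factors_def)

lemma vertex_irr: "v \<in> verts Q \<Longrightarrow> (v, []) \<in> Irr"
  and arrow_irr: "a \<in> arcs Q \<Longrightarrow> (tail Q a, [a]) \<in> Irr"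
  by (auto intro!: short_irr arrow_in_qpaths simp: Nil_in_qpaths)

lemma reducible: "p \<in> paths \<Longrightarrow> p \<notin> Irr \<Longrightarrow> \<exists>q s r. s \<in> S \<and> factors Q p q s r"
  unfolding irr_def subpath_def by blast

lemma not_irr: "s \<in> S \<Longrightarrow> factors Q p q s r \<Longrightarrow> p \<notin> Irr"
  unfolding irr_def subpath_def by blast

lemma replace_pspan:
  assumes "s \<in> S" "factors Q p q s r"
  shows "replace Q \<phi> q s r \<in> pspan {pcat (pcat q t) r | t. t \<in> Irr \<and> parallel Q t s \<and> factors Q (pcat (pcat q t) r) q t r}"
proof -
  have "path_elem q \<cdot> \<phi> s \<in> pspan {pcat q t | t. t \<in> Irr \<and> parallel Q t s \<and> tgt Q q = src t}"
    by (rule pmul_pspan[of _ "{q}", OF _ \<phi>_pspan[OF assms(1)]]) auto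
  then show ?thesis
    unfolding replace_def
    by (rule pmul_pspan[of _ _ _ "{r}"])
      (use assms(2) in \<open>auto simp: factors_def dest: Irr_paths\<close>)
qed

lemma replace_paths: "s \<in> S \<Longrightarrow> factors Q p q s r \<Longrightarrow> replace Q \<phi> q s r \<in> kQ"
  using replace_pspan[of s p q r] by (rule pspan_mono[rotated]) (auto dest: factorsD)

text \<open>If \<open>q s r\<close> occurred in \<open>q \<phi>\<^sub>s r\<close>, then \<open>s\<close> would be one of the irreducible paths in \<open>\<phi>\<^sub>s\<close>.\<close>

lemma replace_lookup:
  assumes "s \<in> S" "factors Q p q s r"
  shows "Poly_Mapping.lookup (replace Q \<phi> q s r) p = 0"
proof -
  have "p \<noteq> pcat (pcat q t) r" if "t \<in> Irr" "parallel Q t s" for t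
  proof
    assume "p = pcat (pcat q t) r"
    then have "t = s" using assms(2) that(2) by (auto simp: factors_def parallel_def pcat_def prod_eq_iff)
    moreover have "factors Q s (src s, []) s (tgt Q s, [])"
      using S_paths[OF assms(1)] qpaths_verts
      by (auto simp: factors_def Nil_in_qpaths pcat_def)
    ultimately show False using that(1) assms(1) by (auto simp: irr_def subpath_def)
  qed
  with replace_pspan[OF assms] show ?thesis unfolding pspan_iff by blast
qed

lemma basic_reductions_iff:
  "\<beta> \<in> basic_reductions Q S \<phi> \<longleftrightarrow>
    (\<exists>p q s r. s \<in> S \<and> factors Q p q s r \<and> \<beta> = reduce_at p (replace Q \<phi> q s r))"
  unfolding basic_reductions_def reduce_at_def by blast

lemma basic_reductionI:
  "s \<in> S \<Longrightarrow> factors Q p q s r \<Longrightarrow> reduce_at p (replace Q \<phi> q s r) \<in> basic_reductions Q S \<phi>"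
  unfolding basic_reductions_iff by blast

lemma basic_in_reductions: "\<beta> \<in> basic_reductions Q S \<phi> \<Longrightarrow> \<beta> \<in> reductions Q S \<phi>"
  using reductions.comp[OF reductions.id, of \<beta> Q S \<phi>] by simp

lemma reductions_comp:
  "\<rho>' \<in> reductions Q S \<phi> \<Longrightarrow> \<rho> \<in> reductions Q S \<phi> \<Longrightarrow> \<rho>' \<circ> \<rho> \<in> reductions Q S \<phi>"
  by (induction rule: reductions.induct) (auto simp: comp_assoc intro: reductions.intros)

lemma reductions_induct [consumes 1, case_names id step]:
  assumes "\<rho> \<in> reductions Q S \<phi>" "R id"
    "\<And>\<rho> p q s r. \<rho> \<in> reductions Q S \<phi> \<Longrightarrow> R \<rho> \<Longrightarrow> s \<in> S \<Longrightarrow> factors Q p q s r \<Longrightarrow>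
      R (reduce_at p (replace Q \<phi> q s r) \<circ> \<rho>)"
  shows "R \<rho>"
  using assms by (induction rule: reductions.induct) (auto simp: basic_reductions_iff)

lemma linmap_reductions: "\<rho> \<in> reductions Q S \<phi> \<Longrightarrow> linmap \<rho>"
  by (induction rule: reductions_induct) (auto simp: comp_def intro: linmap_comp)

lemma reduce_at_paths:
  "s \<in> S \<Longrightarrow> factors Q p q s r \<Longrightarrow> x \<in> kQ \<Longrightarrow> reduce_at p (replace Q \<phi> q s r) x \<in> kQ"
  unfolding reduce_at_eq by (intro pspan_closed replace_paths) (auto dest: factorsD)

lemma reductions_paths: "\<rho> \<in> reductions Q S \<phi> \<Longrightarrow> x \<in> kQ \<Longrightarrow> \<rho> x \<in> kQ"
  by (induction rule: reductions_induct) (auto intro: reduce_at_paths)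

lemma reductions_irr: "\<rho> \<in> reductions Q S \<phi> \<Longrightarrow> x \<in> kIrr \<Longrightarrow> \<rho> x = x"
proof (induction rule: reductions_induct)
  case (step \<rho> p q s r)
  then have "p \<notin> Irr" by (intro not_irr)
  with step.prems have "Poly_Mapping.lookup x p = 0" by (simp add: pspan_iff del: split_paired_All)
  with step show ?case by (simp add: reduce_at_eq)
qed auto

lemma reduce_at_fixed:
  assumes "s \<in> S" "factors Q p q s r" "reduce_at p (replace Q \<phi> q s r) x = x"
  shows "Poly_Mapping.lookup x p = 0"
proof -
  have "Poly_Mapping.lookup (reduce_at p (replace Q \<phi> q s r) x) p = 0"
    using replace_lookup[OF assms(1,2)] by (simp add: reduce_at_eq lookup_add lookup_minus)
  then show ?thesis by (simp add: assms(3))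
qed

text \<open>A sequence of reductions that never reaches an irreducible element can be continued by a
  basic reduction that moves the element, which contradicts reduction-finiteness.\<close>

lemma reduction_finite_progress:
  assumes "reduction_finite Q S \<phi> p" "p \<in> paths" "\<rho> \<in> reductions Q S \<phi>"
  shows "\<exists>\<rho>'\<in>reductions Q S \<phi>. \<rho>' (\<rho> (path_elem p)) \<in> kIrr"
proof (rule ccontr)
  assume never: "\<not> ?thesis"
  define x0 where "x0 = \<rho> (path_elem p)"
  define reach where "reach = {\<rho>' x0 | \<rho>'. \<rho>' \<in> reductions Q S \<phi>}"
  have "\<exists>\<beta>\<in>reductions Q S \<phi>. \<beta> x \<noteq> x \<and> \<beta> x \<in> reach" if "x \<in> reach" for x
  proof -
    from that obtain \<rho>' where \<rho>': "\<rho>' \<in> reductions Q S \<phi>" "x = \<rho>' x0" by (auto simp: reach_def)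
    have "x \<in> kQ"
      unfolding \<rho>'(2) x0_def
      by (rule reductions_paths[OF \<rho>'(1) reductions_paths[OF assms(3)]]) (simp add: assms(2))
    moreover have "x \<notin> kIrr" using never \<rho>' unfolding x0_def by blast
    ultimately obtain p' where p': "p' \<in> paths" "p' \<notin> Irr" "Poly_Mapping.lookup x p' \<noteq> 0"
      unfolding pspan_iff by blast
    from reducible[OF p'(1,2)] obtain q s r where f: "s \<in> S" "factors Q p' q s r" by blast
    let ?\<beta> = "reduce_at p' (replace Q \<phi> q s r)"
    have "?\<beta> \<in> reductions Q S \<phi>" by (intro basic_in_reductions basic_reductionI f)
    moreover have "?\<beta> x \<noteq> x" using reduce_at_fixed[OF f] p'(3) by blast
    moreover have "?\<beta> x \<in> reach" unfolding reach_def
      using reductions_comp[OF calculation(1) \<rho>'(1)] \<rho>'(2) by (auto intro!: exI[of _ "?\<beta> \<circ> \<rho>'"])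
    ultimately show ?thesis by blast
  qed
  then obtain b where b: "b x \<in> reductions Q S \<phi>" "b x x \<noteq> x" "b x x \<in> reach" if "x \<in> reach" for x
    by metis
  define z :: "nat \<Rightarrow> ('v, 'a, 'r) pelem" where "z n = ((\<lambda>x. b x x) ^^ n) x0" for n
  have z: "z n \<in> reach" for n
    by (induction n) (auto simp: z_def b, auto simp: reach_def intro!: exI[of _ id] reductions.id)
  \<comment> \<open>The sequence starts with the path itself: \<open>\<rho>\<close> is applied first, and then the element is moved
    in each step.\<close>
  define seq where "seq n = (case n of 0 \<Rightarrow> \<rho> | Suc m \<Rightarrow> b (z m))" for n
  define y where "y n = (case n of 0 \<Rightarrow> path_elem p | Suc m \<Rightarrow> z m)" for n
  have "\<forall>n. seq n \<in> reductions Q S \<phi>" "y 0 = path_elem p" "\<forall>n. y (Suc n) = seq n (y n)"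
    using z assms(3) b by (auto simp: seq_def y_def z_def x0_def split: nat.split)
  with assms(1) obtain N where N: "\<And>n. n \<ge> N \<Longrightarrow> y n = y N"
    unfolding reduction_finite_def by blast
  from N[of "Suc N"] N[of "Suc (Suc N)"] have "z (Suc N) = z N" by (simp add: y_def)
  with b(2)[OF z, of N] show False by (simp add: z_def)
qed

text \<open>Once a path has become irreducible, no later reduction moves the result. So the paths can be treated
  one after the other, and each of them uses only its own reduction-finiteness. This yields
  reductions that work for linear combinations, without an order on the paths.\<close>

lemma simultaneous_progress:
  assumes "finite K" "K \<subseteq> paths" "\<And>p. p \<in> K \<Longrightarrow> reduction_finite Q S \<phi> p" "\<rho> \<in> reductions Q S \<phi>"
  shows "\<exists>\<rho>'\<in>reductions Q S \<phi>. \<forall>p\<in>K. \<rho>' (\<rho> (path_elem p)) \<in> kIrr"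
  using assms
proof (induction K arbitrary: \<rho> rule: finite_induct)
  case empty
  then show ?case using reductions.id by blast
next
  case (insert p K)
  then obtain \<rho>1 where 1: "\<rho>1 \<in> reductions Q S \<phi>" "\<rho>1 (\<rho> (path_elem p)) \<in> kIrr"
    using reduction_finite_progress[of p \<rho>] by blast
  obtain \<rho>2 where 2: "\<rho>2 \<in> reductions Q S \<phi>" "\<forall>p\<in>K. \<rho>2 ((\<rho>1 \<circ> \<rho>) (path_elem p)) \<in> kIrr"
    using insert.IH[OF _ _ reductions_comp[OF 1(1) insert.prems(3)]] insert.prems(1,2) by auto
  from 1 2 have "\<forall>q\<in>insert p K. (\<rho>2 \<circ> \<rho>1) (\<rho> (path_elem q)) \<in> kIrr"
    by (auto simp: reductions_irr)
  then show ?case using reductions_comp[OF 2(1) 1(1)] by blast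
qed

lemma reduction_invariant:
  assumes "linmap M" "\<And>p q s r. s \<in> S \<Longrightarrow> factors Q p q s r \<Longrightarrow> M (replace Q \<phi> q s r) = M (path_elem p)"
    and "\<rho> \<in> reductions Q S \<phi>"
  shows "M (\<rho> x) = M x"
  using assms(3)
  by (induction rule: reductions_induct) (auto simp: reduce_at_eq linmap_simps[OF assms(1)] assms(2))

end


locale complete_red_system = red_system Q S \<phi>
  for Q :: "('v, 'a) pre_digraph" and S and \<phi> :: "('v, 'a) qpath \<Rightarrow> ('v, 'a, 'r::comm_ring_1) pelem" +
  assumes reduction_unique: "p \<in> qpaths Q \<Longrightarrow> reduction_unique Q S \<phi> p"
begin

text \<open>Pairs that are no paths are sent to \<open>0\<close>, so that \<open>nf\<close> is a linear map defined everywhere.\<close>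

definition nf :: "('v, 'a, 'r) pelem \<Rightarrow> ('v, 'a, 'r) pelem"
  where "nf = linear_ext (\<lambda>p. if p \<in> paths
    then SOME y. y \<in> kIrr \<and> (\<exists>\<rho>\<in>reductions Q S \<phi>. y = \<rho> (path_elem p)) else 0)"

lemma linmap_nf: "linmap nf"
  by (simp add: nf_def)

lemma nf_pathI:
  assumes "p \<in> paths" "\<rho> \<in> reductions Q S \<phi>" "\<rho> (path_elem p) \<in> kIrr"
  shows "nf (path_elem p) = \<rho> (path_elem p)"
proof -
  let ?P = "\<lambda>y. y \<in> kIrr \<and> (\<exists>\<rho>\<in>reductions Q S \<phi>. y = \<rho> (path_elem p))"
  have "?P (\<rho> (path_elem p))" using assms by blast
  then have "?P (Eps ?P)" by (rule someI)
  then obtain \<rho>' where \<rho>': "\<rho>' \<in> reductions Q S \<phi>" "Eps ?P = \<rho>' (path_elem p)"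
    "\<rho>' (path_elem p) \<in> kIrr" by auto
  have "nf (path_elem p) = \<rho>' (path_elem p)"
    unfolding nf_def linear_ext_path if_P[OF assms(1)] \<rho>'(2) ..
  also have "\<dots> = \<rho> (path_elem p)"
    using reduction_unique[OF assms(1)] \<rho>'(1,3) assms(2,3) unfolding reduction_unique_def by blast
  finally show ?thesis .
qed

lemma nf_as_reduction:
  assumes "x \<in> kQ"
  shows "\<exists>\<rho>\<in>reductions Q S \<phi>. nf x = \<rho> x \<and> \<rho> x \<in> kIrr"
proof -
  let ?K = "Poly_Mapping.keys x"
  have K: "?K \<subseteq> paths" using assms by (simp add: pspan_def)
  then obtain \<rho> where \<rho>: "\<rho> \<in> reductions Q S \<phi>" "\<And>p. p \<in> ?K \<Longrightarrow> \<rho> (path_elem p) \<in> kIrr"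
    using simultaneous_progress[OF finite_keys K _ reductions.id] reduction_unique K
    unfolding reduction_unique_def id_apply by blast
  have x: "x \<in> pspan ?K" by (simp add: pspan_def)
  have "nf x = \<rho> x"
    by (rule linmap_eq_on[OF linmap_nf linmap_reductions[OF \<rho>(1)] _ x]) (use K \<rho> in \<open>auto intro: nf_pathI\<close>)
  moreover have "\<rho> x \<in> kIrr"
    by (rule linmap_pspan[OF linmap_reductions[OF \<rho>(1)] _ x]) (use \<rho> in auto)
  ultimately show ?thesis using \<rho>(1) by blast
qed

lemma nf_irr [simp]: "x \<in> kIrr \<Longrightarrow> nf x = x"
  using nf_as_reduction[OF pspan_Irr_paths] reductions_irr by metis

lemma nf_non_path: "p \<notin> paths \<Longrightarrow> nf (path_elem p) = 0"
  by (simp add: nf_def)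

lemma nf_pspan_Irr [simp, intro]: "nf x \<in> kIrr"
proof (rule linmap_pspan[OF linmap_nf, of UNIV])
  show "nf (path_elem p) \<in> kIrr" for p
    using nf_as_reduction[of "path_elem p"] nf_non_path[of p] by (cases "p \<in> paths") auto
qed simp

lemma nf_paths [simp, intro]: "nf x \<in> kQ"
  by (simp add: pspan_Irr_paths)

text \<open>A reduction that computes the normal form of \<open>q \<phi>\<^sub>s r\<close> becomes, when precomposed with the basic
  reduction at \<open>q s r\<close>, a reduction that computes the normal form of \<open>q s r\<close>.\<close>

lemma nf_replace:
  assumes "s \<in> S" "factors Q p q s r"
  shows "nf (replace Q \<phi> q s r) = nf (path_elem p)"
proof -
  from nf_as_reduction[OF replace_paths[OF assms]] obtain \<rho> where
    \<rho>: "\<rho> \<in> reductions Q S \<phi>" "nf (replace Q \<phi> q s r) = \<rho> (replace Q \<phi> q s r)"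
      "\<rho> (replace Q \<phi> q s r) \<in> kIrr" by blast
  have "nf (path_elem p) = (\<rho> \<circ> reduce_at p (replace Q \<phi> q s r)) (path_elem p)"
    using \<rho> assms
    by (intro nf_pathI reductions_comp[OF \<rho>(1)] basic_in_reductions basic_reductionI)
      (auto simp: reduce_at_path dest: factorsD)
  with \<rho> show ?thesis by (simp add: reduce_at_path)
qed

text \<open>This is how all properties of \<open>nf\<close> are derived: \<open>nf x\<close> is obtained from \<open>x\<close> by replacements, so that
  it suffices to check a single one.\<close>

lemma invariant_nf:
  assumes "linmap M" "\<And>p q s r. s \<in> S \<Longrightarrow> factors Q p q s r \<Longrightarrow> M (replace Q \<phi> q s r) = M (path_elem p)"
    and "x \<in> kQ"
  shows "M (nf x) = M x"
  using nf_as_reduction[OF assms(3)] reduction_invariant[OF assms(1,2)] by metis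

text \<open>A replacement inside \<open>x\<close> is also a replacement inside \<open>x y\<close>.\<close>

lemma nf_mult_left:
  assumes "x \<in> kQ" "y \<in> kQ"
  shows "nf (nf x \<cdot> y) = nf (x \<cdot> y)"
proof (rule invariant_nf[OF _ _ assms(1)])
  show "linmap (\<lambda>x. nf (x \<cdot> y))" by (rule linmap_comp[OF linmap_nf linmap_pmul_left])
  fix p q s r assume f: "s \<in> S" "factors Q p q s r"
  show "nf (replace Q \<phi> q s r \<cdot> y) = nf (path_elem p \<cdot> y)"
  proof (rule linmap_eq_on[OF _ _ _ assms(2)])
    show "linmap (\<lambda>y. nf (replace Q \<phi> q s r \<cdot> y))" "linmap (\<lambda>y. nf (path_elem p \<cdot> y))"
      by (rule linmap_comp[OF linmap_nf linmap_pmul_right])+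
    fix t assume t: "t \<in> paths"
    show "nf (replace Q \<phi> q s r \<cdot> path_elem t) = nf (path_elem p \<cdot> path_elem t)"
    proof (cases "tgt Q r = src t")
      case True
      have f': "factors Q (pcat p t) q s (pcat r t)"
        using f t True by (auto simp: factors_def pcat_assoc intro: pcat_in_qpaths)
      have "replace Q \<phi> q s r \<cdot> path_elem t = replace Q \<phi> q s (pcat r t)"
        using True by (simp add: replace_def pmul_assoc pmul_path)
      moreover have "tgt Q p = src t" using True f by (auto simp: factors_def)
      ultimately show ?thesis using nf_replace[OF f(1) f'] by (simp add: pmul_path)
    next
      case False
      then have "path_elem r \<cdot> path_elem t = (0 :: ('v, 'a, 'r) pelem)" by (simp add: pmul_path)
      then show ?thesis by (simp add: factorsD(2)[OF f(2)] replace_def pmul_assoc pmul_linear)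
    qed
  qed
qed

lemma nf_mult_right:
  assumes "x \<in> kQ" "y \<in> kQ"
  shows "nf (x \<cdot> nf y) = nf (x \<cdot> y)"
proof (rule invariant_nf[OF _ _ assms(2)])
  show "linmap (\<lambda>y. nf (x \<cdot> y))" by (rule linmap_comp[OF linmap_nf linmap_pmul_right])
  fix p q s r assume f: "s \<in> S" "factors Q p q s r"
  show "nf (x \<cdot> replace Q \<phi> q s r) = nf (x \<cdot> path_elem p)"
  proof (rule linmap_eq_on[OF _ _ _ assms(1)])
    show "linmap (\<lambda>x. nf (x \<cdot> replace Q \<phi> q s r))" "linmap (\<lambda>x. nf (x \<cdot> path_elem p))"
      by (rule linmap_comp[OF linmap_nf linmap_pmul_left])+
    fix t assume t: "t \<in> paths"
    show "nf (path_elem t \<cdot> replace Q \<phi> q s r) = nf (path_elem t \<cdot> path_elem p)"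
    proof (cases "tgt Q t = src q")
      case True
      have f': "factors Q (pcat t p) (pcat t q) s r"
        using f t True by (auto simp: factors_def pcat_assoc intro: pcat_in_qpaths)
      have "path_elem t \<cdot> replace Q \<phi> q s r = replace Q \<phi> (pcat t q) s r"
        using True by (simp add: replace_def pmul_assoc[symmetric] pmul_path)
      moreover have "tgt Q t = src p" using True f by (auto simp: factors_def)
      ultimately show ?thesis using nf_replace[OF f(1) f'] by (simp add: pmul_path)
    next
      case False
      then have "path_elem t \<cdot> path_elem q = (0 :: ('v, 'a, 'r) pelem)" by (simp add: pmul_path)
      then show ?thesis
        by (simp add: factorsD(2)[OF f(2)] replace_def pmul_assoc[symmetric] pmul_linear)
    qed
  qed
qed

end

section \<open>Termination of rightmost reduction\<close>

context red_system
begin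

text \<open>Two members of \<open>S\<close> that start at the same position of a path are comparable, and hence equal.\<close>

lemma rightmost_unique:
  assumes "rightmost_factors Q S p (q, s, r)" "rightmost_factors Q S p (q', s', r')"
  shows "(q, s, r) = (q', s', r')"
proof -
  have prefix: "s = s'" if s: "s \<in> S" "s' \<in> S" "src s = src s'" "snd s' = snd s @ t" for s s' t
  proof (rule ccontr)
    assume "s \<noteq> s'"
    obtain v where "awalk (src s') (snd s') v" using S_paths[OF s(2)] unfolding qpaths_iff by blast
    then obtain w where w: "awalk (src s) (snd s) w" "awalk w t v"
      using s(3,4) unfolding awalk_append_iff[symmetric] by (metis awalk_append_iff)
    then have "tgt Q s = w" by (rule_tac tgt_awalk)
    then have "(tgt Q s, t) \<in> paths" using w(2) unfolding qpaths_def by blast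
    moreover have "(src s, []) \<in> paths"
      using qpaths_verts(1)[OF S_paths[OF s(1)]] by (simp add: Nil_in_qpaths)
    ultimately have "factors Q s' (src s, []) s (tgt Q s, t)"
      using S_paths[OF s(1)] s(3,4) by (simp add: factors_def pcat_def prod_eq_iff)
    then have "subpath Q s s'" unfolding subpath_def by blast
    with \<open>s \<noteq> s'\<close> s reduction_system show False unfolding reduction_system_def by blast
  qed
  have f: "s \<in> S" "s' \<in> S" "factors Q p q s r" "factors Q p q' s' r'"
    using assms by (simp_all add: rightmost_factors_def)
  have "plen q \<le> plen q'" "plen q' \<le> plen q"
    using assms f unfolding rightmost_factors_def by blast+
  then have "plen q = plen q'" by simp
  moreover have "snd q @ snd s @ snd r = snd q' @ snd s' @ snd r'"
    using f(3,4) by (simp add: factors_def pcat_def)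
  ultimately have e: "snd q = snd q'" "snd s @ snd r = snd s' @ snd r'" by auto
  then have "q = q'" using f(3,4) by (simp add: factors_def pcat_def prod_eq_iff)
  then have "src s = src s'" using f(3,4) by (simp add: factors_def)
  moreover from e(2) obtain t where "snd s' = snd s @ t \<or> snd s = snd s' @ t"
    unfolding append_eq_append_conv2 by metis
  ultimately have "s = s'"
    using prefix[OF f(1,2)] prefix[OF f(2,1)] by metis
  then have "tgt Q s = tgt Q s'" "snd r = snd r'" using e(2) by simp_all
  then have "r = r'" using f(3,4) by (simp add: factors_def prod_eq_iff)
  with \<open>q = q'\<close> \<open>s = s'\<close> show ?thesis by simp
qed

lemma rightmost_exists:
  assumes "p \<in> paths" "p \<notin> Irr"
  shows "\<exists>q s r. rightmost_factors Q S p (q, s, r)"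
proof -
  define L where "L n \<longleftrightarrow> (\<exists>q s r. s \<in> S \<and> factors Q p q s r \<and> plen q = n)" for n
  have "L n \<Longrightarrow> n \<le> plen p" for n by (auto simp: L_def factors_def)
  moreover obtain n where "L n" using reducible[OF assms] unfolding L_def by blast
  ultimately obtain m where m: "L m" "\<And>n. L n \<Longrightarrow> n \<le> m"
    using Greatest_le_nat GreatestI_nat by metis
  then obtain q s r where qsr: "s \<in> S" "factors Q p q s r" "plen q = m" unfolding L_def by blast
  have "plen q' \<le> plen q" if "s' \<in> S \<and> factors Q p q' s' r'" for q' s' r'
    using m(2)[of "plen q'"] that qsr(3) unfolding L_def by blast
  with qsr have "rightmost_factors Q S p (q, s, r)" unfolding rightmost_factors_def by blast
  then show ?thesis by blast
qed

definition rightmost :: "('v, 'a) qpath \<Rightarrow> ('v, 'a) qpath \<times> ('v, 'a) qpath \<times> ('v, 'a) qpath"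
  where "rightmost p = (THE f. rightmost_factors Q S p f)"

lemma rightmost_factors_rightmost:
  assumes "p \<in> paths" "p \<notin> Irr"
  shows "rightmost_factors Q S p (rightmost p)"
proof -
  obtain f where f: "rightmost_factors Q S p f" using rightmost_exists[OF assms] by blast
  show ?thesis
    unfolding rightmost_def using f
  proof (rule theI)
    show "f' = f" if "rightmost_factors Q S p f'" for f'
      using rightmost_unique f that by (cases f; cases f') metis
  qed
qed

abbreviation Red where "Red \<equiv> red Q S \<phi>"

lemma linmap_Red: "linmap Red"
  by (simp add: red_def)

lemma Red_irr_path: "p \<in> Irr \<Longrightarrow> Red (path_elem p) = path_elem p"
  by (simp add: red_def)

lemma Red_irr: "x \<in> kIrr \<Longrightarrow> Red x = x"
  by (rule linmap_eq_on[OF linmap_Red linmap_id]) (simp_all add: Red_irr_path)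

lemma Red_pow_irr: "x \<in> kIrr \<Longrightarrow> (Red ^^ n) x = x"
  by (induction n) (simp_all add: Red_irr)

lemma Red_reducible_rightmost:
  "p \<notin> Irr \<Longrightarrow> rightmost p = (q, s, r) \<Longrightarrow> Red (path_elem p) = replace Q \<phi> q s r"
  by (simp add: red_def rightmost_def)

lemma Red_reducible:
  assumes "p \<in> paths" "p \<notin> Irr"
  shows "\<exists>q s r. rightmost p = (q, s, r) \<and> s \<in> S \<and> factors Q p q s r \<and> Red (path_elem p) = replace Q \<phi> q s r"
proof -
  obtain q s r where f: "rightmost p = (q, s, r)" by (cases "rightmost p")
  with rightmost_factors_rightmost[OF assms] have "s \<in> S" "factors Q p q s r"
    by (simp_all add: rightmost_factors_def)
  with Red_reducible_rightmost[OF assms(2) f] f show ?thesis by blast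
qed

lemma Red_paths: "x \<in> kQ \<Longrightarrow> Red x \<in> kQ"
proof (rule linmap_pspan[OF linmap_Red])
  fix p assume p: "p \<in> paths"
  show "Red (path_elem p) \<in> kQ"
  proof (cases "p \<in> Irr")
    case True
    then show ?thesis using p by (simp add: Red_irr_path)
  next
    case False
    from Red_reducible[OF p False] show ?thesis using replace_paths by metis
  qed
qed

lemma red_inf_eq:
  assumes "(Red ^^ n) x \<in> kIrr"
  shows "red_inf Q S \<phi> x = (Red ^^ n) x"
  unfolding red_inf_def
proof (rule the_equality)
  show "(Red ^^ n) x \<in> kIrr \<and> (\<exists>m. (Red ^^ n) x = (Red ^^ m) x)" using assms by blast
  fix y assume y: "y \<in> kIrr \<and> (\<exists>m. y = (Red ^^ m) x)"
  then obtain m where m: "y = (Red ^^ m) x" by blast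
  have "(Red ^^ (m + n)) x = (Red ^^ n) x" "(Red ^^ (n + m)) x = y"
    unfolding funpow_add using y assms by (simp_all add: Red_pow_irr m)
  then show "y = (Red ^^ n) x" by (simp add: add.commute)
qed

end

context complete_red_system
begin

lemma nf_Red: "x \<in> kQ \<Longrightarrow> nf (Red x) = nf x"
proof (rule linmap_eq_on[OF linmap_comp[OF linmap_nf linmap_Red] linmap_nf])
  fix p assume p: "p \<in> paths"
  show "nf (Red (path_elem p)) = nf (path_elem p)"
    using Red_reducible[OF p] nf_replace Red_irr_path by metis
qed

lemma nf_Red_pow: "x \<in> kQ \<Longrightarrow> nf ((Red ^^ n) x) = nf x"
proof -
  have "x \<in> kQ \<Longrightarrow> (Red ^^ n) x \<in> kQ \<and> nf ((Red ^^ n) x) = nf x"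
    by (induction n) (auto simp: Red_paths nf_Red)
  then show "x \<in> kQ \<Longrightarrow> nf ((Red ^^ n) x) = nf x" by blast
qed

lemma red_inf_nf:
  assumes "x \<in> kQ" "(Red ^^ n) x \<in> kIrr"
  shows "red_inf Q S \<phi> x = nf x"
  using red_inf_eq[OF assms(2)] nf_Red_pow[OF assms(1)] nf_irr[OF assms(2)] by metis

end


locale field_red_system = complete_red_system Q S \<phi>
  for Q :: "('v, 'a) pre_digraph" and S and \<phi> :: "('v, 'a) qpath \<Rightarrow> ('v, 'a, 'k::field) pelem"
begin

text \<open>Termination of the iterated rightmost reduction, which acts on all paths in the support at once, is
  proved by well-founded induction along this relation. Reduction-finiteness does not give its
  well-foundedness directly, because in a linear combination the path that continues a chain may be
  cancelled.\<close>

definition succ_rel :: "(('v, 'a) qpath \<times> ('v, 'a) qpath) set"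
  where "succ_rel = {(p', p). p \<in> paths \<and> p \<notin> Irr \<and> p' \<in> Poly_Mapping.keys (Red (path_elem p))}"

definition red_at :: "('v, 'a) qpath \<Rightarrow> ('v, 'a, 'k) pelem \<Rightarrow> ('v, 'a, 'k) pelem"
  where "red_at p = reduce_at p (Red (path_elem p))"

lemma red_at_reductions: "p \<in> paths \<Longrightarrow> p \<notin> Irr \<Longrightarrow> red_at p \<in> reductions Q S \<phi>"
  using Red_reducible[of p] basic_in_reductions basic_reductionI unfolding red_at_def by metis

lemma Red_lookup_self: "p \<in> paths \<Longrightarrow> p \<notin> Irr \<Longrightarrow> Poly_Mapping.lookup (Red (path_elem p)) p = 0"
  using Red_reducible[of p] replace_lookup by metis

lemma lookup_red_at:
  assumes "p \<in> paths" "p \<notin> Irr"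
  shows "Poly_Mapping.lookup (red_at p x) p' = (if p' = p then 0 else
    Poly_Mapping.lookup x p' + Poly_Mapping.lookup x p * Poly_Mapping.lookup (Red (path_elem p)) p')"
  using Red_lookup_self[OF assms]
  by (simp add: red_at_def reduce_at_eq lookup_add lookup_minus lookup_single when_def algebra_simps)

lemma eventually_constant:
  assumes "p \<in> paths" "\<And>n. \<rho> n \<in> reductions Q S \<phi>" "y 0 = path_elem p" "\<And>n. y (Suc n) = \<rho> n (y n)"
  shows "\<exists>N. \<forall>n\<ge>N. y n = y N"
  using reduction_unique[OF assms(1)] assms(2-4)
  unfolding reduction_unique_def reduction_finite_def by blast

text \<open>A finite set of paths in which every path has a successor contains a minimal such set, and there
  the successors are unique. If the reduction starts with one member of a minimal set, then the support
  always contains exactly one member, namely the next one on a cycle. So no cancellation occurs, and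
  the sequence never becomes stationary.\<close>

lemma no_finite_loop:
  assumes "finite C" "C \<noteq> {}" "\<And>p. p \<in> C \<Longrightarrow> \<exists>p'\<in>C. (p', p) \<in> succ_rel"
  shows False
  using assms
proof (induction C rule: finite_psubset_induct)
  case (psubset C)
  define good where "good \<sigma> \<longleftrightarrow> (\<forall>p\<in>C. \<sigma> p \<in> C \<and> (\<sigma> p, p) \<in> succ_rel)" for \<sigma>
  \<comment> \<open>The image of a successor function is again a set in which every path has a successor.\<close>
  have surj: "\<sigma> ` C = C" if "good \<sigma>" for \<sigma>
  proof (rule ccontr)
    assume "\<sigma> ` C \<noteq> C"
    with that have "\<sigma> ` C \<subset> C" by (auto simp: good_def)
    then show False
    proof (rule psubset.IH)
      show "\<sigma> ` C \<noteq> {}" using psubset.prems by simp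
      fix p assume p: "p \<in> \<sigma> ` C"
      then have "p \<in> C" using that by (auto simp: good_def)
      with that show "\<exists>p'\<in>\<sigma> ` C. (p', p) \<in> succ_rel"
        unfolding good_def by (intro bexI[of _ "\<sigma> p"]) blast+
    qed
  qed
  obtain \<sigma> where \<sigma>: "good \<sigma>" unfolding good_def using psubset.prems(2) by metis
  have inj: "inj_on \<sigma> C" using surj[OF \<sigma>] psubset.hyps by (simp add: eq_card_imp_inj_on)
  have unique: "p' = \<sigma> p" if p: "p \<in> C" "p' \<in> C" "(p', p) \<in> succ_rel" for p p'
  proof (rule ccontr)
    assume ne: "p' \<noteq> \<sigma> p"
    \<comment> \<open>If \<open>p\<close> is sent to \<open>p'\<close> instead, then the former successor of \<open>p\<close> must be reached from some other
      path, in contradiction to the injectivity of \<open>\<sigma>\<close>.\<close>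
    have "good (\<sigma>(p := p'))" using \<sigma> p by (simp add: good_def)
    then have "\<sigma> p \<in> (\<sigma>(p := p')) ` C" using surj \<sigma> p(1) by (metis good_def)
    then obtain z where z: "z \<in> C" "\<sigma> p = (\<sigma>(p := p')) z" by blast
    with ne have "z \<noteq> p" "\<sigma> z = \<sigma> p" by (auto split: if_splits)
    with inj z(1) p(1) show False by (auto dest: inj_onD)
  qed
  obtain p0 where p0: "p0 \<in> C" using psubset.prems by blast
  define c where "c n = (\<sigma> ^^ n) p0" for n
  have c: "c n \<in> C" for n by (induction n) (use \<sigma> p0 in \<open>auto simp: c_def good_def\<close>)
  have cs: "c (Suc n) = \<sigma> (c n)" for n by (simp add: c_def)
  have c': "c n \<in> paths" "c n \<notin> Irr" for n
    using \<sigma> c[of n] unfolding good_def succ_rel_def by blast+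
  define y where "y = rec_nat (path_elem p0) (\<lambda>n. red_at (c n))"
  have y: "y 0 = path_elem p0" "\<And>n. y (Suc n) = red_at (c n) (y n)" by (simp_all add: y_def)
  have succ: "Poly_Mapping.lookup (Red (path_elem (c n))) p \<noteq> 0 \<longleftrightarrow> p = c (Suc n)" if "p \<in> C" for n p
    using unique[OF c that, of n] \<sigma> c[of n] c'[of n]
    unfolding cs succ_rel_def good_def in_keys_iff by blast
  have single: "p \<in> C \<Longrightarrow> Poly_Mapping.lookup (y n) p \<noteq> 0 \<longleftrightarrow> p = c n" for n p
  proof (induction n arbitrary: p)
    case 0
    then show ?case by (simp add: y c_def lookup_single when_def)
  next
    case (Suc n)
    have "c (Suc n) \<noteq> c n" using succ[OF c, of n n] Red_lookup_self[OF c'] by metis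
    then show ?case
      using Suc.IH[OF Suc.prems] Suc.IH[OF c[of n]] succ[OF Suc.prems, of n]
      unfolding y(2) lookup_red_at[OF c'] by (cases "p = c n") simp_all
  qed
  have "p0 \<in> paths" using c'(1)[of 0] by (simp add: c_def)
  then have "\<exists>N. \<forall>n\<ge>N. y n = y N"
    by (rule eventually_constant[where \<rho> = "\<lambda>n. red_at (c n)"]) (use red_at_reductions[OF c'] y in \<open>auto simp only:\<close>)
  then obtain N where N: "\<forall>n\<ge>N. y n = y N" by blast
  have "y (Suc N) = y N" by (rule N[rule_format]) simp
  then have "c (Suc N) = c N" using single[OF c[of "Suc N"], of N] single[OF c[of "Suc N"], of "Suc N"] by simp
  then show False using succ[OF c[of N], of N] Red_lookup_self[OF c'(1,2)[of N]] by simp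
qed

text \<open>Along an infinite descending chain, the current path always belongs to the support if a step is
  skipped whenever the next path is in the support already: otherwise the next path is new and cannot be
  cancelled. When the sequence has become stationary, the rest of the chain lies in a finite support
  and so is a finite set as excluded by \<open>no_finite_loop\<close>.\<close>

lemma wf_succ_rel: "wf succ_rel"
  unfolding wf_iff_no_infinite_down_chain
proof
  assume "\<exists>f. \<forall>i. (f (Suc i), f i) \<in> succ_rel"
  then obtain f where f: "\<And>i. (f (Suc i), f i) \<in> succ_rel" by blast
  then have f': "f i \<in> paths" "f i \<notin> Irr" "Poly_Mapping.lookup (Red (path_elem (f i))) (f (Suc i)) \<noteq> 0" for i
    unfolding succ_rel_def in_keys_iff by blast+
  define \<rho> where "\<rho> n x = (if Poly_Mapping.lookup x (f (Suc n)) \<noteq> 0 then x else red_at (f n) x)" for n x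
  define y where "y = rec_nat (path_elem (f 0)) (\<lambda>n. \<rho> n)"
  have y: "y 0 = path_elem (f 0)" "\<And>n. y (Suc n) = \<rho> n (y n)" by (simp_all add: y_def)
  have inv: "Poly_Mapping.lookup (y n) (f n) \<noteq> 0" for n
  proof (induction n)
    case 0
    then show ?case by (simp add: y)
  next
    case (Suc n)
    have "f (Suc n) \<noteq> f n" using f'(3)[of n] Red_lookup_self[OF f'(1,2)] by metis
    then show ?case using Suc f'(3)[of n] by (simp add: y \<rho>_def lookup_red_at f')
  qed
  let ?\<rho> = "\<lambda>n. if Poly_Mapping.lookup (y n) (f (Suc n)) \<noteq> 0 then id else red_at (f n)"
  have "?\<rho> n \<in> reductions Q S \<phi>" "y (Suc n) = ?\<rho> n (y n)" for n
    using red_at_reductions[OF f'(1,2)] by (simp_all add: reductions.id y \<rho>_def)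
  then have "\<exists>N. \<forall>n\<ge>N. y n = y N"
    by (rule eventually_constant[where \<rho> = ?\<rho> and y = y, OF f'(1)[of 0] _ y(1)])
  then obtain N where N: "\<And>n. n \<ge> N \<Longrightarrow> y n = y N" by blast
  have sub: "f ` {N..} \<subseteq> Poly_Mapping.keys (y N)"
    unfolding in_keys_iff using inv N by (intro subsetI, unfold in_keys_iff) (metis imageE atLeast_iff)
  show False
  proof (rule no_finite_loop)
    show "finite (f ` {N..})" using sub finite_keys by (rule finite_subset)
    show "f ` {N..} \<noteq> {}" by simp
    fix p assume "p \<in> f ` {N..}"
    then obtain i where "i \<ge> N" "p = f i" by auto
    with f[of i] show "\<exists>p'\<in>f ` {N..}. (p', p) \<in> succ_rel"
      by (intro bexI[of _ "f (Suc i)"]) auto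
  qed
qed

lemma Red_terminates:
  assumes "x \<in> kQ"
  shows "\<exists>n. (Red ^^ n) x \<in> kIrr"
proof -
  have lin: "\<exists>n. (Red ^^ n) x \<in> kIrr"
    if "x \<in> pspan P" "\<And>p. p \<in> P \<Longrightarrow> \<exists>n. (Red ^^ n) (path_elem p) \<in> kIrr" for P x
    using that(1)
  proof (induction rule: pspan_induct)
    case zero
    show ?case by (rule exI[of _ 0]) simp
  next
    case (step c p y)
    from step(3) that(2)[OF step(1)] obtain m n where
      mn: "(Red ^^ m) y \<in> kIrr" "(Red ^^ n) (path_elem p) \<in> kIrr" by blast
    have "(Red ^^ (m + n)) y = (Red ^^ m) y"
      by (subst add.commute, simp add: funpow_add Red_pow_irr mn)
    moreover have "(Red ^^ (m + n)) (path_elem p) = (Red ^^ n) (path_elem p)"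
      by (simp add: funpow_add Red_pow_irr mn)
    ultimately have "(Red ^^ (m + n)) (scal c (path_elem p) + y) \<in> kIrr"
      using mn by (simp only: linmap_simps[OF linmap_funpow[OF linmap_Red]]) (intro pspan_closed)
    then show ?case by blast
  qed
  have "p \<in> paths \<Longrightarrow> \<exists>n. (Red ^^ n) (path_elem p) \<in> kIrr" for p
    using wf_succ_rel
  proof (induction p rule: wf_induct_rule)
    case (less p)
    show ?case
    proof (cases "p \<in> Irr")
      case True
      then show ?thesis by (intro exI[of _ 0]) simp
    next
      case False
      have k: "Poly_Mapping.keys (Red (path_elem p)) \<subseteq> paths"
        using Red_paths[of "path_elem p"] less.prems by (simp add: pspan_def)
      have "\<exists>n. (Red ^^ n) (Red (path_elem p)) \<in> kIrr"
        by (rule lin[of _ "Poly_Mapping.keys (Red (path_elem p))"])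
          (use k less False in \<open>auto simp: pspan_def succ_rel_def\<close>)
      then obtain n where "(Red ^^ n) (Red (path_elem p)) \<in> kIrr" by blast
      then have "(Red ^^ Suc n) (path_elem p) \<in> kIrr" by (simp only: funpow_Suc_right o_apply)
      then show ?thesis by blast
    qed
  qed
  with lin[OF assms] show ?thesis by blast
qed

end

section \<open>Path algebras over the dual numbers\<close>

definition dual_elem :: "('v, 'a, 'k::comm_ring_1) pelem \<Rightarrow> ('v, 'a, 'k) pelem \<Rightarrow> ('v, 'a, 'k dual) pelem"
  where "dual_elem x y = Poly_Mapping.map (\<lambda>c. Dual c 0) x + Poly_Mapping.map (\<lambda>c. Dual 0 c) y"

definition std_elem :: "('v, 'a, 'k::comm_ring_1 dual) pelem \<Rightarrow> ('v, 'a, 'k) pelem"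
  where "std_elem z = Poly_Mapping.map std_part z"

definition eps_elem :: "('v, 'a, 'k::comm_ring_1 dual) pelem \<Rightarrow> ('v, 'a, 'k) pelem"
  where "eps_elem z = Poly_Mapping.map eps_part z"

lemma lookup_dual_elem [simp]:
  "Poly_Mapping.lookup (dual_elem x y) p = Dual (Poly_Mapping.lookup x p) (Poly_Mapping.lookup y p)"
  by (simp add: dual_elem_def lookup_add map.rep_eq when_def plus_dual_def zero_dual_def)

lemma lookup_std_elem [simp]: "Poly_Mapping.lookup (std_elem z) p = std_part (Poly_Mapping.lookup z p)"
  and lookup_eps_elem [simp]: "Poly_Mapping.lookup (eps_elem z) p = eps_part (Poly_Mapping.lookup z p)"
  by (simp_all add: std_elem_def eps_elem_def map.rep_eq when_def zero_dual_def)

lemma std_dual_elem [simp]: "std_elem (dual_elem x y) = x"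
  and eps_dual_elem [simp]: "eps_elem (dual_elem x y) = y"
  and dual_elem_collapse [simp]: "dual_elem (std_elem z) (eps_elem z) = z"
  by (rule poly_mapping_eqI; simp)+

lemma dual_elem_inject [simp]: "dual_elem x y = dual_elem x' y' \<longleftrightarrow> x = x' \<and> y = y'"
  by (metis std_dual_elem eps_dual_elem)

lemma dual_elem_add: "dual_elem x y + dual_elem x' y' = dual_elem (x + x') (y + y')"
  and dual_elem_diff: "dual_elem x y - dual_elem x' y' = dual_elem (x - x') (y - y')"
  and dual_elem_zero: "dual_elem 0 0 = 0"
  and dual_elem_scal: "scal c (dual_elem x y) =
    dual_elem (scal (std_part c) x) (scal (std_part c) y + scal (eps_part c) x)"
  and path_elem_dual: "path_elem p = dual_elem (path_elem p) 0"
  by (rule poly_mapping_eqI; simp add: lookup_add lookup_minus plus_dual_def minus_dual_def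
    zero_dual_def times_dual_def one_dual_def lookup_single when_def)+

lemma std_elem_simps:
  "std_elem (x + y) = std_elem x + std_elem y" "std_elem (x - y) = std_elem x - std_elem y"
  "std_elem 0 = 0" "std_elem (scal c x) = scal (std_part c) (std_elem x)"
  by (rule poly_mapping_eqI; simp add: lookup_add lookup_minus plus_dual_def minus_dual_def
    zero_dual_def times_dual_def)+

lemma eps_elem_simps:
  "eps_elem (x + y) = eps_elem x + eps_elem y" "eps_elem (x - y) = eps_elem x - eps_elem y"
  "eps_elem 0 = 0"
  "eps_elem (scal c x) = scal (std_part c) (eps_elem x) + scal (eps_part c) (std_elem x)"
  by (rule poly_mapping_eqI; simp add: lookup_add lookup_minus plus_dual_def minus_dual_def
    zero_dual_def times_dual_def)+

lemma dual_elem_pspan [simp]: "dual_elem x y \<in> pspan P \<longleftrightarrow> x \<in> pspan P \<and> y \<in> pspan P"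
  by (auto simp: pspan_iff zero_dual_def)

lemma std_elem_pspan: "z \<in> pspan P \<Longrightarrow> std_elem z \<in> pspan P"
  and eps_elem_pspan: "z \<in> pspan P \<Longrightarrow> eps_elem z \<in> pspan P"
  by (auto simp: pspan_iff zero_dual_def)

lemma dual_elem_split: "dual_elem x y = dual_elem x 0 + scal (Dual 0 1) (dual_elem y 0)"
  by (simp add: dual_elem_scal dual_elem_add)

text \<open>A \<open>k[t]/(t^2)\<close>-linear map is determined by its values on the elements without \<open>t\<close>-part.\<close>

lemma dual_linmap:
  assumes "linmap M"
  shows "linmap (\<lambda>x. std_elem (M (dual_elem x 0)))" "linmap (\<lambda>x. eps_elem (M (dual_elem x 0)))"
    "M (dual_elem x y) = dual_elem (std_elem (M (dual_elem x 0)))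
      (eps_elem (M (dual_elem x 0)) + std_elem (M (dual_elem y 0)))"
proof -
  have 1: "dual_elem (x + y) 0 = dual_elem x 0 + dual_elem y 0" for x y :: "('a, 'b, 'c) pelem"
    by (simp add: dual_elem_add)
  have 2: "dual_elem (scal c x) 0 = scal (Dual c 0) (dual_elem x 0)" for x :: "('a, 'b, 'c) pelem" and c
    by (simp add: dual_elem_scal)
  show "linmap (\<lambda>x. std_elem (M (dual_elem x 0)))" "linmap (\<lambda>x. eps_elem (M (dual_elem x 0)))"
    by (rule linmapI; simp add: 1 2 linmap_simps[OF assms] std_elem_simps eps_elem_simps)+
  have "M (dual_elem x y) = M (dual_elem x 0) + scal (Dual 0 1) (M (dual_elem y 0))"
    by (subst dual_elem_split) (simp only: linmap_simps[OF assms])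
  also have "\<dots> = dual_elem (std_elem (M (dual_elem x 0))) (eps_elem (M (dual_elem x 0)))
     + scal (Dual 0 1) (dual_elem (std_elem (M (dual_elem y 0))) (eps_elem (M (dual_elem y 0))))"
    by simp
  also have "\<dots> = dual_elem (std_elem (M (dual_elem x 0)))
      (eps_elem (M (dual_elem x 0)) + std_elem (M (dual_elem y 0)))"
    unfolding dual_elem_scal dual_elem_add by simp
  finally show "M (dual_elem x y) = \<dots>" .
qed

lemma linmap_dual:
  assumes "linmap f" "linmap g"
  shows "linmap (\<lambda>z. dual_elem (f (std_elem z)) (g (std_elem z) + f (eps_elem z)))"
  by (rule linmapI) (simp_all add: std_elem_simps eps_elem_simps linmap_simps[OF assms(1)]
    linmap_simps[OF assms(2)] dual_elem_add dual_elem_scal scal_add algebra_simps)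

lemma pmul_dual_elem:
  "pmul G (dual_elem a b) (dual_elem c d) = dual_elem (pmul G a c) (pmul G a d + pmul G b c)"
proof -
  have p: "pmul G (dual_elem (path_elem p) 0) (dual_elem (path_elem q) 0) =
      dual_elem (pmul G (path_elem p) (path_elem q :: ('a, 'b, 'c) pelem)) 0" for p q
    by (simp add: path_elem_dual[symmetric] pmul_path dual_elem_zero)
  have s: "dual_elem (scal k x + y) 0 = scal (Dual k 0) (dual_elem x 0) + dual_elem y 0"
    for k and x y :: "('a, 'b, 'c) pelem"
    by (simp add: dual_elem_scal dual_elem_add)
  have 1: "pmul G (dual_elem (path_elem p) 0) (dual_elem c 0) = dual_elem (pmul G (path_elem p) c) 0"
    for p and c :: "('a, 'b, 'c) pelem"
    using pspan_UNIV[of c]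
    by (induction rule: pspan_induct) (simp_all add: s dual_elem_zero pmul_linear p del: scal_simps(7))
  have 2: "pmul G (dual_elem a 0) (dual_elem c 0) = dual_elem (pmul G a c) 0"
    for a c :: "('a, 'b, 'c) pelem"
    using pspan_UNIV[of a]
    by (induction rule: pspan_induct) (simp_all add: s dual_elem_zero pmul_linear 1 del: scal_simps(7))
  let ?t = "\<lambda>x. scal (Dual 0 1) (dual_elem x 0)"
  have "pmul G (dual_elem a b) (dual_elem c d) = pmul G (dual_elem a 0 + ?t b) (dual_elem c 0 + ?t d)"
    by (simp only: dual_elem_split[symmetric])
  also have "\<dots> = dual_elem (pmul G a c) 0 + ?t (pmul G b c) +
      (?t (pmul G a d) + scal (Dual 0 1 * Dual 0 1) (dual_elem (pmul G b d) 0))"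
    by (simp only: pmul_add_left pmul_add_right pmul_scal_left pmul_scal_right 2 scal_simps(4) scal_add)
  also have "\<dots> = dual_elem (pmul G a c) (pmul G a d + pmul G b c)"
    by (simp add: dual_elem_scal dual_elem_add times_dual_def add.commute)
  finally show ?thesis .
qed

lemma deform_eq: "deform \<phi> \<psi> s = dual_elem (\<phi> s) (\<psi> (path_elem s))"
  by (simp add: deform_def dual_elem_def)

lemma replace_deform:
  "replace G (deform \<phi> \<psi>) q s r =
    dual_elem (replace G \<phi> q s r) (replace G (\<lambda>s. \<psi> (path_elem s)) q s r)"
  unfolding replace_def deform_eq
  by (simp add: path_elem_dual pmul_dual_elem pmul_linear)


section \<open>Normal forms of first-order deformations\<close>

lemma pmul_vertex:
  "pmul G (path_elem (v, [])) (path_elem p) = (if src p = v then path_elem p else 0)"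
  "pmul G (path_elem p) (path_elem (v, [])) = (if tgt G p = v then path_elem p else 0)"
  by (auto simp: pmul_path vertex_pcat)

lemma bimod_hom_parallel:
  assumes "\<psi> \<in> bimod_hom G (pspan P) (pspan P')" "s \<in> P" "src s \<in> verts G" "tgt G s \<in> verts G"
  shows "\<psi> (path_elem s) \<in> pspan {p \<in> P'. parallel G p s}"
proof -
  let ?u = "path_elem (src s, [])" and ?v = "path_elem (tgt G s, [])" and ?s = "path_elem s"
  have P': "\<psi> ?s \<in> pspan P'" using assms(1,2) by (auto simp: bimod_hom_def)
  have "\<psi> (pmul G (pmul G ?u ?s) ?v) = pmul G (pmul G ?u (\<psi> ?s)) ?v"
    using assms unfolding bimod_hom_def by simp
  then have "\<psi> ?s = pmul G (pmul G ?u (\<psi> ?s)) ?v" by (simp add: pmul_vertex)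
  moreover have "pmul G ?u (\<psi> ?s) \<in> pspan {p \<in> P'. src p = src s}"
    by (rule pmul_pspan[of _ "{(src s, [])}", OF _ P']) (simp_all add: vertex_pcat)
  then have "pmul G (pmul G ?u (\<psi> ?s)) ?v \<in> pspan {p \<in> P'. parallel G p s}"
    by (rule pmul_pspan[of _ _ _ "{(tgt G s, [])}"]) (simp_all add: parallel_def)
  ultimately show ?thesis by simp
qed

context complete_red_system
begin

text \<open>For a path this is reduction-finiteness. For a linear combination, the same sequence of reductions is
  applied to each of its finitely many paths.\<close>

lemma element_reduction_finite:
  assumes "x \<in> kQ" "\<And>n. \<rho> n \<in> reductions Q S \<phi>" "y 0 = x" "\<And>n. y (Suc n) = \<rho> n (y n)"
  shows "\<exists>N. \<forall>n\<ge>N. y n = y N"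
proof -
  define R where "R = rec_nat id (\<lambda>n f. \<rho> n \<circ> f)"
  have R: "R 0 = id" "\<And>n. R (Suc n) = \<rho> n \<circ> R n" by (simp_all add: R_def)
  have y: "y n = R n x" for n by (induction n) (simp_all add: R assms)
  have lin: "linmap (R n)" for n
  proof (induction n)
    case (Suc n)
    then show ?case using linmap_comp[OF linmap_reductions[OF assms(2)[of n]]] by (simp add: R comp_def)
  qed (simp add: R)
  have "\<exists>N. \<forall>n\<ge>N. R n x = R N x"
    using assms(1)
  proof (induction rule: pspan_induct)
    case zero
    then show ?case by (simp add: linmap_simps[OF lin])
  next
    case (step c p z)
    have "\<exists>N. \<forall>n\<ge>N. R n (path_elem p) = R N (path_elem p)"
      using reduction_unique[OF step(1)] unfolding reduction_unique_def reduction_finite_def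
      by (elim conjE allE[of _ \<rho>] allE[of _ "\<lambda>n. R n (path_elem p)"] impE) (simp_all add: R assms(2))
    then obtain M where M: "\<And>n. n \<ge> M \<Longrightarrow> R n (path_elem p) = R M (path_elem p)" by blast
    from step(3) obtain N where N: "\<And>n. n \<ge> N \<Longrightarrow> R n z = R N z" by blast
    have "R n (scal c (path_elem p) + z) = R (max M N) (scal c (path_elem p) + z)" if "n \<ge> max M N" for n
      unfolding linmap_simps[OF lin] using that M[of n] M[of "max M N"] N[of n] N[of "max M N"] by simp
    then show ?case by blast
  qed
  then show ?thesis unfolding y .
qed

text \<open>Otherwise \<open>\<rho>\<close> and \<open>\<rho>'\<close> could be applied alternately forever.\<close>

lemma reductions_acyclic:
  assumes "a \<in> kQ" "\<rho> \<in> reductions Q S \<phi>" "\<rho>' \<in> reductions Q S \<phi>" "\<rho>' (\<rho> a) = a"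
  shows "\<rho> a = a"
proof -
  let ?\<rho> = "\<lambda>n::nat. if even n then \<rho> else \<rho>'" and ?y = "\<lambda>n::nat. if even n then a else \<rho> a"
  have "\<exists>N. \<forall>n\<ge>N. ?y n = ?y N"
    by (rule element_reduction_finite[OF assms(1), of ?\<rho>]) (simp_all add: assms)
  then obtain N where N: "\<forall>n\<ge>N. ?y n = ?y N" by blast
  have "?y (2 * N) = ?y N" "?y (Suc (2 * N)) = ?y N" by (rule N[rule_format]; simp)+
  then show ?thesis by (simp split: if_splits)
qed

end

context field_red_system
begin

text \<open>For a deformation \<open>\<psi>\<close>, the map \<open>D\<close> is the \<open>t\<close>-part of the deformed normal form on \<open>kQ\<close>. It is
  characterized by the equations which say that \<open>x \<mapsto> nf x + D(x) t\<close> is invariant under replacements by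
  \<open>\<phi> + \<psi> t\<close> and is the identity on irreducible paths.\<close>

definition eps_nf :: "(('v, 'a, 'k) pelem \<Rightarrow> ('v, 'a, 'k) pelem) \<Rightarrow> (('v, 'a, 'k) pelem \<Rightarrow> ('v, 'a, 'k) pelem) \<Rightarrow> bool"
  where "eps_nf \<psi> D \<longleftrightarrow> linmap D \<and> (\<forall>p. D (path_elem p) \<in> kIrr) \<and>
    (\<forall>p. p \<notin> paths \<or> p \<in> Irr \<longrightarrow> D (path_elem p) = 0) \<and>
    (\<forall>p q s r. s \<in> S \<longrightarrow> factors Q p q s r \<longrightarrow>
      D (path_elem p) = D (replace Q \<phi> q s r) + nf (replace Q (\<lambda>s. \<psi> (path_elem s)) q s r))"

lemma deform_red_system:
  assumes "\<psi> \<in> bimod_hom Q (pspan S) kIrr"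
  shows "red_system Q S (deform \<phi> \<psi>)"
proof
  have "\<psi> (path_elem s) \<in> pspan {p \<in> Irr. parallel Q p s}" if "s \<in> S" for s
    using bimod_hom_parallel[OF assms that] qpaths_verts[OF S_paths[OF that]] by simp
  then show "reduction_system Q S (deform \<phi> \<psi>)"
    using reduction_system unfolding reduction_system_def deform_eq dual_elem_pspan by blast
qed

text \<open>The reduction of an element to its normal form does not change the value of \<open>M\<close>.\<close>

lemma nf_eqI:
  assumes "linmap M" "\<And>x. x \<in> kIrr \<Longrightarrow> M x = x" "\<And>p. p \<notin> paths \<Longrightarrow> M (path_elem p) = 0"
    "\<And>p q s r. s \<in> S \<Longrightarrow> factors Q p q s r \<Longrightarrow> M (replace Q \<phi> q s r) = M (path_elem p)"
  shows "M x = nf x"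
proof (rule linmap_eq_on[OF assms(1) linmap_nf, of UNIV])
  show "M (path_elem p) = nf (path_elem p)" for p
    using invariant_nf[OF assms(1,4), of "path_elem p"] assms(2)[of "nf (path_elem p)"]
      assms(3)[of p] nf_non_path[of p] by (cases "p \<in> paths") auto
qed simp

text \<open>Modulo \<open>t\<close>, the normal form of the deformed system is invariant under replacements by \<open>\<phi>\<close>, and so it
  is \<open>nf\<close>. Comparing the coefficients of \<open>t\<close> in the invariance under replacements by \<open>\<phi> + \<psi> t\<close> gives the
  defining property of \<open>D\<close>.\<close>

lemma deformed_nf:
  assumes "complete_red_system Q S (deform \<phi> \<psi>)"
  shows "\<exists>D. eps_nf \<psi> D \<and> (\<forall>x y. complete_red_system.nf Q S (deform \<phi> \<psi>) (dual_elem x y) =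
    dual_elem (nf x) (D x + nf y))"
proof -
  interpret E: complete_red_system Q S "deform \<phi> \<psi>" by fact
  define D where "D x = eps_elem (E.nf (dual_elem x 0))" for x
  have repl: "E.nf (dual_elem (path_elem p) 0) =
      E.nf (dual_elem (replace Q \<phi> q s r) (replace Q (\<lambda>s. \<psi> (path_elem s)) q s r))"
    if "s \<in> S" "factors Q p q s r" for p q s r
    using E.nf_replace[OF that] unfolding replace_deform path_elem_dual by simp
  have "std_elem (E.nf (dual_elem x 0)) = nf x" for x
  proof (rule nf_eqI)
    show "linmap (\<lambda>x. std_elem (E.nf (dual_elem x 0)))" by (rule dual_linmap[OF E.linmap_nf])
    show "std_elem (E.nf (dual_elem x 0)) = x" if "x \<in> kIrr" for x
      using that by simp
    show "std_elem (E.nf (dual_elem (path_elem p) 0)) = 0" if "p \<notin> paths" for p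
      using E.nf_non_path[OF that] unfolding path_elem_dual by (simp add: std_elem_simps)
    show "std_elem (E.nf (dual_elem (replace Q \<phi> q s r) 0)) = std_elem (E.nf (dual_elem (path_elem p) 0))"
      if "s \<in> S" "factors Q p q s r" for p q s r
      unfolding repl[OF that] by (subst (2) dual_linmap(3)[OF E.linmap_nf]) simp
  qed
  then have E: "E.nf (dual_elem x y) = dual_elem (nf x) (D x + nf y)" for x y
    by (subst dual_linmap(3)[OF E.linmap_nf]) (simp add: D_def)
  have "eps_nf \<psi> D"
    unfolding eps_nf_def
  proof (intro conjI allI impI)
    show "linmap D" unfolding D_def by (rule dual_linmap[OF E.linmap_nf])
    show "D (path_elem p) \<in> kIrr" for p unfolding D_def by (rule eps_elem_pspan) simp
    show "D (path_elem p) = 0" if "p \<notin> paths \<or> p \<in> Irr" for p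
      using that E.nf_non_path[of p] unfolding D_def path_elem_dual by (auto simp: eps_elem_simps)
    show "D (path_elem p) = D (replace Q \<phi> q s r) + nf (replace Q (\<lambda>s. \<psi> (path_elem s)) q s r)"
      if "s \<in> S" "factors Q p q s r" for p q s r
      using repl[OF that] unfolding E by (simp add: linmap_simps[OF linmap_nf])
  qed
  with E show ?thesis by blast
qed

context
  fixes \<psi> D
  assumes hom: "\<psi> \<in> bimod_hom Q (pspan S) kIrr" and eps: "eps_nf \<psi> D"
begin

lemma eps_nfD:
  "linmap D" "p \<notin> paths \<Longrightarrow> D (path_elem p) = 0"
  "s \<in> S \<Longrightarrow> factors Q p q s r \<Longrightarrow>
    D (path_elem p) = D (replace Q \<phi> q s r) + nf (replace Q (\<lambda>s. \<psi> (path_elem s)) q s r)"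
  using eps unfolding eps_nf_def by blast+

lemma eps_nf_irr: "x \<in> kIrr \<Longrightarrow> D x = 0"
  by (rule linmap_eq_on[OF eps_nfD(1) linmap_zero]) (use eps in \<open>auto simp: eps_nf_def\<close>)

lemma eps_nf_pspan: "D x \<in> kIrr"
  by (rule linmap_pspan[OF eps_nfD(1), of UNIV]) (use eps in \<open>auto simp: eps_nf_def\<close>)

interpretation E: red_system Q S "deform \<phi> \<psi>"
  by (rule deform_red_system[OF hom])

definition Nf where "Nf z = dual_elem (nf (std_elem z)) (D (std_elem z) + nf (eps_elem z))"

lemma linmap_Nf: "linmap Nf"
  unfolding Nf_def by (intro linmap_dual linmap_nf eps_nfD)

lemma Nf_reduction: "\<rho> \<in> reductions Q S (deform \<phi> \<psi>) \<Longrightarrow> Nf (\<rho> z) = Nf z"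
proof (rule E.reduction_invariant[OF linmap_Nf])
  show "Nf (replace Q (deform \<phi> \<psi>) q s r) = Nf (path_elem p)" if "s \<in> S" "factors Q p q s r" for p q s r
    unfolding Nf_def replace_deform path_elem_dual
    by (simp add: nf_replace[OF that] eps_nfD(3)[OF that] linmap_simps[OF linmap_nf])
qed

lemma Nf_irr: "z \<in> kIrr \<Longrightarrow> Nf z = z"
  by (simp add: Nf_def eps_nf_irr std_elem_pspan eps_elem_pspan)

text \<open>On multiples of \<open>t\<close>, replacing by \<open>\<phi> + \<psi> t\<close> is the same as replacing by \<open>\<phi>\<close>, as \<open>t^2 = 0\<close>.\<close>

lemma reduction_std:
  assumes "\<rho> \<in> reductions Q S (deform \<phi> \<psi>)"
  shows "\<exists>\<rho>0\<in>reductions Q S \<phi>. (\<forall>z. std_elem (\<rho> z) = \<rho>0 (std_elem z)) \<and>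
    (\<forall>y. \<rho> (dual_elem 0 y) = dual_elem 0 (\<rho>0 y))"
  using assms
proof (induction rule: E.reductions_induct)
  case id
  then show ?case using reductions.id by (auto intro!: bexI[of _ id])
next
  case (step \<rho> p q s r)
  then obtain \<rho>0 where \<rho>0: "\<rho>0 \<in> reductions Q S \<phi>" "\<And>z. std_elem (\<rho> z) = \<rho>0 (std_elem z)"
    "\<And>y. \<rho> (dual_elem 0 y) = dual_elem 0 (\<rho>0 y)" by blast
  let ?\<beta> = "reduce_at p (replace Q \<phi> q s r)"
  have "?\<beta> \<circ> \<rho>0 \<in> reductions Q S \<phi>"
    using reductions_comp[OF basic_in_reductions[OF basic_reductionI] \<rho>0(1)] step by blast
  moreover have "std_elem (reduce_at p (replace Q (deform \<phi> \<psi>) q s r) z) = ?\<beta> (std_elem z)" for z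
    unfolding reduce_at_eq replace_deform path_elem_dual
    by (simp add: std_elem_simps)
  moreover have "reduce_at p (replace Q (deform \<phi> \<psi>) q s r) (dual_elem 0 y) = dual_elem 0 (?\<beta> y)" for y
    unfolding reduce_at_eq replace_deform path_elem_dual
    by (simp add: dual_elem_diff dual_elem_scal dual_elem_add)
  ultimately show ?case using \<rho>0 by (intro bexI[of _ "?\<beta> \<circ> \<rho>0"]) auto
qed

text \<open>If a reduction leaves the constant part fixed, then by acyclicity so does each of its basic
  reductions. A basic reduction that fixes \<open>a\<close> acts at a path outside of the support of \<open>a\<close> and does not
  produce any \<open>t\<close>-part.\<close>

lemma reduction_fixed:
  assumes "\<rho> \<in> reductions Q S (deform \<phi> \<psi>)" "a \<in> kQ" "std_elem (\<rho> (dual_elem a 0)) = a"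
  shows "\<rho> (dual_elem a 0) = dual_elem a 0"
  using assms
proof (induction rule: E.reductions_induct)
  case (step \<rho> p q s r)
  obtain \<rho>0 where \<rho>0: "\<rho>0 \<in> reductions Q S \<phi>" "\<And>z. std_elem (\<rho> z) = \<rho>0 (std_elem z)"
    using reduction_std[OF step.hyps(1)] by blast
  let ?\<beta> = "reduce_at p (replace Q \<phi> q s r)"
  have \<beta>: "std_elem (reduce_at p (replace Q (deform \<phi> \<psi>) q s r) z) = ?\<beta> (std_elem z)" for z
    unfolding reduce_at_eq replace_deform path_elem_dual
    by (simp add: std_elem_simps)
  have cyc: "?\<beta> (\<rho>0 a) = a" using step.prems(2) by (simp add: \<beta> \<rho>0(2))
  have "\<rho>0 a = a"
    by (rule reductions_acyclic[OF step.prems(1) \<rho>0(1) basic_in_reductions[OF basic_reductionI[OF step.hyps(2,3)]] cyc])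
  then have "\<rho> (dual_elem a 0) = dual_elem a 0"
    using step.IH[OF step.prems(1)] by (simp add: \<rho>0(2))
  moreover have "Poly_Mapping.lookup a p = 0"
    using reduce_at_fixed[OF step.hyps(2,3)] cyc \<open>\<rho>0 a = a\<close> by simp
  ultimately show ?case by (simp add: reduce_at_eq zero_dual_def[symmetric])
qed simp

text \<open>The constant parts of a sequence of reductions become stationary, since they are obtained by
  reductions with respect to \<open>\<phi>\<close>. From then on, nothing flows from the constant part into the
  \<open>t\<close>-part, and the \<open>t\<close>-part is itself subject to reductions with respect to \<open>\<phi>\<close>.\<close>

lemma deform_reduction_finite:
  assumes "p \<in> paths"
  shows "reduction_finite Q S (deform \<phi> \<psi>) p"
  unfolding reduction_finite_def
proof (intro allI impI, elim conjE)
  fix \<rho> y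
  assume \<rho>: "\<forall>n. \<rho> n \<in> reductions Q S (deform \<phi> \<psi>)" and y0: "y 0 = path_elem p"
    and ySuc: "\<forall>n::nat. y (Suc n) = \<rho> n (y n)"
  from \<rho> reduction_std have "\<forall>n. \<exists>\<rho>0\<in>reductions Q S \<phi>. (\<forall>z. std_elem (\<rho> n z) = \<rho>0 (std_elem z)) \<and>
    (\<forall>y. \<rho> n (dual_elem 0 y) = dual_elem 0 (\<rho>0 y))" by blast
  then obtain \<rho>0 where \<rho>0: "\<And>n. \<rho>0 n \<in> reductions Q S \<phi>"
    "\<And>n z. std_elem (\<rho> n z) = \<rho>0 n (std_elem z)"
    "\<And>n y. \<rho> n (dual_elem 0 y) = dual_elem 0 (\<rho>0 n y)" by metis
  have paths: "y n \<in> kQ" for n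
    by (induction n) (use assms \<rho> in \<open>auto simp: y0 ySuc intro: E.reductions_paths\<close>)
  have "\<exists>N. \<forall>n\<ge>N. std_elem (y n) = std_elem (y N)"
    by (rule element_reduction_finite[of "path_elem p" \<rho>0])
      (simp_all add: assms \<rho>0 y0 ySuc path_elem_dual)
  then obtain N where N: "\<And>n. n \<ge> N \<Longrightarrow> std_elem (y n) = std_elem (y N)" by blast
  define a where "a = std_elem (y N)"
  have a: "a \<in> kQ" unfolding a_def by (rule std_elem_pspan[OF paths])
  have fixed: "\<rho> n (dual_elem a 0) = dual_elem a 0" if "n \<ge> N" for n
  proof (rule reduction_fixed[OF _ a])
    show "std_elem (\<rho> n (dual_elem a 0)) = a"
      using \<rho>0(2)[of n "y n"] N[OF that] N[of "Suc n"] that ySuc by (simp add: \<rho>0(2) a_def)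
  qed (use \<rho> in blast)
  \<comment> \<open>Hence, from step \<open>N\<close> on, only the \<open>t\<close>-part evolves.\<close>
  have step: "eps_elem (y (Suc n)) = \<rho>0 n (eps_elem (y n))" if "n \<ge> N" for n
  proof -
    have "y n = dual_elem a 0 + dual_elem 0 (eps_elem (y n))"
      using N[OF that] dual_elem_collapse[of "y n"] by (simp add: dual_elem_add a_def)
    then have "\<rho> n (y n) = \<rho> n (dual_elem a 0) + \<rho> n (dual_elem 0 (eps_elem (y n)))"
      using linmap_simps(1)[OF E.linmap_reductions[OF \<rho>[rule_format]]] by metis
    then show ?thesis using ySuc by (simp add: fixed[OF that] \<rho>0(3) dual_elem_add)
  qed
  have "\<exists>M. \<forall>n\<ge>M. eps_elem (y (n + N)) = eps_elem (y (M + N))"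
    by (rule element_reduction_finite[of "eps_elem (y N)" "\<lambda>n. \<rho>0 (n + N)"])
      (simp_all add: eps_elem_pspan paths \<rho>0 step)
  then obtain M where M: "\<And>n. n \<ge> M \<Longrightarrow> eps_elem (y (n + N)) = eps_elem (y (M + N))" by blast
  have "y n = y (M + N)" if "n \<ge> M + N" for n
  proof -
    have "eps_elem (y n) = eps_elem (y (M + N))" using M[of "n - N"] that by simp
    moreover have "std_elem (y n) = std_elem (y (M + N))" using N[of n] N[of "M + N"] that by simp
    ultimately show ?thesis using dual_elem_collapse by metis
  qed
  then show "\<exists>N. \<forall>n\<ge>N. y n = y N" by blast
qed

text \<open>Uniqueness holds because \<open>Nf\<close> is invariant under the reductions of the deformed system and is the
  identity on irreducible elements.\<close>

lemma deform_complete: "complete_red_system Q S (deform \<phi> \<psi>)"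
proof
  fix p assume p: "p \<in> paths"
  have "\<rho> (path_elem p) = \<rho>' (path_elem p)"
    if "\<rho> \<in> reductions Q S (deform \<phi> \<psi>)" "\<rho>' \<in> reductions Q S (deform \<phi> \<psi>)"
      "\<rho> (path_elem p) \<in> kIrr" "\<rho>' (path_elem p) \<in> kIrr" for \<rho> \<rho>'
    using Nf_reduction[OF that(1)] Nf_reduction[OF that(2)] Nf_irr[OF that(3)] Nf_irr[OF that(4)] by metis
  with deform_reduction_finite[OF p] show "reduction_unique Q S (deform \<phi> \<psi>) p"
    unfolding reduction_unique_def by blast
qed

text \<open>The constant part is reduced first. When it is irreducible, only the \<open>t\<close>-part moves, and it moves as
  under the original system.\<close>

lemma Red_deform_terminates:
  assumes "z \<in> kQ"
  shows "\<exists>n. (red Q S (deform \<phi> \<psi>) ^^ n) z \<in> kIrr"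
proof -
  let ?M = "\<lambda>x. std_elem (E.Red (dual_elem x 0))"
  have M: "?M x = Red x" if "x \<in> kQ" for x
  proof (rule linmap_eq_on[OF dual_linmap(1)[OF E.linmap_Red] linmap_Red _ that])
    fix p assume p: "p \<in> paths"
    show "?M (path_elem p) = Red (path_elem p)"
    proof (cases "p \<in> Irr")
      case True
      then show ?thesis
        using E.Red_irr_path[OF True] by (simp add: Red_irr_path path_elem_dual)
    next
      case False
      then obtain q s r where "rightmost p = (q, s, r)" "Red (path_elem p) = replace Q \<phi> q s r"
        using Red_reducible[OF p] by blast
      then show ?thesis
        using E.Red_reducible_rightmost[OF False] by (simp add: path_elem_dual replace_deform)
    qed
  qed
  have std: "std_elem ((E.Red ^^ n) z) = (Red ^^ n) (std_elem z) \<and> (E.Red ^^ n) z \<in> kQ"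
    if "z \<in> kQ" for z n
  proof (induction n)
    case (Suc n)
    let ?y = "(E.Red ^^ n) z"
    have "std_elem (E.Red ?y) = ?M (std_elem ?y)"
      using dual_linmap(3)[OF E.linmap_Red, of "std_elem ?y" "eps_elem ?y"] by simp
    then show ?case using Suc M[OF std_elem_pspan[OF conjunct2[OF Suc]]] by (simp add: E.Red_paths)
  qed (use that in simp)
  have eps: "(E.Red ^^ n) (dual_elem 0 y) = dual_elem 0 ((Red ^^ n) y) \<and> (Red ^^ n) y \<in> kQ"
    if "y \<in> kQ" for y n
  proof (induction n)
    case (Suc n)
    have "E.Red (dual_elem 0 ((Red ^^ n) y)) = dual_elem 0 (?M ((Red ^^ n) y))"
      using dual_linmap(3)[OF E.linmap_Red, of 0 "(Red ^^ n) y"]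
      by (simp add: dual_elem_zero linmap_simps[OF E.linmap_Red] std_elem_simps eps_elem_simps)
    then show ?case using Suc M by (simp add: Red_paths)
  qed (use that in simp)
  from Red_terminates[OF std_elem_pspan[OF assms]] obtain m where
    m: "(Red ^^ m) (std_elem z) \<in> kIrr" by blast
  define w where "w = (E.Red ^^ m) z"
  have w: "std_elem w \<in> kIrr" "w \<in> kQ" using std[OF assms, of m] m by (simp_all add: w_def)
  from Red_terminates[OF eps_elem_pspan[OF w(2)]] obtain n where
    n: "(Red ^^ n) (eps_elem w) \<in> kIrr" by blast
  have "w = dual_elem (std_elem w) 0 + dual_elem 0 (eps_elem w)" by (simp add: dual_elem_add)
  then have "(E.Red ^^ n) w = (E.Red ^^ n) (dual_elem (std_elem w) 0) + (E.Red ^^ n) (dual_elem 0 (eps_elem w))"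
    using linmap_simps(1)[OF linmap_funpow[OF E.linmap_Red]] by metis
  also have "\<dots> \<in> kIrr"
    using w n by (intro pspan_closed) (simp_all add: E.Red_pow_irr eps eps_elem_pspan)
  finally have "(E.Red ^^ (n + m)) z \<in> kIrr" by (simp add: funpow_add w_def)
  then show ?thesis by blast
qed

lemma red_inf_deform:
  assumes "z \<in> kQ"
  shows "red_inf Q S (deform \<phi> \<psi>) z = dual_elem (nf (std_elem z)) (D (std_elem z) + nf (eps_elem z))"
proof -
  interpret C: complete_red_system Q S "deform \<phi> \<psi>" by (rule deform_complete)
  from Red_deform_terminates[OF assms] obtain n where
    n: "(E.Red ^^ n) z \<in> kIrr" by blast
  obtain \<rho> where \<rho>: "\<rho> \<in> reductions Q S (deform \<phi> \<psi>)" "C.nf z = \<rho> z" "\<rho> z \<in> kIrr"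
    using C.nf_as_reduction[OF assms] by blast
  have "red_inf Q S (deform \<phi> \<psi>) z = C.nf z" by (rule C.red_inf_nf[OF assms n])
  also have "\<dots> = Nf z" using Nf_reduction[OF \<rho>(1)] Nf_irr[OF \<rho>(3)] \<rho>(2) by metis
  finally show ?thesis by (simp add: Nf_def)
qed

text \<open>This is the coefficient of \<open>t\<close> in the compatibility of the deformed normal form with products.\<close>

lemma eps_nf_mult:
  assumes "x \<in> kQ" "y \<in> kQ"
  shows "D (pmul Q x y) = D (pmul Q (nf x) (nf y)) + nf (pmul Q (nf x) (D y)) + nf (pmul Q (D x) (nf y))"
proof -
  interpret C: complete_red_system Q S "deform \<phi> \<psi>" by (rule deform_complete)
  have Nf: "C.nf z = Nf z" if "z \<in> kQ" for z
    using C.nf_as_reduction[OF that] Nf_reduction Nf_irr by metis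
  have "C.nf (pmul Q (dual_elem x 0) (dual_elem y 0)) =
      C.nf (pmul Q (C.nf (dual_elem x 0)) (C.nf (dual_elem y 0)))"
    using assms by (simp add: C.nf_mult_left C.nf_mult_right)
  then show ?thesis
    using assms by (simp add: Nf pmul_in_pspan_qpaths pspan_Irr_paths eps_nf_pspan Nf_def pmul_dual_elem
      pmul_linear linmap_simps[OF linmap_nf] algebra_simps)
qed

end

end

section \<open>Cochains on the irreducible paths\<close>

context field_red_system
begin

text \<open>The multiplication of \<open>A = kQ/I\<close>, transported to the span of the irreducible paths.\<close>

definition star (infixl "\<star>" 70) where "x \<star> y = nf (x \<cdot> y)"

abbreviation vtx :: "'v \<Rightarrow> ('v, 'a, 'k) pelem" where "vtx v \<equiv> path_elem (v, [])"
abbreviation arr :: "'a \<Rightarrow> ('v, 'a, 'k) pelem" where "arr a \<equiv> path_elem (tail Q a, [a])"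

lemma star_Irr [simp, intro]: "x \<star> y \<in> kIrr"
  by (simp add: star_def)

lemma star_linear:
  "(x + y) \<star> z = x \<star> z + y \<star> z" "z \<star> (x + y) = z \<star> x + z \<star> y"
  "(x - y) \<star> z = x \<star> z - y \<star> z" "z \<star> (x - y) = z \<star> x - z \<star> y"
  "(- x) \<star> z = - (x \<star> z)" "z \<star> (- x) = - (z \<star> x)" "0 \<star> z = 0" "z \<star> 0 = 0"
  "scal c x \<star> z = scal c (x \<star> z)" "z \<star> scal c x = scal c (z \<star> x)"
  by (simp_all add: star_def pmul_linear linmap_simps[OF linmap_nf])

lemma linmap_star_left: "linmap f \<Longrightarrow> linmap (\<lambda>x. f x \<star> y)"
  and linmap_star_right: "linmap f \<Longrightarrow> linmap (\<lambda>x. y \<star> f x)"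
  by (simp_all add: linmap_def star_linear)

lemma star_sum_left: "sum f A \<star> z = (\<Sum>a\<in>A. f a \<star> z)"
  and star_sum_right: "z \<star> sum f A = (\<Sum>a\<in>A. z \<star> f a)"
  using linmap_sum[OF linmap_star_left[OF linmap_id]] linmap_sum[OF linmap_star_right[OF linmap_id]] by blast+

lemma star_nf:
  assumes "x \<in> kQ" "y \<in> kQ"
  shows "nf x \<star> y = x \<star> y" "x \<star> nf y = x \<star> y" "nf (x \<cdot> y) = nf x \<star> nf y"
  using assms by (simp_all add: star_def nf_mult_left nf_mult_right)

lemma star_assoc:
  assumes "x \<in> kQ" "y \<in> kQ" "z \<in> kQ"
  shows "(x \<star> y) \<star> z = x \<star> (y \<star> z)"
  using assms by (simp add: star_def nf_mult_left nf_mult_right pmul_in_pspan_qpaths pmul_assoc)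

declare vertex_irr [simp] arrow_irr [simp] arrow_in_qpaths [simp] Nil_in_qpaths [simp]

lemma vtx_mult_Irr:
  assumes "x \<in> kIrr"
  shows "vtx v \<cdot> x \<in> kIrr" "x \<cdot> vtx v \<in> kIrr"
  using pmul_pspan[of "vtx v" "{(v, [])}" x Irr Q Irr] pmul_pspan[of x Irr "vtx v" "{(v, [])}" Q Irr] assms
  by (simp_all add: vertex_pcat)

lemma vtx_star:
  assumes "x \<in> kIrr"
  shows "vtx v \<star> x = vtx v \<cdot> x" "x \<star> vtx v = x \<cdot> vtx v"
  using vtx_mult_Irr[OF assms] by (simp_all add: star_def)

lemma vtx_star_vtx: "u \<in> verts Q \<Longrightarrow> v \<in> verts Q \<Longrightarrow> vtx u \<star> vtx v = (if u = v then vtx u else 0)"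
  by (simp add: vtx_star pmul_path vertex_pcat)

lemma path_balanced:
  assumes "p \<in> paths"
  shows "vtx (src p) \<star> path_elem p = nf (path_elem p)" "path_elem p \<star> vtx (tgt Q p) = nf (path_elem p)"
  by (simp_all add: star_def pmul_vertex)

lemma star_path: "path_elem p \<star> path_elem q = (if tgt Q p = src q then nf (path_elem (pcat p q)) else 0)"
  by (simp add: star_def pmul_path linmap_simps[OF linmap_nf])

lemma nf_balanced:
  assumes "p \<in> paths"
  shows "vtx (src p) \<star> nf (path_elem p) = nf (path_elem p)" "nf (path_elem p) \<star> vtx (tgt Q p) = nf (path_elem p)"
  using path_balanced[OF assms] star_nf(1)[of "path_elem p" "vtx (tgt Q p)"] star_nf(2)[of "vtx (src p)" "path_elem p"]
    assms qpaths_verts[OF assms] by simp_all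

text \<open>The Hochschild differential of a 1-cochain.\<close>

definition cob :: "(('v, 'a, 'k) pelem \<Rightarrow> ('v, 'a, 'k) pelem) \<Rightarrow> ('v, 'a, 'k) pelem \<Rightarrow> ('v, 'a, 'k) pelem \<Rightarrow> ('v, 'a, 'k) pelem"
  where "cob g x y = x \<star> g y - g (x \<star> y) + g x \<star> y"

lemma cob_add: "cob (\<lambda>x. f x + g x) x y = cob f x y + cob g x y"
  and cob_diff: "cob (\<lambda>x. f x - g x) x y = cob f x y - cob g x y"
  and cob_scal: "cob (\<lambda>x. scal c (g x)) x y = scal c (cob g x y)"
  by (simp_all add: cob_def star_linear scal_add scal_diff algebra_simps)

definition cohomologous where
  "cohomologous F G \<longleftrightarrow> (\<exists>g. linmap g \<and> (\<forall>x. g x \<in> kIrr) \<and>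
    (\<forall>x\<in>kIrr. \<forall>y\<in>kIrr. F x y - G x y = cob g x y))"

lemma cohomologousI:
  assumes "linmap g" "\<And>x. g x \<in> kIrr"
    "\<And>x y. x \<in> kIrr \<Longrightarrow> y \<in> kIrr \<Longrightarrow> F x y - G x y = cob g x y"
  shows "cohomologous F G"
  using assms unfolding cohomologous_def by blast

lemma cohomologousE:
  assumes "cohomologous F G"
  obtains g where "linmap g" "\<And>x. g x \<in> kIrr"
    "\<And>x y. x \<in> kIrr \<Longrightarrow> y \<in> kIrr \<Longrightarrow> F x y - G x y = cob g x y"
  using assms unfolding cohomologous_def by blast

lemma cohomologous_refl: "cohomologous F F"
  by (rule cohomologousI[of "\<lambda>x. 0"]) (simp_all add: cob_def star_linear)

lemma cohomologous_scal:
  assumes "cohomologous F G"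
  shows "cohomologous (\<lambda>x y. scal c (F x y)) (\<lambda>x y. scal c (G x y))"
  using assms
proof (rule cohomologousE)
  fix g assume "linmap g" "\<And>x. g x \<in> kIrr"
    "\<And>x y. x \<in> kIrr \<Longrightarrow> y \<in> kIrr \<Longrightarrow> F x y - G x y = cob g x y"
  then show ?thesis
    by (intro cohomologousI[of "\<lambda>x. scal c (g x)"]) (simp_all add: linmap_scal cob_scal flip: scal_diff)
qed

lemma cohomologous_add:
  assumes "cohomologous F G" "cohomologous F' G'"
  shows "cohomologous (\<lambda>x y. F x y + F' x y) (\<lambda>x y. G x y + G' x y)"
proof -
  from assms(1) obtain g where g: "linmap g" "\<And>x. g x \<in> kIrr"
    "\<And>x y. x \<in> kIrr \<Longrightarrow> y \<in> kIrr \<Longrightarrow> F x y - G x y = cob g x y" by (rule cohomologousE) blast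
  from assms(2) obtain g' where g': "linmap g'" "\<And>x. g' x \<in> kIrr"
    "\<And>x y. x \<in> kIrr \<Longrightarrow> y \<in> kIrr \<Longrightarrow> F' x y - G' x y = cob g' x y" by (rule cohomologousE) blast
  show ?thesis
    using g g' by (intro cohomologousI[of "\<lambda>x. g x + g' x"]) (simp_all add: linmap_add cob_add flip: g(3) g'(3))
qed

lemma cohomologous_sym: "cohomologous F G \<Longrightarrow> cohomologous G F"
  using cohomologous_add[OF cohomologous_scal[of F G "- 1"] cohomologous_refl[of "\<lambda>x y. F x y + G x y"]]
  by simp

lemma cohomologous_trans: "cohomologous F G \<Longrightarrow> cohomologous G H \<Longrightarrow> cohomologous F H"
  using cohomologous_add[OF cohomologous_add[of F G G H] cohomologous_refl[of "\<lambda>x y. - G x y"]]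
  by (simp add: algebra_simps)

definition cocycle :: "(('v, 'a, 'k) pelem \<Rightarrow> ('v, 'a, 'k) pelem \<Rightarrow> ('v, 'a, 'k) pelem) \<Rightarrow> bool"
  where "cocycle F \<longleftrightarrow> (\<forall>y. linmap (\<lambda>x. F x y)) \<and> (\<forall>x. linmap (F x)) \<and> (\<forall>x y. F x y \<in> kIrr) \<and>
    (\<forall>x\<in>kIrr. \<forall>y\<in>kIrr. \<forall>z\<in>kIrr.
      x \<star> F y z - F (x \<star> y) z + F x (y \<star> z) - F x y \<star> z = 0)"

lemma cocycleD:
  assumes "cocycle F"
  shows "linmap (\<lambda>x. F x y)" "linmap (F x)" "F x y \<in> kIrr"
    "x \<in> kIrr \<Longrightarrow> y \<in> kIrr \<Longrightarrow> z \<in> kIrr \<Longrightarrow>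
      x \<star> F y z - F (x \<star> y) z + F x (y \<star> z) - F x y \<star> z = 0"
  using assms unfolding cocycle_def by blast+

lemma cocycle_diff_cob:
  assumes F: "cocycle F" and g: "linmap g" "\<And>x. g x \<in> kIrr"
  shows "cocycle (\<lambda>x y. F x y - cob g x y)"
  unfolding cocycle_def
proof (intro conjI allI ballI)
  note l = linmap_diff linmap_add cocycleD[OF F] linmap_star_left linmap_star_right g linmap_comp[OF g(1)] linmap_id
  show "linmap (\<lambda>x. F x y - cob g x y)" for y unfolding cob_def by (intro l)
  show "linmap (\<lambda>y. F x y - cob g x y)" for x unfolding cob_def by (intro l)
  show "F x y - cob g x y \<in> kIrr" for x y
    unfolding cob_def by (intro pspan_closed star_Irr g cocycleD(3)[OF F])
  fix x y z :: "('v, 'a, 'k) pelem" assume i: "x \<in> kIrr" "y \<in> kIrr" "z \<in> kIrr"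
  note p = i[THEN pspan_Irr_paths] g(2)[THEN pspan_Irr_paths]
  have "x \<star> cob g y z - cob g (x \<star> y) z + cob g x (y \<star> z) - cob g x y \<star> z = 0"
    unfolding cob_def by (simp add: star_linear star_assoc p linmap_simps[OF g(1)])
  then show "x \<star> (F y z - cob g y z) - (F (x \<star> y) z - cob g (x \<star> y) z) +
      (F x (y \<star> z) - cob g x (y \<star> z)) - (F x y - cob g x y) \<star> z = 0"
    using cocycleD(4)[OF F i] by (simp add: star_linear algebra_simps)
qed

lemma sum_vtx:
  assumes "x \<in> kIrr" "finite (verts Q)"
  shows "(\<Sum>v\<in>verts Q. vtx v \<star> x) = x" "(\<Sum>v\<in>verts Q. x \<star> vtx v) = x"
proof -
  show "(\<Sum>v\<in>verts Q. vtx v \<star> x) = x"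
  proof (rule linmap_eq_on[OF linmap_setsum linmap_id _ assms(1)])
    fix p assume p: "p \<in> Irr"
    then show "(\<Sum>v\<in>verts Q. vtx v \<star> path_elem p) = path_elem p"
      using assms(2) qpaths_verts(1)[OF Irr_paths[OF p]] by (simp add: vtx_star pmul_vertex)
  qed (intro linmap_star_right linmap_id)
  show "(\<Sum>v\<in>verts Q. x \<star> vtx v) = x"
  proof (rule linmap_eq_on[OF linmap_setsum linmap_id _ assms(1)])
    fix p assume p: "p \<in> Irr"
    then show "(\<Sum>v\<in>verts Q. path_elem p \<star> vtx v) = path_elem p"
      using assms(2) qpaths_verts(2)[OF Irr_paths[OF p]] by (simp add: vtx_star pmul_vertex)
  qed (intro linmap_star_left linmap_id)
qed

text \<open>Multiplying the cocycle identity for \<open>(e\<^sub>v, e\<^sub>u, x)\<close> by \<open>e\<^sub>v\<close> from the left and summing over \<open>v\<close> gives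
  \<open>F(e\<^sub>u, x) = e\<^sub>u F(e\<^sub>u, x) - g(e\<^sub>u x) + g(e\<^sub>u) x\<close>, whose right-hand side is the coboundary of \<open>g\<close>.
  The choice of \<open>g\<close> comes from the separability idempotent \<open>\<Sum> e\<^sub>v \<otimes> e\<^sub>v\<close> of \<open>kQ\<^sub>0\<close>.\<close>

lemma normalize_left:
  assumes F: "cocycle F" and fin: "finite (verts Q)"
  defines "g \<equiv> \<lambda>x. \<Sum>v\<in>verts Q. vtx v \<star> F (vtx v) x"
  assumes u: "u \<in> verts Q" and x: "x \<in> kIrr"
  shows "cob g (vtx u) x = F (vtx u) x"
proof -
  note lin = linmap_simps[OF cocycleD(1)[OF F]] linmap_simps[OF cocycleD(2)[OF F]]
  note p = x[THEN pspan_Irr_paths] cocycleD(3)[OF F, THEN pspan_Irr_paths]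
  have 1: "vtx u \<star> g x = vtx u \<star> F (vtx u) x"
  proof -
    have "vtx u \<star> g x = (\<Sum>v\<in>verts Q. if u = v then vtx u \<star> F (vtx u) x else 0)"
      unfolding g_def star_sum_right
      by (intro sum.cong) (use u p in \<open>auto simp: star_assoc[symmetric] vtx_star_vtx star_linear\<close>)
    then show ?thesis using u fin by simp
  qed
  have "F (vtx u) x - (vtx u \<star> F (vtx u) x) + g (vtx u \<star> x) - g (vtx u) \<star> x =
    (\<Sum>v\<in>verts Q. vtx v \<star> F (vtx u) x) - (\<Sum>v\<in>verts Q. vtx v \<star> F (vtx v \<star> vtx u) x)
     + (\<Sum>v\<in>verts Q. vtx v \<star> F (vtx v) (vtx u \<star> x)) - (\<Sum>v\<in>verts Q. vtx v \<star> (F (vtx v) (vtx u) \<star> x))"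
  proof -
    have "(\<Sum>v\<in>verts Q. vtx v \<star> F (vtx v \<star> vtx u) x) =
        (\<Sum>v\<in>verts Q. if u = v then vtx u \<star> F (vtx u) x else 0)"
      by (intro sum.cong) (use u in \<open>auto simp: vtx_star_vtx lin star_linear\<close>)
    moreover have "g (vtx u) \<star> x = (\<Sum>v\<in>verts Q. vtx v \<star> (F (vtx v) (vtx u) \<star> x))"
      unfolding g_def star_sum_left by (intro sum.cong) (use p in \<open>auto simp: star_assoc\<close>)
    ultimately show ?thesis
      using u fin sum_vtx(1)[OF cocycleD(3)[OF F] fin] by (simp add: g_def)
  qed
  also have "\<dots> = (\<Sum>v\<in>verts Q. vtx v \<star>
      (vtx v \<star> F (vtx u) x - F (vtx v \<star> vtx u) x + F (vtx v) (vtx u \<star> x) - F (vtx v) (vtx u) \<star> x))"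
    unfolding sum.distrib[symmetric] sum_subtractf[symmetric]
  proof (rule sum.cong[OF refl])
    fix v assume v: "v \<in> verts Q"
    have "vtx v \<star> (vtx v \<star> F (vtx u) x) = vtx v \<star> F (vtx u) x"
      using v p by (simp add: star_assoc[symmetric] vtx_star_vtx)
    then show "vtx v \<star> F (vtx u) x - vtx v \<star> F (vtx v \<star> vtx u) x + vtx v \<star> F (vtx v) (vtx u \<star> x)
        - vtx v \<star> (F (vtx v) (vtx u) \<star> x) =
      vtx v \<star> (vtx v \<star> F (vtx u) x - F (vtx v \<star> vtx u) x + F (vtx v) (vtx u \<star> x) - F (vtx v) (vtx u) \<star> x)"
      by (simp add: star_linear)
  qed
  also have "\<dots> = 0"
    by (intro sum.neutral ballI) (use u x in \<open>simp add: cocycleD(4)[OF F] star_linear\<close>)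
  finally show ?thesis unfolding cob_def 1 by (simp add: algebra_simps)
qed

text \<open>A cocycle that vanishes as soon as one argument is a vertex is a cochain relative to
  \<open>kQ_0\<close>.\<close>

definition left_normal where "left_normal F \<longleftrightarrow> (\<forall>v\<in>verts Q. \<forall>x\<in>kIrr. F (vtx v) x = 0)"
definition right_normal where "right_normal F \<longleftrightarrow> (\<forall>v\<in>verts Q. \<forall>x\<in>kIrr. F x (vtx v) = 0)"

lemma left_normalD: "left_normal F \<Longrightarrow> v \<in> verts Q \<Longrightarrow> x \<in> kIrr \<Longrightarrow> F (vtx v) x = 0"
  and right_normalD: "right_normal F \<Longrightarrow> v \<in> verts Q \<Longrightarrow> x \<in> kIrr \<Longrightarrow> F x (vtx v) = 0"
  by (simp_all add: left_normal_def right_normal_def)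

lemma left_normal_star:
  assumes "cocycle F" "left_normal F" "v \<in> verts Q" "x \<in> kIrr" "y \<in> kIrr"
  shows "F (vtx v \<star> x) y = vtx v \<star> F x y"
  using cocycleD(4)[OF assms(1), of "vtx v" x y] left_normalD[OF assms(2,3)] assms(3-5)
  by (simp add: star_linear)

lemma right_normal_star:
  assumes "cocycle F" "right_normal F" "v \<in> verts Q" "x \<in> kIrr" "y \<in> kIrr"
  shows "F x (y \<star> vtx v) = F x y \<star> vtx v"
  using cocycleD(4)[OF assms(1), of x y "vtx v"] right_normalD[OF assms(2,3)] assms(3-5)
  by (simp add: star_linear)

lemma normal_middle:
  assumes "cocycle F" "left_normal F" "right_normal F" "v \<in> verts Q" "x \<in> kIrr" "y \<in> kIrr"
  shows "F (x \<star> vtx v) y = F x (vtx v \<star> y)"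
  using cocycleD(4)[OF assms(1), of x "vtx v" y] left_normalD[OF assms(2,4)] right_normalD[OF assms(3,4)] assms(4-6)
  by (simp add: star_linear)

text \<open>The mirror image of the previous construction. The second claim says that it does not destroy the
  normalization on the left.\<close>

lemma normalize_right:
  assumes F: "cocycle F" "left_normal F" and fin: "finite (verts Q)"
  defines "g \<equiv> \<lambda>x. \<Sum>v\<in>verts Q. F x (vtx v) \<star> vtx v"
  assumes u: "u \<in> verts Q" and x: "x \<in> kIrr"
  shows "cob g x (vtx u) = F x (vtx u)" "cob g (vtx u) x = 0"
proof -
  note lin = linmap_simps[OF cocycleD(1)[OF F(1)]] linmap_simps[OF cocycleD(2)[OF F(1)]]
  note p = x[THEN pspan_Irr_paths] cocycleD(3)[OF F(1), THEN pspan_Irr_paths]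
  have gu: "g (vtx u) = 0"
    unfolding g_def by (intro sum.neutral) (use u in \<open>auto simp: left_normalD[OF F(2)] star_linear\<close>)
  have 1: "g x \<star> vtx u = F x (vtx u) \<star> vtx u"
  proof -
    have "g x \<star> vtx u = (\<Sum>v\<in>verts Q. if u = v then F x (vtx u) \<star> vtx u else 0)"
      unfolding g_def star_sum_left
      by (intro sum.cong) (use u p in \<open>auto simp: star_assoc vtx_star_vtx star_linear\<close>)
    then show ?thesis using u fin by simp
  qed
  have "F x (vtx u) \<star> vtx u - g (x \<star> vtx u) - F x (vtx u) =
    (\<Sum>v\<in>verts Q. F x (vtx u \<star> vtx v) \<star> vtx v) - (\<Sum>v\<in>verts Q. F (x \<star> vtx u) (vtx v) \<star> vtx v)
      - (\<Sum>v\<in>verts Q. F x (vtx u) \<star> vtx v)"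
  proof -
    have "(\<Sum>v\<in>verts Q. F x (vtx u \<star> vtx v) \<star> vtx v) =
        (\<Sum>v\<in>verts Q. if u = v then F x (vtx u) \<star> vtx u else 0)"
      by (intro sum.cong) (use u in \<open>auto simp: vtx_star_vtx lin star_linear\<close>)
    then show ?thesis
      using u fin sum_vtx(2)[OF cocycleD(3)[OF F(1)] fin] by (simp add: g_def)
  qed
  also have "\<dots> = 0"
    unfolding sum_subtractf[symmetric]
  proof (intro sum.neutral ballI)
    fix v assume v: "v \<in> verts Q"
    have e: "F x (vtx u) \<star> vtx v = (F x (vtx u) \<star> vtx v) \<star> vtx v"
      using u v p by (simp add: star_assoc vtx_star_vtx)
    have "F x (vtx u \<star> vtx v) - F (x \<star> vtx u) (vtx v) - F x (vtx u) \<star> vtx v = 0"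
      using cocycleD(4)[OF F(1) x, of "vtx u" "vtx v"] u v left_normalD[OF F(2) u, of "vtx v"]
      by (simp add: star_linear algebra_simps)
    then have "(F x (vtx u \<star> vtx v) - F (x \<star> vtx u) (vtx v) - F x (vtx u) \<star> vtx v) \<star> vtx v = 0"
      by (simp add: star_linear)
    then show "F x (vtx u \<star> vtx v) \<star> vtx v - F (x \<star> vtx u) (vtx v) \<star> vtx v - F x (vtx u) \<star> vtx v = 0"
      by (subst e) (simp add: star_linear)
  qed
  finally show "cob g x (vtx u) = F x (vtx u)"
    by (simp add: cob_def gu 1 star_linear algebra_simps)
  have "g (vtx u \<star> x) = vtx u \<star> g x"
    unfolding g_def star_sum_right
    by (intro sum.cong) (use u x p in \<open>auto simp: left_normal_star[OF F] star_assoc\<close>)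
  then show "cob g (vtx u) x = 0" by (simp add: cob_def gu star_linear)
qed

lemma normalize_cocycle:
  assumes F: "cocycle F" and fin: "finite (verts Q)"
  shows "\<exists>g. linmap g \<and> (\<forall>x. g x \<in> kIrr) \<and> cocycle (\<lambda>x y. F x y - cob g x y) \<and>
    left_normal (\<lambda>x y. F x y - cob g x y) \<and> right_normal (\<lambda>x y. F x y - cob g x y)"
proof -
  define g1 where "g1 x = (\<Sum>v\<in>verts Q. vtx v \<star> F (vtx v) x)" for x
  define F1 where "F1 x y = F x y - cob g1 x y" for x y
  have g1: "linmap g1" "g1 x \<in> kIrr" for x
    unfolding g1_def by (intro linmap_setsum linmap_star_right cocycleD[OF F] pspan_sum star_Irr)+
  have F1: "cocycle F1" "left_normal F1"
    unfolding F1_def left_normal_def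
    using cocycle_diff_cob[OF F g1] normalize_left[OF F fin] by (simp_all add: g1_def[abs_def])
  define g2 where "g2 x = (\<Sum>v\<in>verts Q. F1 x (vtx v) \<star> vtx v)" for x
  have g2: "linmap g2" "g2 x \<in> kIrr" for x
    unfolding g2_def by (intro linmap_setsum linmap_star_left cocycleD[OF F1(1)] pspan_sum star_Irr)+
  have e: "F x y - cob (\<lambda>x. g1 x + g2 x) x y = F1 x y - cob g2 x y" for x y
    by (simp add: F1_def cob_add)
  have "left_normal (\<lambda>x y. F1 x y - cob g2 x y)" "right_normal (\<lambda>x y. F1 x y - cob g2 x y)"
    using normalize_right[OF F1 fin] F1(2)
    unfolding left_normal_def right_normal_def g2_def[abs_def] by simp_all
  then show ?thesis
    using cocycle_diff_cob[OF F1(1) g2] g1 g2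
    by (intro exI[of _ "\<lambda>x. g1 x + g2 x"]) (simp add: e linmap_add)
qed

end

section \<open>Deformations and cocycles\<close>

lemma linmap_pspan_UNIV:
  "linmap f \<Longrightarrow> (\<And>p. f (path_elem p) \<in> pspan P) \<Longrightarrow> f x \<in> pspan P"
  by (rule linmap_pspan[of f UNIV]) auto

context field_red_system
begin

text \<open>The product formula says that \<open>D\<close> trivializes, on the path algebra, the pull-back of the 2-cochain
  \<open>(x, y) \<mapsto> D (x y)\<close> of \<open>A\<close>: the equation \<open>D (x y) = F (x, y) + x D(y) + D(x) y\<close>, for this cochain \<open>F\<close>. That
  \<open>D\<close> vanishes on irreducible paths makes the cochain determined by \<open>D\<close>; it is the infinitesimal part
  of the deformed multiplication on the irreducible paths. The values outside of the paths are fixed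
  to be \<open>0\<close> in order that \<open>D\<close> is unique.\<close>

definition trivialization :: "(('v, 'a, 'k) pelem \<Rightarrow> ('v, 'a, 'k) pelem) \<Rightarrow> bool"
  where "trivialization D \<longleftrightarrow> linmap D \<and> (\<forall>x. D x \<in> kIrr) \<and> (\<forall>x\<in>kIrr. D x = 0) \<and>
    (\<forall>p. p \<notin> paths \<longrightarrow> D (path_elem p) = 0) \<and>
    (\<forall>x\<in>kQ. \<forall>y\<in>kQ. D (x \<cdot> y) = D (nf x \<cdot> nf y) + nf x \<star> D y + D x \<star> nf y)"

lemma trivializationD:
  assumes "trivialization D"
  shows "linmap D" "D x \<in> kIrr" "x \<in> kIrr \<Longrightarrow> D x = 0" "p \<notin> paths \<Longrightarrow> D (path_elem p) = 0"
    "x \<in> kQ \<Longrightarrow> y \<in> kQ \<Longrightarrow> D (x \<cdot> y) = D (nf x \<cdot> nf y) + nf x \<star> D y + D x \<star> nf y"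
  using assms unfolding trivialization_def by blast+

lemma trivialization_linear:
  assumes "trivialization D" "trivialization D'"
  shows "trivialization (\<lambda>x. D x + D' x)" "trivialization (\<lambda>x. scal c (D x))"
proof -
  note D = trivializationD[OF assms(1)] and D' = trivializationD[OF assms(2)]
  show "trivialization (\<lambda>x. D x + D' x)"
    unfolding trivialization_def
  proof (intro conjI ballI allI impI)
    show "D (x \<cdot> y) + D' (x \<cdot> y) = D (nf x \<cdot> nf y) + D' (nf x \<cdot> nf y) + nf x \<star> (D y + D' y) + (D x + D' x) \<star> nf y"
      if "x \<in> kQ" "y \<in> kQ" for x y
      unfolding D(5)[OF that] D'(5)[OF that] star_linear by (simp add: algebra_simps)
  qed (auto intro: linmap_add D D' pspan_closed simp: D(3,4) D'(3,4))
  show "trivialization (\<lambda>x. scal c (D x))"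
    unfolding trivialization_def
  proof (intro conjI ballI allI impI)
    show "scal c (D (x \<cdot> y)) = scal c (D (nf x \<cdot> nf y)) + nf x \<star> scal c (D y) + scal c (D x) \<star> nf y"
      if "x \<in> kQ" "y \<in> kQ" for x y
      unfolding D(5)[OF that] star_linear by (simp add: scal_add)
  qed (auto intro: linmap_scal D pspan_closed simp: D(3,4))
qed

lemma trivialization_zero: "trivialization (\<lambda>x. 0)"
  by (simp add: trivialization_def star_linear)

lemma S_self_factors: "s \<in> S \<Longrightarrow> factors Q s (src s, []) s (tgt Q s, [])"
  using S_paths qpaths_verts[OF S_paths] by (simp add: factors_def pcat_def)

lemma replace_self:
  assumes "s \<in> S" "x \<in> pspan {p \<in> Irr. parallel Q p s}"
  shows "vtx (src s) \<cdot> x \<cdot> vtx (tgt Q s) = x"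
proof (rule linmap_eq_on[OF _ linmap_id _ assms(2)])
  show "linmap (\<lambda>x. vtx (src s) \<cdot> x \<cdot> vtx (tgt Q s))"
    by (rule linmap_comp[OF linmap_pmul_left linmap_pmul_right])
qed (simp add: parallel_def pmul_vertex)

lemma nf_S: "s \<in> S \<Longrightarrow> nf (path_elem s) = \<phi> s"
proof -
  assume s: "s \<in> S"
  have i: "\<phi> s \<in> kIrr" using \<phi>_pspan[OF s] by (rule pspan_mono[rotated]) blast
  have "nf (path_elem s) = nf (replace Q \<phi> (src s, []) s (tgt Q s, []))"
    using nf_replace[OF s S_self_factors[OF s]] by simp
  also have "\<dots> = \<phi> s" unfolding replace_def using replace_self[OF s \<phi>_pspan[OF s]] i by simp
  finally show ?thesis .
qed

lemma eps_nf_trivialization: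
  assumes "\<psi> \<in> bimod_hom Q (pspan S) kIrr" "eps_nf \<psi> D"
  shows "trivialization D" "\<psi> = restrict D (pspan S)"
proof -
  note e = eps_nfD[OF assms] eps_nf_irr[OF assms] eps_nf_pspan[OF assms] eps_nf_mult[OF assms]
  show "trivialization D"
    unfolding trivialization_def
    by (intro conjI allI ballI impI) (rule e(1,2,4,5) e(6)[folded star_def]; assumption)+
  have "D (path_elem s) = \<psi> (path_elem s)" if s: "s \<in> S" for s
  proof -
    have p: "\<psi> (path_elem s) \<in> pspan {p \<in> Irr. parallel Q p s}"
      using bimod_hom_parallel[OF assms(1) s] qpaths_verts[OF S_paths[OF s]] by simp
    then have "\<psi> (path_elem s) \<in> kIrr" by (rule pspan_mono[rotated]) blast
    moreover have "\<phi> s \<in> kIrr" using \<phi>_pspan[OF s] by (rule pspan_mono[rotated]) blast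
    ultimately show ?thesis
      using e(3)[OF s S_self_factors[OF s]] replace_self[OF s p] replace_self[OF s \<phi>_pspan[OF s]] e(4)
      by (simp add: replace_def)
  qed
  note on_S = this
  have \<psi>: "\<psi> (x + y) = \<psi> x + \<psi> y" "\<psi> (scal c x) = scal c (\<psi> x)"
    if "x \<in> pspan S" "y \<in> pspan S" for x y c
    using assms(1) that by (simp_all add: bimod_hom_def)
  have "D x = \<psi> x" if "x \<in> pspan S" for x
    using that
  proof (induction rule: pspan_induct)
    case zero
    have "\<psi> 0 = 0" using \<psi>(2)[of 0 0 0] by simp
    then show ?case by (simp add: linmap_simps[OF e(1)])
  next
    case (step c p y)
    have p: "path_elem p \<in> pspan S" using step by simp
    have "\<psi> (scal c (path_elem p) + y) = scal c (\<psi> (path_elem p)) + \<psi> y"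
      by (simp only: \<psi>(1)[OF pspan_closed(5)[OF p] step(2)] \<psi>(2)[OF p p])
    then show ?case
      using step(3) on_S[OF step(1)] by (simp only: linmap_simps[OF e(1)])
  qed
  moreover have "\<psi> \<in> extensional (pspan S)" using assms(1) by (auto simp: bimod_hom_def PiE_def)
  ultimately show "\<psi> = restrict D (pspan S)"
    by (intro extensionalityI[of _ "pspan S"]) simp_all
qed

lemma trivialization_balanced:
  assumes "trivialization D" "x \<in> kQ" "v \<in> verts Q"
  shows "D (vtx v \<cdot> x) = vtx v \<cdot> D x" "D (x \<cdot> vtx v) = D x \<cdot> vtx v"
proof -
  note D = trivializationD[OF assms(1)]
  show "D (vtx v \<cdot> x) = vtx v \<cdot> D x"
    using D(5)[of "vtx v" x] assms(2,3) D(3)[OF vtx_mult_Irr(1)] D(2)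
    by (simp add: D(3) star_linear vtx_star)
  show "D (x \<cdot> vtx v) = D x \<cdot> vtx v"
    using D(5)[of x "vtx v"] assms(2,3) D(3)[OF vtx_mult_Irr(2)] D(2)
    by (simp add: D(3) star_linear vtx_star)
qed

lemma pspan_S_paths: "x \<in> pspan S \<Longrightarrow> x \<in> kQ"
  using S_paths by (auto simp: pspan_def)

text \<open>The element \<open>w = s - \<phi>\<^sub>s\<close> vanishes in \<open>A\<close>, so that the product formula for \<open>q w r\<close> reduces to
  \<open>D (q w r) = q D(w) r\<close>, and \<open>D w = D s\<close> because \<open>\<phi>\<^sub>s\<close> is irreducible.\<close>

lemma trivialization_eps_nf:
  assumes "trivialization D"
  shows "restrict D (pspan S) \<in> bimod_hom Q (pspan S) kIrr" "eps_nf (restrict D (pspan S)) D"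
proof -
  note D = trivializationD[OF assms]
  note lin = linmap_simps[OF D(1)] linmap_simps[OF linmap_nf]
  have S: "vtx u \<cdot> x \<cdot> vtx v \<in> pspan S" if "x \<in> pspan S" for u v and x
  proof -
    have "vtx u \<cdot> x \<in> pspan S"
      using pmul_pspan[of "vtx u" "{(u, [])}" x S Q S] that by (simp add: vertex_pcat)
    then show ?thesis
      using pmul_pspan[of "vtx u \<cdot> x" S "vtx v" "{(v, [])}" Q S] by simp
  qed
  show "restrict D (pspan S) \<in> bimod_hom Q (pspan S) kIrr"
    unfolding bimod_hom_def
    using D(2) S by (auto simp: lin trivialization_balanced[OF assms] pspan_S_paths pmul_in_pspan_qpaths)
  have "D (path_elem p) = D (replace Q \<phi> q s r) + nf (replace Q (\<lambda>s. restrict D (pspan S) (path_elem s)) q s r)"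
    if s: "s \<in> S" and f: "factors Q p q s r" for p q s r
  proof -
    define w where "w = path_elem s - \<phi> s"
    have i: "\<phi> s \<in> kIrr" using \<phi>_pspan[OF s] by (rule pspan_mono[rotated]) blast
    have q: "path_elem q \<in> kQ" and r: "path_elem r \<in> kQ" and w: "w \<in> kQ"
      using f s i by (simp_all add: factors_def w_def pspan_Irr_paths S_paths)
    have nfw: "nf w = 0" using nf_S[OF s] i by (simp add: w_def lin)
    have Dw: "D w = D (path_elem s)" using D(3)[OF i] by (simp add: w_def lin)
    have wr: "D (w \<cdot> path_elem r) = D w \<star> path_elem r"
      using D(5)[OF w r] star_nf(2)[OF pspan_Irr_paths[OF D(2)] r] by (simp add: nfw pmul_linear lin star_linear)
    have nfwr: "nf (w \<cdot> path_elem r) = 0" using star_nf(3)[OF w r] by (simp add: nfw star_linear)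
    have "D (path_elem q \<cdot> (w \<cdot> path_elem r)) = path_elem q \<star> (D w \<star> path_elem r)"
      using D(5)[OF q pmul_in_pspan_qpaths[OF w r]] star_nf(1)[OF q]
      by (simp add: nfwr pmul_linear lin star_linear wr pspan_Irr_paths)
    also have "\<dots> = nf (path_elem q \<cdot> D w \<cdot> path_elem r)"
      using q r D(2) by (simp add: star_def nf_mult_right pmul_in_pspan_qpaths pspan_Irr_paths pmul_assoc)
    finally have "D (path_elem q \<cdot> w \<cdot> path_elem r) = nf (path_elem q \<cdot> D (path_elem s) \<cdot> path_elem r)"
      by (simp add: pmul_assoc Dw)
    moreover have "path_elem q \<cdot> w \<cdot> path_elem r = path_elem p - replace Q \<phi> q s r"
      using factorsD(2)[OF f] by (simp add: w_def replace_def pmul_linear)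
    ultimately show ?thesis using s by (simp add: lin replace_def diff_eq_eq add.commute)
  qed
  then show "eps_nf (restrict D (pspan S)) D"
    unfolding eps_nf_def using D(1-4) by (simp del: split_paired_All) blast
qed

lemma trivialization_unique:
  assumes "trivialization D" "trivialization D'" "restrict D (pspan S) = restrict D' (pspan S)"
  shows "D = D'"
proof
  fix x
  note D = trivializationD[OF assms(1)] and D' = trivializationD[OF assms(2)]
  note e = eps_nfD(3)[OF trivialization_eps_nf[OF assms(1)]]
    and e' = eps_nfD(3)[OF trivialization_eps_nf[OF assms(2)]]
  have l: "linmap (\<lambda>x. D x - D' x)" by (intro linmap_diff D D')
  have "D (path_elem p) - D' (path_elem p) = 0" for p
  proof (cases "p \<in> paths")
    case True
    have "D (nf (path_elem p)) - D' (nf (path_elem p)) = D (path_elem p) - D' (path_elem p)"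
    proof (rule invariant_nf[OF l])
      show "D (replace Q \<phi> q s r) - D' (replace Q \<phi> q s r) = D (path_elem p) - D' (path_elem p)"
        if "s \<in> S" "factors Q p q s r" for p q s r
        using e[OF that] e'[OF that] unfolding assms(3) by (simp del: restrict_apply)
    qed (use True in simp)
    then show ?thesis by (simp add: D(3) D'(3))
  qed (simp add: D(4) D'(4))
  then have "D (path_elem p) = D' (path_elem p)" for p by simp
  then show "D x = D' x" by (rule linmap_eq_on[OF D(1) D'(1) _ pspan_UNIV])
qed

text \<open>A deformation \<open>\<psi>\<close> has a normal form map, and its \<open>t\<close>-part \<open>D\<close> is a trivialization with
  \<open>D s = D \<phi>\<^sub>s + \<psi>\<^sub>s = \<psi>\<^sub>s\<close>. Conversely, a trivialization is the \<open>t\<close>-part of a map that is invariant under the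
  reductions of the system deformed by its restriction.\<close>

lemma first_order_deformations_iff:
  "\<psi> \<in> first_order_deformations Q S \<phi> \<longleftrightarrow> (\<exists>D. trivialization D \<and> \<psi> = restrict D (pspan S))"
proof
  assume a: "\<psi> \<in> first_order_deformations Q S \<phi>"
  then have hom: "\<psi> \<in> bimod_hom Q (pspan S) kIrr"
    by (simp add: first_order_deformations_def deformation_homs_def fun_module_def)
  interpret E: red_system Q S "deform \<phi> \<psi>" by (rule deform_red_system[OF hom])
  have "complete_red_system Q S (deform \<phi> \<psi>)"
    by unfold_locales (use a in \<open>simp add: first_order_deformations_def\<close>)
  from deformed_nf[OF this] show "\<exists>D. trivialization D \<and> \<psi> = restrict D (pspan S)"
    using eps_nf_trivialization[OF hom] by blast
next
  assume "\<exists>D. trivialization D \<and> \<psi> = restrict D (pspan S)"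
  then obtain D where D: "trivialization D" "\<psi> = restrict D (pspan S)" by blast
  then have e: "\<psi> \<in> bimod_hom Q (pspan S) kIrr" "eps_nf \<psi> D"
    using trivialization_eps_nf by simp_all
  interpret C: complete_red_system Q S "deform \<phi> \<psi>" by (rule deform_complete[OF e])
  show "\<psi> \<in> first_order_deformations Q S \<phi>"
    using e C.reduction_unique by (simp add: first_order_deformations_def deformation_homs_def fun_module_def)
qed

text \<open>Expand \<open>D (x y z)\<close> in two ways.\<close>

lemma trivialization_cocycle:
  assumes "trivialization D"
  shows "cocycle (\<lambda>x y. D (nf x \<cdot> nf y))"
  unfolding cocycle_def
proof (intro conjI allI ballI)
  note D = trivializationD[OF assms]
  note lin = linmap_simps[OF D(1)]
  show "linmap (\<lambda>x. D (nf x \<cdot> nf y))" "linmap (\<lambda>y. D (nf x \<cdot> nf y))" for x y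
    by (rule linmapI; simp add: lin linmap_simps[OF linmap_nf] pmul_linear)+
  show "D (nf x \<cdot> nf y) \<in> kIrr" for x y by (rule D)
  fix x y z :: "('v, 'a, 'k) pelem" assume i: "x \<in> kIrr" "y \<in> kIrr" "z \<in> kIrr"
  note p = i[THEN pspan_Irr_paths]
  have 1: "D (x \<cdot> y \<cdot> z) = D ((x \<star> y) \<cdot> z) + D (x \<cdot> y) \<star> z"
    using D(5)[OF pmul_in_pspan_qpaths[OF p(1,2)] p(3)] i
    by (simp add: D(3) star_def pmul_linear linmap_simps[OF linmap_nf])
  have 2: "D (x \<cdot> (y \<cdot> z)) = D (x \<cdot> (y \<star> z)) + x \<star> D (y \<cdot> z)"
    using D(5)[OF p(1) pmul_in_pspan_qpaths[OF p(2,3)]] i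
    by (simp add: D(3) star_def pmul_linear linmap_simps[OF linmap_nf])
  from 1 2 show "x \<star> D (nf y \<cdot> nf z) - D (nf (x \<star> y) \<cdot> nf z) + D (nf x \<cdot> nf (y \<star> z)) - D (nf x \<cdot> nf y) \<star> z = 0"
    using i by (simp add: pmul_assoc algebra_simps)
qed

text \<open>A normalized cocycle becomes a coboundary on the path algebra, which is free over \<open>kQ\<^sub>0\<close> on the
  arrows: a trivialization may be prescribed on the arrows, here by \<open>0\<close>, and then the product formula
  forces its value on \<open>a p\<close>.\<close>

primrec twist :: "(('v, 'a, 'k) pelem \<Rightarrow> ('v, 'a, 'k) pelem \<Rightarrow> ('v, 'a, 'k) pelem) \<Rightarrow> 'a list \<Rightarrow> ('v, 'a, 'k) pelem"
  where "twist F [] = 0"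
  | "twist F (a # as) = F (arr a) (nf (path_elem (head Q a, as))) + arr a \<star> twist F as"

definition twist_ext :: "(('v, 'a, 'k) pelem \<Rightarrow> ('v, 'a, 'k) pelem \<Rightarrow> ('v, 'a, 'k) pelem) \<Rightarrow> ('v, 'a, 'k) pelem \<Rightarrow> ('v, 'a, 'k) pelem"
  where "twist_ext F = linear_ext (\<lambda>p. if p \<in> paths then twist F (snd p) else 0)"

context
  fixes F
  assumes F: "cocycle F" "left_normal F" "right_normal F"
begin

lemma twist_Irr: "twist F as \<in> kIrr"
  by (induction as) (auto intro: cocycleD(3)[OF F(1)])

lemma linmap_twist_ext: "linmap (twist_ext F)"
  by (simp add: twist_ext_def)

lemma twist_ext_path: "p \<in> paths \<Longrightarrow> twist_ext F (path_elem p) = twist F (snd p)"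
  and twist_ext_nonpath: "p \<notin> paths \<Longrightarrow> twist_ext F (path_elem p) = 0"
  by (simp_all add: twist_ext_def)

lemma twist_ext_Irr: "twist_ext F x \<in> kIrr"
  by (rule linmap_pspan_UNIV[OF linmap_twist_ext]) (simp add: twist_ext_def twist_Irr)

lemma arr_balanced: "a \<in> arcs Q \<Longrightarrow> vtx (tail Q a) \<star> arr a = arr a"
  using nf_balanced(1)[of "(tail Q a, [a])"] by simp

lemma twist_balanced:
  assumes "p \<in> paths"
  shows "vtx (src p) \<star> twist F (snd p) = twist F (snd p)" "twist F (snd p) \<star> vtx (tgt Q p) = twist F (snd p)"
proof -
  note pi = pspan_Irr_paths twist_Irr pspan_Irr_paths[OF twist_Irr] pspan_Irr_paths[OF cocycleD(3)[OF F(1)]]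
  show "vtx (src p) \<star> twist F (snd p) = twist F (snd p)"
    using assms
  proof (induction rule: qpaths_induct)
    case (arrow a p)
    have "vtx (tail Q a) \<star> (arr a \<star> twist F (snd p)) = arr a \<star> twist F (snd p)"
      using arrow(1) by (simp add: star_assoc[symmetric] pi arr_balanced)
    moreover have "vtx (tail Q a) \<star> F (arr a) y = F (arr a) y" if "y \<in> kIrr" for y
      using left_normal_star[OF F(1,2), of "tail Q a" "arr a" y] that arrow(1) by (simp add: arr_balanced)
    ultimately show ?case by (simp add: star_linear)
  qed (simp add: star_linear)
  show "twist F (snd p) \<star> vtx (tgt Q p) = twist F (snd p)"
    using assms
  proof (induction rule: qpaths_induct)
    case (arrow a p)
    have v: "tgt Q p \<in> verts Q" and p: "(head Q a, snd p) = p"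
      using arrow qpaths_verts by (simp_all add: prod_eq_iff)
    have "arr a \<star> twist F (snd p) \<star> vtx (tgt Q p) = arr a \<star> twist F (snd p)"
      using arrow v by (simp add: star_assoc pi)
    moreover have "F (arr a) (nf (path_elem p)) \<star> vtx (tgt Q p) = F (arr a) (nf (path_elem p))"
      using right_normal_star[OF F(1,3) v, of "arr a" "nf (path_elem p)"] arrow(1)
      by (simp add: nf_balanced(2)[OF arrow(2)])
    ultimately show ?case by (simp add: star_linear p)
  qed (simp add: star_linear)
qed

text \<open>By induction on the first factor. In the step from \<open>p\<close> to \<open>a p\<close>, the four values of \<open>F\<close> that appear are
  related by the cocycle identity for \<open>(a, p, q)\<close>. If \<open>p\<close> and \<open>q\<close> cannot be concatenated, all terms vanish
  because \<open>F\<close> is normalized.\<close>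

lemma twist_ext_mult:
  assumes "x \<in> kQ" "y \<in> kQ"
  shows "twist_ext F (x \<cdot> y) = F (nf x) (nf y) + nf x \<star> twist_ext F y + twist_ext F x \<star> nf y"
proof (rule bilinear_eq_on[OF _ _ _ _ _ assms])
  note lin = linmap_simps[OF linmap_twist_ext] linmap_simps[OF linmap_nf]
    linmap_simps[OF cocycleD(1)[OF F(1)]] linmap_simps[OF cocycleD(2)[OF F(1)]]
  show "linmap (\<lambda>x. twist_ext F (x \<cdot> y))" "linmap (\<lambda>y. twist_ext F (x \<cdot> y))"
    "linmap (\<lambda>x. F (nf x) (nf y) + nf x \<star> twist_ext F y + twist_ext F x \<star> nf y)"
    "linmap (\<lambda>y. F (nf x) (nf y) + nf x \<star> twist_ext F y + twist_ext F x \<star> nf y)" for x y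
    by (rule linmapI; simp add: lin pmul_linear star_linear scal_add algebra_simps)+
  note pi = pspan_Irr_paths twist_Irr pspan_Irr_paths[OF twist_Irr] pspan_Irr_paths[OF cocycleD(3)[OF F(1)]]
  fix p q assume p: "p \<in> paths" and q: "q \<in> paths"
  show "twist_ext F (path_elem p \<cdot> path_elem q) =
    F (nf (path_elem p)) (nf (path_elem q)) + nf (path_elem p) \<star> twist_ext F (path_elem q)
      + twist_ext F (path_elem p) \<star> nf (path_elem q)"
  proof (cases "tgt Q p = src q")
    case True
    from p True have "twist F (snd p @ snd q) = F (nf (path_elem p)) (nf (path_elem q))
      + nf (path_elem p) \<star> twist F (snd q) + twist F (snd p) \<star> nf (path_elem q)"
    proof (induction rule: qpaths_induct)
      case (vertex v)
      then show ?case
        using twist_balanced(1)[OF q] by (simp add: left_normalD[OF F(2)] star_linear)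
    next
      case (arrow a p)
      let ?p = "nf (path_elem p)" and ?q = "nf (path_elem q)"
      have e: "(head Q a, snd p) = p" "(head Q a, snd p @ snd q) = pcat p q"
        using arrow by (simp_all add: prod_eq_iff)
      have tq: "tgt Q p = src q" using arrow.prems(1) by (simp add: e(1))
      have npq: "nf (path_elem (pcat p q)) = ?p \<star> ?q"
        using star_nf(3)[of "path_elem p" "path_elem q"] arrow q by (simp add: pmul_path tq)
      have nap: "nf (path_elem (tail Q a, a # snd p)) = arr a \<star> ?p"
        using star_nf(3)[of "arr a" "path_elem p"] arrow by (simp add: pmul_path pcat_def)
      from tq have IH: "twist F (snd p @ snd q) = F ?p ?q + ?p \<star> twist F (snd q) + twist F (snd p) \<star> ?q"
        by (rule arrow.IH)
      have c: "arr a \<star> F ?p ?q - F (arr a \<star> ?p) ?q + F (arr a) (?p \<star> ?q) - F (arr a) ?p \<star> ?q = 0"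
        by (rule cocycleD(4)[OF F(1)]) (simp_all add: arrow)
      have as: "arr a \<star> (?p \<star> twist F (snd q)) = arr a \<star> ?p \<star> twist F (snd q)"
        "arr a \<star> (twist F (snd p) \<star> ?q) = arr a \<star> twist F (snd p) \<star> ?q"
        using arrow by (simp_all add: star_assoc pi)
      show ?case
        unfolding snd_conv append_Cons twist.simps e npq nap IH star_linear as
        using c by (simp add: algebra_simps)
    qed
    then show ?thesis
      using True p q by (simp add: pmul_path twist_ext_path pcat_in_qpaths)
  next
    case False
    let ?p = "nf (path_elem p)" and ?q = "nf (path_elem q)" and ?u = "vtx (tgt Q p)" and ?v = "vtx (src q)"
    have uv: "tgt Q p \<in> verts Q" "src q \<in> verts Q" using p q qpaths_verts by simp_all
    have "F (?p \<star> ?u) (?v \<star> ?q) = F ?p (?u \<star> (?v \<star> ?q))"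
      by (rule normal_middle[OF F uv(1)]) simp_all
    also have "?u \<star> (?v \<star> ?q) = 0"
      using uv False by (simp add: star_assoc[symmetric] pi vtx_star_vtx star_linear)
    finally have "F ?p ?q = 0" by (simp add: nf_balanced p q lin)
    moreover have "?p \<star> twist F (snd q) = (?p \<star> ?u) \<star> (?v \<star> twist F (snd q))"
      by (simp add: nf_balanced twist_balanced p q)
    then have "?p \<star> twist F (snd q) = ?p \<star> ((?u \<star> ?v) \<star> twist F (snd q))"
      using uv by (simp add: star_assoc pi)
    then have "?p \<star> twist F (snd q) = 0" using uv False by (simp add: vtx_star_vtx star_linear)
    moreover have "twist F (snd p) \<star> ?q = (twist F (snd p) \<star> ?u) \<star> (?v \<star> ?q)"
      by (simp add: nf_balanced twist_balanced p q)
    then have "twist F (snd p) \<star> ?q = twist F (snd p) \<star> ((?u \<star> ?v) \<star> ?q)"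
      using uv by (simp add: star_assoc pi)
    then have "twist F (snd p) \<star> ?q = 0" using uv False by (simp add: vtx_star_vtx star_linear)
    ultimately show ?thesis
      using False p q by (simp add: pmul_path twist_ext_path lin)
  qed
qed

text \<open>Subtracting the values on normal forms achieves that the map vanishes on irreducible paths, and
  changes the cocycle by a coboundary.\<close>

lemma twist_trivialization:
  "trivialization (\<lambda>x. twist_ext F x - twist_ext F (nf x))" (is "trivialization ?D")
  "x \<in> kIrr \<Longrightarrow> y \<in> kIrr \<Longrightarrow>
    twist_ext F (x \<cdot> y) - twist_ext F (nf (x \<cdot> y)) = F x y + cob (twist_ext F) x y"
proof -
  note lin = linmap_simps[OF linmap_twist_ext] linmap_simps[OF linmap_nf]
  show "trivialization ?D"
    unfolding trivialization_def
  proof (intro conjI ballI allI impI)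
    show "linmap ?D" by (intro linmap_diff linmap_twist_ext linmap_comp[OF linmap_twist_ext linmap_nf])
    show "?D x \<in> kIrr" for x by (intro pspan_closed twist_ext_Irr)
    show "?D x = 0" if "x \<in> kIrr" for x using that by simp
    show "?D (path_elem p) = 0" if "p \<notin> paths" for p
      using that by (simp add: twist_ext_nonpath nf_non_path lin)
    show "?D (x \<cdot> y) = ?D (nf x \<cdot> nf y) + nf x \<star> ?D y + ?D x \<star> nf y" if "x \<in> kQ" "y \<in> kQ" for x y
    proof -
      have "nf (nf x \<cdot> nf y) = nf (x \<cdot> y)" using that by (simp add: nf_mult_left nf_mult_right)
      then show ?thesis
        using that twist_ext_mult[OF that] twist_ext_mult[of "nf x" "nf y"] by (simp add: star_linear)
    qed
  qed
  show "twist_ext F (x \<cdot> y) - twist_ext F (nf (x \<cdot> y)) = F x y + cob (twist_ext F) x y"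
    if "x \<in> kIrr" "y \<in> kIrr"
    using twist_ext_mult[of x y] that by (simp add: pspan_Irr_paths cob_def star_def)
qed

end

lemma cocycle_cohomologous_trivialization:
  assumes F: "cocycle F" and fin: "finite (verts Q)"
  shows "\<exists>D. trivialization D \<and> cohomologous F (\<lambda>x y. D (nf x \<cdot> nf y))"
proof -
  from normalize_cocycle[OF assms] obtain g where g: "linmap g" "\<forall>x. g x \<in> kIrr"
    and F': "cocycle (\<lambda>x y. F x y - cob g x y)" "left_normal (\<lambda>x y. F x y - cob g x y)"
      "right_normal (\<lambda>x y. F x y - cob g x y)" by blast
  let ?t = "twist_ext (\<lambda>x y. F x y - cob g x y)"
  have "trivialization (\<lambda>x. ?t x - ?t (nf x))" by (rule twist_trivialization(1)[OF F'])
  moreover have "cohomologous F (\<lambda>x y. ?t (nf x \<cdot> nf y) - ?t (nf (nf x \<cdot> nf y)))"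
  proof (rule cohomologousI)
    show "linmap (\<lambda>x. g x - ?t x)" by (intro linmap_diff g linmap_twist_ext[OF F'])
    show "g x - ?t x \<in> kIrr" for x using g twist_ext_Irr[OF F'] by (intro pspan_closed) simp_all
    show "F x y - (?t (nf x \<cdot> nf y) - ?t (nf (nf x \<cdot> nf y))) = cob (\<lambda>x. g x - ?t x) x y"
      if "x \<in> kIrr" "y \<in> kIrr" for x y
      using twist_trivialization(2)[OF F' that] that by (simp add: cob_diff algebra_simps)
  qed
  ultimately show ?thesis by blast
qed

end

section \<open>Equivalence of deformations\<close>

context field_red_system
begin

text \<open>The Leibniz rule for multiplication by arrows from the right implies the Leibniz rule for all paths,
  by induction on the second path.\<close>

lemma derivation_from_arrows:
  assumes K: "linmap K" "\<And>x. K x \<in> kIrr" "\<And>v. v \<in> verts Q \<Longrightarrow> K (vtx v) = 0"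
    and bal: "\<And>p. p \<in> paths \<Longrightarrow> vtx (src p) \<star> K (path_elem p) = K (path_elem p)"
      "\<And>p. p \<in> paths \<Longrightarrow> K (path_elem p) \<star> vtx (tgt Q p) = K (path_elem p)"
    and step: "\<And>p a. p \<in> paths \<Longrightarrow> a \<in> arcs Q \<Longrightarrow> tgt Q p = tail Q a \<Longrightarrow>
      K (path_elem (pcat p (tail Q a, [a]))) = path_elem p \<star> K (arr a) + K (path_elem p) \<star> arr a"
    and xy: "x \<in> kQ" "y \<in> kQ"
  shows "K (x \<cdot> y) = x \<star> K y + K x \<star> y"
proof (rule bilinear_eq_on[OF _ _ _ _ _ xy])
  note lin = linmap_simps[OF K(1)]
  show "linmap (\<lambda>x. K (x \<cdot> y))" "linmap (\<lambda>y. K (x \<cdot> y))"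
    "linmap (\<lambda>x. x \<star> K y + K x \<star> y)" "linmap (\<lambda>y. x \<star> K y + K x \<star> y)" for x y
    by (rule linmapI; simp add: lin pmul_linear star_linear scal_add algebra_simps)+
  note Kp = K(2)[THEN pspan_Irr_paths]
  fix p q assume p: "p \<in> paths" and q: "q \<in> paths"
  show "K (path_elem p \<cdot> path_elem q) = path_elem p \<star> K (path_elem q) + K (path_elem p) \<star> path_elem q"
  proof (cases "tgt Q p = src q")
    case True
    from q True have "K (path_elem (pcat p q)) = path_elem p \<star> K (path_elem q) + K (path_elem p) \<star> path_elem q"
    proof (induction rule: qpaths_rev_induct)
      case (vertex v)
      then show ?case using bal(2)[OF p] by (simp add: K(3) star_linear)
    next
      case (arrow a q)
      have pq: "tgt Q p = src q" using arrow.prems by simp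
      have 1: "K (path_elem (pcat (pcat p q) (tail Q a, [a]))) =
          path_elem (pcat p q) \<star> K (arr a) + K (path_elem (pcat p q)) \<star> arr a"
        using arrow.hyps p pq by (intro step pcat_in_qpaths) simp_all
      have 2: "path_elem (pcat p q) \<star> K (arr a) = path_elem p \<star> (path_elem q \<star> K (arr a))"
      proof -
        have "path_elem (pcat p q) \<star> K (arr a) = (path_elem p \<star> path_elem q) \<star> K (arr a)"
          using star_nf(1)[of "path_elem (pcat p q)" "K (arr a)"] p arrow.hyps pq Kp
          by (simp add: star_path pcat_in_qpaths)
        then show ?thesis using p arrow.hyps Kp by (simp add: star_assoc)
      qed
      have 3: "path_elem (pcat q (tail Q a, [a])) \<in> kQ" "path_elem q \<star> arr a = nf (path_elem (pcat q (tail Q a, [a])))"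
        using arrow.hyps by (simp_all add: star_path pcat_in_qpaths)
      have 4: "K (path_elem p) \<star> (path_elem q \<star> arr a) = K (path_elem p) \<star> path_elem (pcat q (tail Q a, [a]))"
        unfolding 3(2) by (rule star_nf(2)[OF Kp 3(1)])
      have "K (path_elem (pcat p (pcat q (tail Q a, [a])))) =
          path_elem p \<star> (path_elem q \<star> K (arr a)) + (path_elem p \<star> K (path_elem q) + K (path_elem p) \<star> path_elem q) \<star> arr a"
        using 1 arrow.IH[OF pq] unfolding pcat_assoc 2 by simp
      also have "\<dots> = path_elem p \<star> (path_elem q \<star> K (arr a) + K (path_elem q) \<star> arr a)
          + K (path_elem p) \<star> (path_elem q \<star> arr a)"
        using p arrow.hyps Kp by (simp add: star_linear star_assoc)
      also have "path_elem q \<star> K (arr a) + K (path_elem q) \<star> arr a = K (path_elem (pcat q (tail Q a, [a])))"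
        using arrow.hyps by (intro step[symmetric])
      finally show ?case unfolding 4 .
    qed
    then show ?thesis using True by (simp add: pmul_path)
  next
    case False
    have uv: "tgt Q p \<in> verts Q" "src q \<in> verts Q" using p q qpaths_verts by simp_all
    have z: "path_elem p \<star> vtx (src q) = 0" "vtx (tgt Q p) \<star> path_elem q = 0"
      using False by (simp_all add: star_path)
    have "path_elem p \<star> (vtx (src q) \<star> K (path_elem q)) = 0" "(K (path_elem p) \<star> vtx (tgt Q p)) \<star> path_elem q = 0"
      using p q uv Kp by (simp_all add: star_assoc[symmetric] z(1) star_linear, simp add: star_assoc z star_linear)
    then show ?thesis using False by (simp add: pmul_path lin bal p q)
  qed
qed

text \<open>The coefficient of \<open>t\<close> in the product of the elements \<open>a + g(a) t\<close>, over the arrows \<open>a\<close> of a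
  path.\<close>

definition arrow_product :: "(('v, 'a, 'k) pelem \<Rightarrow> ('v, 'a, 'k) pelem) \<Rightarrow> ('v, 'a) qpath \<Rightarrow> ('v, 'a, 'k) pelem"
  where "arrow_product g p = eps_elem (foldl (pmul Q) (path_elem (fst p, []))
    (map (\<lambda>a. dual_elem (arr a) (g (arr a))) (snd p)))"

lemma foldl_arrows:
  assumes "p \<in> paths"
  shows "foldl (pmul Q) (path_elem (fst p, [])) (map (\<lambda>a. dual_elem (arr a) (g (arr a))) (snd p)) =
    dual_elem (path_elem p) (arrow_product g p)"
proof -
  have "std_elem (foldl (pmul Q) (path_elem (fst p, [])) (map (\<lambda>a. dual_elem (arr a) (g (arr a))) (snd p))) = path_elem p"
    (is "std_elem (?f p) = _")
    using assms
  proof (induction rule: qpaths_rev_induct)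
    case (vertex v)
    then show ?case by (simp add: path_elem_dual)
  next
    case (arrow a p)
    have "?f (pcat p (tail Q a, [a])) = pmul Q (dual_elem (std_elem (?f p)) (eps_elem (?f p))) (dual_elem (arr a) (g (arr a)))"
      by simp
    then show ?case using arrow by (simp only: pmul_dual_elem std_dual_elem) (simp add: pmul_path)
  qed
  then show ?thesis using dual_elem_collapse[of "?f p"] by (simp add: arrow_product_def)
qed

lemma arrow_product_vertex: "arrow_product g (v, []) = 0"
  by (simp add: arrow_product_def path_elem_dual)

lemma arrow_product_snoc:
  assumes "p \<in> paths"
  shows "arrow_product g (pcat p (tail Q a, [a])) = path_elem p \<cdot> g (arr a) + arrow_product g p \<cdot> arr a"
  using foldl_arrows[OF assms, of g] by (simp add: arrow_product_def[of g "pcat p (tail Q a, [a])"] pmul_dual_elem)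

lemma arrow_product_paths:
  assumes "p \<in> paths" "\<And>x. g x \<in> kQ"
  shows "arrow_product g p \<in> kQ"
  using assms(1)
proof (induction rule: qpaths_rev_induct)
  case (arrow a p)
  then show ?case using assms(2) by (simp add: arrow_product_snoc pmul_in_pspan_qpaths)
qed (simp add: arrow_product_vertex)

lemma red_inf_trivialization:
  assumes "trivialization D" "z \<in> kQ"
  shows "red_inf Q S (deform \<phi> (restrict D (pspan S))) z =
    dual_elem (nf (std_elem z)) (D (std_elem z) + nf (eps_elem z))"
  by (rule red_inf_deform[OF trivialization_eps_nf[OF assms(1)] assms(2)])

lemma trivialization_path_balanced:
  assumes "trivialization D" "p \<in> paths"
  shows "vtx (src p) \<star> D (path_elem p) = D (path_elem p)" "D (path_elem p) \<star> vtx (tgt Q p) = D (path_elem p)"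
  using trivialization_balanced(1)[OF assms(1), of "path_elem p" "src p"]
    trivialization_balanced(2)[OF assms(1), of "path_elem p" "tgt Q p"]
    assms(2) qpaths_verts[OF assms(2)] trivializationD(2)[OF assms(1)]
  by (simp_all add: vtx_star pmul_vertex)

text \<open>Comparison of the coefficients of \<open>t\<close> in the condition for equivalence, for a map of the form
  \<open>T x = x + g(x) t\<close>.\<close>

lemma equivariant_iff:
  assumes D: "trivialization D" and D': "trivialization D'" and g: "linmap g" "\<And>x. g x \<in> kIrr"
    and T: "\<And>x y. x \<in> kIrr \<Longrightarrow> y \<in> kIrr \<Longrightarrow> T (dual_elem x y) = dual_elem x (g x + y)"
    and p: "p \<in> paths"
  shows "T (red_inf Q S (deform \<phi> (restrict D' (pspan S))) (path_elem p)) =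
      red_inf Q S (deform \<phi> (restrict D (pspan S)))
        (foldl (pmul Q) (path_elem (fst p, [])) (map (\<lambda>a. T (path_elem (tail Q a, [a]))) (snd p))) \<longleftrightarrow>
    D' (path_elem p) - D (path_elem p) + g (nf (path_elem p)) = nf (arrow_product g p)"
proof -
  have gpaths: "arrow_product g p \<in> kQ"
    by (rule arrow_product_paths[OF p]) (rule pspan_Irr_paths[OF g(2)])
  have arcs: "set (snd p) \<subseteq> arcs Q" using p by (auto simp: qpaths_iff)
  have "T (path_elem (tail Q a, [a])) = dual_elem (arr a) (g (arr a))" if "a \<in> set (snd p)" for a
    using that arcs T[of "arr a" 0] by (simp add: path_elem_dual subset_iff)
  then have m: "map (\<lambda>a. T (path_elem (tail Q a, [a]))) (snd p) = map (\<lambda>a. dual_elem (arr a) (g (arr a))) (snd p)"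
    by simp
  show ?thesis
    unfolding m foldl_arrows[OF p] path_elem_dual[of p] using p gpaths
    by (auto simp: red_inf_trivialization[OF D] red_inf_trivialization[OF D'] T trivializationD(2)[OF D']
      linmap_simps[OF linmap_nf] algebra_simps)
qed

text \<open>Write \<open>T x = x + g(x) t\<close> for the map that realizes the equivalence. The coefficient of \<open>t\<close> in the
  condition on \<open>T\<close> says that \<open>K = D' - D + g\<close> agrees on each path with the normal form of
  \<open>\<Sum> p\<^sub>1 \<dots> g(p\<^sub>i) \<dots> p\<^sub>m\<close>. So \<open>K\<close> is a derivation, and the Leibniz rule of \<open>K\<close> on
  irreducible \<open>x\<close>, \<open>y\<close> says that \<open>D' (x y) - D (x y)\<close> is the coboundary of \<open>g\<close>.\<close>

lemma equiv_imp_cohomologous: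
  assumes D: "trivialization D" and D': "trivialization D'"
    and e: "(restrict D (pspan S), restrict D' (pspan S)) \<in> deformation_equiv Q S \<phi>"
  shows "cohomologous (\<lambda>x y. D' (nf x \<cdot> nf y)) (\<lambda>x y. D (nf x \<cdot> nf y))"
proof -
  note tD = trivializationD[OF D] and tD' = trivializationD[OF D']
  from e obtain T where T: "T \<in> bimod_hom Q kIrr kIrr"
    and std: "\<forall>x\<in>kIrr. \<forall>p. std_part (Poly_Mapping.lookup (T x) p) = std_part (Poly_Mapping.lookup x p)"
    and vtx: "\<forall>v\<in>verts Q. T (path_elem (v, [])) = path_elem (v, [])"
    and eqv: "\<forall>(u, as)\<in>paths. T (red_inf Q S (deform \<phi> (restrict D' (pspan S))) (path_elem (u, as))) =
      red_inf Q S (deform \<phi> (restrict D (pspan S)))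
        (foldl (pmul Q) (path_elem (u, [])) (map (\<lambda>a. T (path_elem (tail Q a, [a]))) as))"
    unfolding deformation_equiv_def by blast
  have T_Irr: "T x \<in> kIrr" if "x \<in> kIrr" for x using T that by (auto simp: bimod_hom_def)
  have T_lin: "T (x + y) = T x + T y" "T (scal c x) = scal c (T x)" if "x \<in> kIrr" "y \<in> kIrr" for x y c
    using T that by (auto simp: bimod_hom_def)
  have T_std: "std_elem (T x) = std_elem x" if "x \<in> kIrr" for x
    by (rule poly_mapping_eqI) (use std that in \<open>simp del: split_paired_All\<close>)
  define g where "g x = eps_elem (T (dual_elem (nf x) 0))" for x
  have T0: "T (dual_elem x 0) = dual_elem x (g x)" if "x \<in> kIrr" for x
    using dual_elem_collapse[of "T (dual_elem x 0)"] T_std[of "dual_elem x 0"] that by (simp add: g_def)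
  have T1: "T (dual_elem x y) = dual_elem x (g x + y)" if "x \<in> kIrr" "y \<in> kIrr" for x y
  proof -
    have m: "dual_elem x 0 \<in> kIrr" "dual_elem y 0 \<in> kIrr" using that by simp_all
    have "T (dual_elem x y) = T (dual_elem x 0) + scal (Dual 0 1) (T (dual_elem y 0))"
      unfolding dual_elem_split[of x y] by (simp only: T_lin(1)[OF m(1) pspan_closed(5)[OF m(2)]] T_lin(2)[OF m(2) m(2)])
    then show ?thesis using that by (simp add: T0 dual_elem_scal dual_elem_add)
  qed
  have g: "linmap g" "g x \<in> kIrr" "g (nf x) = g x" for x
  proof -
    show "linmap g"
    proof (rule linmapI)
      show "g (x + y) = g x + g y" for x y
        using T_lin(1)[of "dual_elem (nf x) 0" "dual_elem (nf y) 0"]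
        by (simp add: g_def linmap_simps[OF linmap_nf] dual_elem_add eps_elem_simps)
      show "g (scal c x) = scal c (g x)" for c x
        using T_lin(2)[of "dual_elem (nf x) 0" "dual_elem (nf x) 0" "Dual c 0"]
        by (simp add: g_def linmap_simps[OF linmap_nf] dual_elem_scal eps_elem_simps)
    qed
    show "g x \<in> kIrr" unfolding g_def by (rule eps_elem_pspan[OF T_Irr]) simp
    show "g (nf x) = g x" by (simp add: g_def)
  qed
  note lin = linmap_simps[OF g(1)] linmap_simps[OF tD(1)] linmap_simps[OF tD'(1)] linmap_simps[OF linmap_nf]
  have gv: "g (vtx v) = 0" if "v \<in> verts Q" for v
  proof -
    have "T (path_elem (v, [])) = path_elem (v, [])" using vtx that by blast
    then have "T (dual_elem (vtx v) 0) = dual_elem (vtx v) 0" unfolding path_elem_dual .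
    then show ?thesis using that by (simp add: g_def eps_elem_simps)
  qed
  have gb: "g (vtx u \<cdot> x \<cdot> vtx v) = vtx u \<cdot> g x \<cdot> vtx v" if "x \<in> kIrr" "u \<in> verts Q" "v \<in> verts Q" for u v x
  proof -
    have "T (pmul Q (pmul Q (path_elem (u, [])) (dual_elem x 0)) (path_elem (v, []))) =
        pmul Q (pmul Q (path_elem (u, [])) (T (dual_elem x 0))) (path_elem (v, []))"
      using T that unfolding bimod_hom_def by simp
    then show ?thesis
      using that by (simp add: path_elem_dual pmul_dual_elem pmul_linear T0 vtx_mult_Irr)
  qed
  have gp: "g (path_elem p) = vtx (src p) \<cdot> g (path_elem p) \<cdot> vtx (tgt Q p)" if p: "p \<in> paths" for p
  proof -
    have "vtx (src p) \<cdot> nf (path_elem p) \<cdot> vtx (tgt Q p) = nf (path_elem p)"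
      using nf_balanced[OF p] by (simp add: vtx_star)
    then show ?thesis using gb[of "nf (path_elem p)" "src p" "tgt Q p"] qpaths_verts[OF p] by (simp add: g(3))
  qed
  define K where "K x = D' x - D x + g x" for x
  have K: "linmap K" "K x \<in> kIrr" for x
    unfolding K_def by (intro linmap_add linmap_diff pspan_closed g tD tD')+
  have Kprod: "K (path_elem p) = nf (arrow_product g p)" if p: "p \<in> paths" for p
    using equivariant_iff[OF D D' g(1,2) T1 p] eqv p by (auto simp: K_def g(3))
  have "K (x \<cdot> y) = x \<star> K y + K x \<star> y" if "x \<in> kQ" "y \<in> kQ" for x y
  proof (rule derivation_from_arrows[OF K _ _ _ _ that])
    show "K (vtx v) = 0" if "v \<in> verts Q" for v using that by (simp add: K_def tD(3) tD'(3) gv)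
    fix p assume p: "p \<in> paths"
    have "vtx (src p) \<cdot> g (path_elem p) = g (path_elem p)"
      by (subst (1 2) gp[OF p]) (simp add: pmul_assoc[symmetric] pmul_path)
    moreover have "g (path_elem p) \<cdot> vtx (tgt Q p) = g (path_elem p)"
      by (subst (1 2) gp[OF p]) (simp add: pmul_assoc pmul_path)
    ultimately show "vtx (src p) \<star> K (path_elem p) = K (path_elem p)" "K (path_elem p) \<star> vtx (tgt Q p) = K (path_elem p)"
      by (simp_all add: K_def star_linear trivialization_path_balanced[OF D p]
        trivialization_path_balanced[OF D' p] vtx_star g(2))
    fix a assume a: "a \<in> arcs Q" "tgt Q p = tail Q a"
    have Ka: "K (arr a) = g (arr a)" using a by (simp add: K_def tD(3) tD'(3))
    have gpaths: "arrow_product g p \<in> kQ"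
      by (rule arrow_product_paths[OF p]) (rule pspan_Irr_paths[OF g(2)])
    have "K (path_elem (pcat p (tail Q a, [a]))) = nf (path_elem p \<cdot> g (arr a) + arrow_product g p \<cdot> arr a)"
      using Kprod[OF pcat_in_qpaths[OF p arrow_in_qpaths[OF a(1)]]] a by (simp add: arrow_product_snoc[OF p])
    also have "\<dots> = path_elem p \<star> g (arr a) + nf (arrow_product g p) \<star> arr a"
      using a gpaths by (simp add: lin star_def nf_mult_left)
    finally show "K (path_elem (pcat p (tail Q a, [a]))) = path_elem p \<star> K (arr a) + K (path_elem p) \<star> arr a"
      by (simp add: Kprod[OF p] Ka)
  qed
  then have "D' (x \<cdot> y) - D (x \<cdot> y) = cob g x y" if "x \<in> kIrr" "y \<in> kIrr" for x y
    using that g(3)[of "x \<cdot> y"]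
    by (simp add: pspan_Irr_paths K_def tD(3) tD'(3) cob_def star_def[of x y] algebra_simps)
  with g show ?thesis by (intro cohomologousI[of g]) simp_all
qed

text \<open>On the vertices, \<open>g\<close> is a derivation of the separable algebra \<open>kQ\<^sub>0\<close> and thus inner: it is the
  commutator with \<open>m = \<Sum> g(e\<^sub>v) e\<^sub>v\<close>. Subtracting this inner derivation does not change the coboundary.\<close>

lemma normalize_coboundary:
  assumes D: "trivialization D" "trivialization D'" and g: "linmap g" "\<And>x. g x \<in> kIrr"
    and c: "\<And>x y. x \<in> kIrr \<Longrightarrow> y \<in> kIrr \<Longrightarrow> D' (x \<cdot> y) - D (x \<cdot> y) = cob g x y"
    and fin: "finite (verts Q)"
  shows "\<exists>h. linmap h \<and> (\<forall>x. h x \<in> kIrr) \<and> (\<forall>v\<in>verts Q. h (vtx v) = 0) \<and>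
    (\<forall>x\<in>kIrr. \<forall>y\<in>kIrr. D' (x \<cdot> y) - D (x \<cdot> y) = cob h x y)"
proof -
  note tD = trivializationD[OF D(1)] and tD' = trivializationD[OF D(2)]
  note lin = linmap_simps[OF g(1)]
  define m where "m = (\<Sum>v\<in>verts Q. g (vtx v) \<star> vtx v)"
  define h where "h x = g x - (m \<star> x - x \<star> m)" for x
  have m: "m \<in> kIrr" unfolding m_def by (intro pspan_sum star_Irr)
  have h: "linmap h" "h x \<in> kIrr" for x
    unfolding h_def by (intro linmap_diff g linmap_star_right linmap_star_left linmap_id pspan_closed star_Irr)+
  have "cob (\<lambda>x. m \<star> x - x \<star> m) x y = 0" if "x \<in> kIrr" "y \<in> kIrr" for x y
    using m[THEN pspan_Irr_paths] that[THEN pspan_Irr_paths] by (simp add: cob_def star_linear star_assoc)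
  then have ch: "D' (x \<cdot> y) - D (x \<cdot> y) = cob h x y" if "x \<in> kIrr" "y \<in> kIrr" for x y
    using c[OF that] that unfolding h_def by (simp add: cob_diff)
  have "h (vtx u) = 0" if u: "u \<in> verts Q" for u
  proof -
    have gvv: "vtx u \<star> g (vtx v) - g (vtx u \<star> vtx v) + g (vtx u) \<star> vtx v = 0" if "v \<in> verts Q" for v
      using c[of "vtx u" "vtx v"] u that tD(3)[OF vtx_mult_Irr(1)] tD'(3)[OF vtx_mult_Irr(1)]
      by (simp add: cob_def)
    have "m \<star> vtx u = (\<Sum>v\<in>verts Q. if u = v then g (vtx u) \<star> vtx u else 0)"
      unfolding m_def star_sum_left using u g(2)[THEN pspan_Irr_paths]
      by (intro sum.cong) (auto simp: star_assoc vtx_star_vtx star_linear)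
    then have 1: "m \<star> vtx u = g (vtx u) \<star> vtx u" using u fin by simp
    have "vtx u \<star> m = (\<Sum>v\<in>verts Q. (g (vtx u \<star> vtx v) - g (vtx u) \<star> vtx v) \<star> vtx v)"
      unfolding m_def star_sum_right
    proof (rule sum.cong[OF refl])
      fix v assume v: "v \<in> verts Q"
      have "vtx u \<star> g (vtx v) = g (vtx u \<star> vtx v) - g (vtx u) \<star> vtx v"
        using gvv[OF v] by (simp add: algebra_simps)
      then show "vtx u \<star> (g (vtx v) \<star> vtx v) = (g (vtx u \<star> vtx v) - g (vtx u) \<star> vtx v) \<star> vtx v"
        using u v g(2)[THEN pspan_Irr_paths] by (simp add: star_assoc[symmetric])
    qed
    also have "\<dots> = (\<Sum>v\<in>verts Q. (if u = v then g (vtx u) \<star> vtx u else 0) - g (vtx u) \<star> vtx v)"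
    proof (rule sum.cong[OF refl])
      fix v assume v: "v \<in> verts Q"
      have "(g (vtx u) \<star> vtx v) \<star> vtx v = g (vtx u) \<star> vtx v"
        using v g(2)[THEN pspan_Irr_paths] by (simp add: star_assoc vtx_star_vtx)
      then show "(g (vtx u \<star> vtx v) - g (vtx u) \<star> vtx v) \<star> vtx v =
          (if u = v then g (vtx u) \<star> vtx u else 0) - g (vtx u) \<star> vtx v"
        using u v by (auto simp: star_linear vtx_star_vtx lin)
    qed
    also have "\<dots> = g (vtx u) \<star> vtx u - g (vtx u)"
      using u fin sum_vtx(2)[OF g(2) fin] by (simp add: sum_subtractf)
    finally show ?thesis by (simp add: h_def 1)
  qed
  with h ch show ?thesis by blast
qed

text \<open>The preceding argument is reversed: with \<open>g\<close> normalized on the vertices, \<open>T x = x + g(x) t\<close> is a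
  bimodule map, \<open>K = D' - D + g\<close> is a derivation, and derivations are determined by their values on the
  vertices and arrows, where \<open>K\<close> is \<open>0\<close> and \<open>g\<close>, respectively.\<close>

lemma cohomologous_imp_equiv:
  assumes D: "trivialization D" and D': "trivialization D'" and fin: "finite (verts Q)"
    and c0: "cohomologous (\<lambda>x y. D' (nf x \<cdot> nf y)) (\<lambda>x y. D (nf x \<cdot> nf y))"
  shows "(restrict D (pspan S), restrict D' (pspan S)) \<in> deformation_equiv Q S \<phi>"
proof -
  note tD = trivializationD[OF D] and tD' = trivializationD[OF D']
  from c0 obtain g0 where g0: "linmap g0" "\<And>x. g0 x \<in> kIrr"
    "\<And>x y. x \<in> kIrr \<Longrightarrow> y \<in> kIrr \<Longrightarrow> D' (nf x \<cdot> nf y) - D (nf x \<cdot> nf y) = cob g0 x y"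
    by (rule cohomologousE) blast
  have "D' (x \<cdot> y) - D (x \<cdot> y) = cob g0 x y" if "x \<in> kIrr" "y \<in> kIrr" for x y
    using g0(3)[OF that] that by simp
  note g0(1,2) this
  from normalize_coboundary[OF D D' this fin] obtain g where g: "linmap g" "\<And>x. g x \<in> kIrr"
    and gv: "\<And>v. v \<in> verts Q \<Longrightarrow> g (vtx v) = 0"
    and c: "\<And>x y. x \<in> kIrr \<Longrightarrow> y \<in> kIrr \<Longrightarrow> D' (x \<cdot> y) - D (x \<cdot> y) = cob g x y" by metis
  note lin = linmap_simps[OF g(1)] linmap_simps[OF tD(1)] linmap_simps[OF tD'(1)] linmap_simps[OF linmap_nf]
  have gb: "g (vtx v \<cdot> x) = vtx v \<cdot> g x" "g (x \<cdot> vtx v) = g x \<cdot> vtx v" if "x \<in> kIrr" "v \<in> verts Q" for x v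
    using c[of "vtx v" x] c[of x "vtx v"] that tD(3)[OF vtx_mult_Irr(1)] tD'(3)[OF vtx_mult_Irr(1)]
      tD(3)[OF vtx_mult_Irr(2)] tD'(3)[OF vtx_mult_Irr(2)]
    by (simp_all add: cob_def gv star_linear vtx_star g)
  \<comment> \<open>The map \<open>x \<mapsto> x + g(x) t\<close>, extended linearly over the dual numbers.\<close>
  define T0 where "T0 z = dual_elem (std_elem z) (g (std_elem z) + eps_elem z)" for z
  define T where "T = restrict T0 kIrr"
  have T0: "linmap T0" unfolding T0_def by (rule linmap_dual[OF linmap_id g(1)])
  have T0_Irr: "T0 z \<in> kIrr" if "z \<in> kIrr" for z
    using that by (simp add: T0_def std_elem_pspan eps_elem_pspan g)
  have dvm: "pmul Q (path_elem (u, [])) z \<in> kIrr" "pmul Q z (path_elem (u, [])) \<in> kIrr"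
    if "z \<in> kIrr" for u and z :: "('v, 'a, 'k dual) pelem"
    using pmul_pspan[of "path_elem (u, [])" "{(u, [])}" z Irr Q Irr] pmul_pspan[of z Irr "path_elem (u, [])" "{(u, [])}" Q Irr] that
    by (simp_all add: vertex_pcat)
  have T0b: "T0 (pmul Q (path_elem (u, [])) z) = pmul Q (path_elem (u, [])) (T0 z)"
    "T0 (pmul Q z (path_elem (u, []))) = pmul Q (T0 z) (path_elem (u, []))"
    if "z \<in> kIrr" "u \<in> verts Q" for u z
  proof -
    obtain x y where z: "z = dual_elem x y" using dual_elem_collapse by metis
    with that show "T0 (pmul Q (path_elem (u, [])) z) = pmul Q (path_elem (u, [])) (T0 z)"
      "T0 (pmul Q z (path_elem (u, []))) = pmul Q (T0 z) (path_elem (u, []))"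
      by (simp_all add: path_elem_dual pmul_dual_elem pmul_linear T0_def gb)
  qed
  have "T \<in> bimod_hom Q kIrr kIrr"
    unfolding bimod_hom_def T_def using T0_Irr
    by (auto simp: linmap_simps[OF T0] T0b dvm)
  moreover have "bij_betw T kIrr kIrr"
  proof (rule bij_betw_byWitness[where f' = "\<lambda>z. dual_elem (std_elem z) (eps_elem z - g (std_elem z))"])
    show "T ` kIrr \<subseteq> kIrr" using T0_Irr by (auto simp: T_def)
    show "(\<lambda>z. dual_elem (std_elem z) (eps_elem z - g (std_elem z))) ` kIrr \<subseteq> kIrr"
      using g by (auto simp: std_elem_pspan eps_elem_pspan)
    show "\<forall>z\<in>kIrr. T (dual_elem (std_elem z) (eps_elem z - g (std_elem z))) = z"
      using g by (auto simp: T_def T0_def std_elem_pspan eps_elem_pspan)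
  qed (auto simp: T_def T0_def)
  moreover have "std_part (Poly_Mapping.lookup (T x) p) = std_part (Poly_Mapping.lookup x p)" if "x \<in> kIrr" for x p
    using that by (simp add: T_def T0_def)
  moreover have "T (path_elem (v, [])) = path_elem (v, [])" if "v \<in> verts Q" for v
    using that by (simp add: T_def path_elem_dual T0_def gv)
  moreover have "T (red_inf Q S (deform \<phi> (restrict D' (pspan S))) (path_elem p)) =
      red_inf Q S (deform \<phi> (restrict D (pspan S)))
        (foldl (pmul Q) (path_elem (fst p, [])) (map (\<lambda>a. T (path_elem (tail Q a, [a]))) (snd p)))"
    if p: "p \<in> paths" for p
  proof -
    have gpaths: "arrow_product g p \<in> kQ" if "p \<in> paths" for p
      by (rule arrow_product_paths[OF that]) (rule pspan_Irr_paths[OF g(2)])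
    define K where "K x = D' x - D x + g (nf x)" for x
    have K: "K x \<in> kIrr" for x unfolding K_def by (intro pspan_closed g tD tD')
    have Kmult: "K (x \<cdot> y) = x \<star> K y + K x \<star> y" if "x \<in> kQ" "y \<in> kQ" for x y
    proof -
      have s: "nf x \<star> nf y = x \<star> y" "nf x \<star> K y = x \<star> K y" "K x \<star> nf y = K x \<star> y"
        using that K[THEN pspan_Irr_paths] by (simp_all add: star_nf(1,2))
      have "D' (x \<cdot> y) - D (x \<cdot> y) = cob g (nf x) (nf y) + nf x \<star> (D' y - D y) + (D' x - D x) \<star> nf y"
        unfolding tD(5)[OF that] tD'(5)[OF that] using c[of "nf x" "nf y"] by (simp add: star_linear algebra_simps)
      then have "K (x \<cdot> y) = nf x \<star> K y + K x \<star> nf y"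
        using s(1) by (simp add: K_def cob_def star_linear star_def[of x y] algebra_simps)
      then show ?thesis unfolding s .
    qed
    have "K (path_elem p) = nf (arrow_product g p)"
      using p
    proof (induction rule: qpaths_rev_induct)
      case (vertex v)
      then show ?case by (simp add: K_def tD(3) tD'(3) gv arrow_product_vertex lin)
    next
      case (arrow a p)
      have "K (arr a) = g (arr a)" using arrow by (simp add: K_def tD(3) tD'(3))
      then show ?case
        using Kmult[of "path_elem p" "arr a"] arrow gpaths[OF arrow(2)]
        by (simp add: pmul_path arrow_product_snoc lin star_def nf_mult_left)
    qed
    moreover have "T (dual_elem x y) = dual_elem x (g x + y)" if "x \<in> kIrr" "y \<in> kIrr" for x y
      using that by (simp add: T_def T0_def)
    ultimately show ?thesis using equivariant_iff[OF D D' g _ p, of T] by (simp add: K_def)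
  qed
  moreover have "restrict D (pspan S) \<in> first_order_deformations Q S \<phi>" "restrict D' (pspan S) \<in> first_order_deformations Q S \<phi>"
    using D D' first_order_deformations_iff by blast+
  ultimately show ?thesis
    unfolding deformation_equiv_def
    by (intro CollectI case_prodI conjI bexI[of _ T] ballI allI) (simp_all add: case_prod_unfold)
qed

end

section \<open>Isomorphisms of quotient modules\<close>

lemma quot_module_add:
  assumes "module_congruence M r" "x \<in> carrier M" "y \<in> carrier M"
  shows "r `` {x} \<oplus>\<^bsub>quot_module M r\<^esub> r `` {y} = r `` {x \<oplus>\<^bsub>M\<^esub> y}"
proof -
  have e: "equiv (carrier M) r" and c: "\<And>x x' y y'. (x, x') \<in> r \<Longrightarrow> (y, y') \<in> r \<Longrightarrow> (x \<oplus>\<^bsub>M\<^esub> y, x' \<oplus>\<^bsub>M\<^esub> y') \<in> r"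
    using assms(1) unfolding module_congruence_def by blast+
  have "r `` {x' \<oplus>\<^bsub>M\<^esub> y'} = r `` {x \<oplus>\<^bsub>M\<^esub> y}" if "(x, x') \<in> r" "(y, y') \<in> r" for x' y'
    using equiv_class_eq[OF e c[OF that]] by simp
  then have "(\<Union>x'\<in>r `` {x}. \<Union>y'\<in>r `` {y}. r `` {x' \<oplus>\<^bsub>M\<^esub> y'}) =
      (\<Union>x'\<in>r `` {x}. \<Union>y'\<in>r `` {y}. r `` {x \<oplus>\<^bsub>M\<^esub> y})"
    by (intro SUP_cong refl) blast
  also have "\<dots> = r `` {x \<oplus>\<^bsub>M\<^esub> y}"
    using equiv_class_self[OF e assms(2)] equiv_class_self[OF e assms(3)] by blast
  finally show ?thesis by (simp add: quot_module_def)
qed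

lemma quot_module_smult:
  assumes "module_congruence M r" "x \<in> carrier M"
  shows "c \<odot>\<^bsub>quot_module M r\<^esub> (r `` {x}) = r `` {c \<odot>\<^bsub>M\<^esub> x}"
proof -
  have e: "equiv (carrier M) r" and c: "\<And>c x x'. (x, x') \<in> r \<Longrightarrow> (c \<odot>\<^bsub>M\<^esub> x, c \<odot>\<^bsub>M\<^esub> x') \<in> r"
    using assms(1) unfolding module_congruence_def by blast+
  have "r `` {c \<odot>\<^bsub>M\<^esub> x'} = r `` {c \<odot>\<^bsub>M\<^esub> x}" if "(x, x') \<in> r" for x'
    using equiv_class_eq[OF e c[OF that]] by simp
  then have "(\<Union>x'\<in>r `` {x}. r `` {c \<odot>\<^bsub>M\<^esub> x'}) = (\<Union>x'\<in>r `` {x}. r `` {c \<odot>\<^bsub>M\<^esub> x})"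
    by (intro SUP_cong refl) blast
  also have "\<dots> = r `` {c \<odot>\<^bsub>M\<^esub> x}" using equiv_class_self[OF e assms(2)] by blast
  finally show ?thesis by (simp add: quot_module_def)
qed

text \<open>The inverse of the isomorphism is induced by \<open>F\<close>. Both claims hold because \<open>s\<close> is the preimage of \<open>r\<close>
  under \<open>F\<close>.\<close>

lemma quot_module_iso:
  assumes r: "module_congruence M r"
    and F: "\<And>x. x \<in> carrier N \<Longrightarrow> F x \<in> carrier M"
      "\<And>x y. x \<in> carrier N \<Longrightarrow> y \<in> carrier N \<Longrightarrow> F (x \<oplus>\<^bsub>N\<^esub> y) = F x \<oplus>\<^bsub>M\<^esub> F y"
      "\<And>c x. x \<in> carrier N \<Longrightarrow> F (c \<odot>\<^bsub>N\<^esub> x) = c \<odot>\<^bsub>M\<^esub> F x"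
    and N: "\<And>x y. x \<in> carrier N \<Longrightarrow> y \<in> carrier N \<Longrightarrow> x \<oplus>\<^bsub>N\<^esub> y \<in> carrier N"
      "\<And>c x. x \<in> carrier N \<Longrightarrow> c \<odot>\<^bsub>N\<^esub> x \<in> carrier N"
    and s: "s = {(x, y). x \<in> carrier N \<and> y \<in> carrier N \<and> (F x, F y) \<in> r}"
    and surj: "\<And>z. z \<in> carrier M \<Longrightarrow> \<exists>x\<in>carrier N. (z, F x) \<in> r"
  shows "module_congruence N s" "\<exists>h. linear_iso (quot_module M r) (quot_module N s) h"
proof -
  have e: "equiv (carrier M) r" using r by (simp add: module_congruence_def)
  have r_refl: "(x, x) \<in> r" if "x \<in> carrier M" for x using equiv_class_self[OF e that] by blast
  have r_sym: "(y, x) \<in> r" if "(x, y) \<in> r" for x y using e that by (meson equivE symE)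
  have r_trans: "(x, z) \<in> r" if "(x, y) \<in> r" "(y, z) \<in> r" for x y z using e that by (meson equivE transE)
  have "equiv (carrier N) s"
  proof (rule equivI)
    show "s \<subseteq> carrier N \<times> carrier N" unfolding s by blast
    show "refl_on (carrier N) s" unfolding s by (intro refl_onI) (simp add: r_refl F)
    show "sym s" unfolding s by (intro symI) (auto intro: r_sym)
    show "trans s" unfolding s by (intro transI) (auto intro: r_trans)
  qed
  then show sc: "module_congruence N s"
    using r unfolding module_congruence_def s by (auto simp: F N)
  define h where "h U = {x \<in> carrier N. F x \<in> U}" for U
  have h: "h (r `` {F x}) = s `` {x}" if "x \<in> carrier N" for x
    using that unfolding h_def s by auto
  have classes: "\<exists>x\<in>carrier N. U = r `` {F x}" if "U \<in> carrier (quot_module M r)" for U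
  proof -
    from that obtain z where z: "z \<in> carrier M" "U = r `` {z}" by (auto simp: quot_module_def elim: quotientE)
    from surj[OF z(1)] obtain x where "x \<in> carrier N" "(z, F x) \<in> r" by blast
    then show ?thesis using equiv_class_eq[OF e] z(2) by blast
  qed
  have "linear_iso (quot_module M r) (quot_module N s) h"
    unfolding linear_iso_def
  proof (intro conjI ballI allI)
    show "bij_betw h (carrier (quot_module M r)) (carrier (quot_module N s))"
    proof (rule bij_betw_imageI)
      show "inj_on h (carrier (quot_module M r))"
      proof (rule inj_onI)
        fix U V assume UV: "U \<in> carrier (quot_module M r)" "V \<in> carrier (quot_module M r)" "h U = h V"
        then obtain x y where xy: "x \<in> carrier N" "U = r `` {F x}" "y \<in> carrier N" "V = r `` {F y}"
          using classes by metis
        with UV(3) have "s `` {x} = s `` {y}" using h by simp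
        then have "(x, y) \<in> s" using xy r_refl F unfolding s by auto
        then show "U = V" using equiv_class_eq[OF e] xy unfolding s by blast
      qed
      show "h ` carrier (quot_module M r) = carrier (quot_module N s)"
      proof
        show "h ` carrier (quot_module M r) \<subseteq> carrier (quot_module N s)"
        proof
          fix V assume "V \<in> h ` carrier (quot_module M r)"
          then obtain U where "U \<in> carrier (quot_module M r)" "V = h U" by blast
          with classes[of U] obtain x where "x \<in> carrier N" "V = s `` {x}" using h by auto
          then show "V \<in> carrier (quot_module N s)" by (simp add: quot_module_def quotientI)
        qed
        show "carrier (quot_module N s) \<subseteq> h ` carrier (quot_module M r)"
        proof
          fix V assume "V \<in> carrier (quot_module N s)"
          then obtain x where x: "x \<in> carrier N" "V = s `` {x}" by (auto simp: quot_module_def elim: quotientE)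
          then have "r `` {F x} \<in> carrier (quot_module M r)" by (simp add: quot_module_def quotientI F)
          then have "h (r `` {F x}) \<in> h ` carrier (quot_module M r)" by (rule imageI)
          then show "V \<in> h ` carrier (quot_module M r)" by (simp only: h[OF x(1)] x(2))
        qed
      qed
    qed
    fix U assume "U \<in> carrier (quot_module M r)"
    then obtain x where x: "x \<in> carrier N" "U = r `` {F x}" using classes by blast
    show "h (c \<odot>\<^bsub>quot_module M r\<^esub> U) = c \<odot>\<^bsub>quot_module N s\<^esub> h U" for c
      using x by (simp add: quot_module_smult[OF r] quot_module_smult[OF sc] h F N F(3)[symmetric] del: F(3))
    fix V assume "V \<in> carrier (quot_module M r)"
    then obtain y where y: "y \<in> carrier N" "V = r `` {F y}" using classes by blast
    show "h (U \<oplus>\<^bsub>quot_module M r\<^esub> V) = h U \<oplus>\<^bsub>quot_module N s\<^esub> h V"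
      using x y by (simp add: quot_module_add[OF r] quot_module_add[OF sc] h F(1) N F(2)[symmetric])
  qed
  then show "\<exists>h. linear_iso (quot_module M r) (quot_module N s) h" by blast
qed


section \<open>The quotient algebra\<close>

lemma path_algebra_sel [simp]:
  "carrier (path_algebra G) = pspan (qpaths G)" "monoid.mult (path_algebra G) = pmul G"
  "one (path_algebra G) = (\<Sum>v\<in>verts G. path_elem (v, []))" "ring.zero (path_algebra G) = 0"
  "add (path_algebra G) = (+)" "module.smult (path_algebra G) = scal"
  by (simp_all add: path_algebra_def)

locale presented_algebra = field_red_system Q S \<phi>
  for Q :: "('v, 'a) pre_digraph" and S and \<phi> :: "('v, 'a) qpath \<Rightarrow> ('v, 'a, 'k::field) pelem" +
  fixes I
  assumes finite_verts: "finite (verts Q)" and ideal_I: "ideal I (path_algebra Q)"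
    and I_gen: "I = genideal (path_algebra Q) {path_elem s - \<phi> s | s. s \<in> S}"
begin

abbreviation P :: "('k, ('v, 'a, 'k) pelem) module" where "P \<equiv> path_algebra Q"

lemma I_paths: "x \<in> I \<Longrightarrow> x \<in> kQ"
  using additive_subgroup.a_subset[OF ideal.axioms(1)[OF ideal_I]] by auto

lemma I_closed:
  "x \<in> I \<Longrightarrow> y \<in> I \<Longrightarrow> x + y \<in> I" "x \<in> I \<Longrightarrow> y \<in> kQ \<Longrightarrow> y \<cdot> x \<in> I"
  "x \<in> I \<Longrightarrow> y \<in> kQ \<Longrightarrow> x \<cdot> y \<in> I" "0 \<in> I" "x \<in> I \<Longrightarrow> scal c x \<in> I"
proof -
  interpret J: ideal I P by (rule ideal_I)
  show "x \<in> I \<Longrightarrow> y \<in> I \<Longrightarrow> x + y \<in> I" using additive_subgroup.a_closed[OF J.is_additive_subgroup] by simp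
  show l: "x \<in> I \<Longrightarrow> y \<in> kQ \<Longrightarrow> y \<cdot> x \<in> I" for y using J.I_l_closed by simp
  show "x \<in> I \<Longrightarrow> y \<in> kQ \<Longrightarrow> x \<cdot> y \<in> I" using J.I_r_closed by simp
  show "0 \<in> I" using additive_subgroup.zero_closed[OF J.is_additive_subgroup] by simp
  assume x: "x \<in> I"
  have "scal c (\<Sum>v\<in>verts Q. vtx v) \<cdot> x = scal c x"
    using J.l_one[of x] I_paths[OF x] by (simp add: pmul_scal_left)
  moreover have "scal c (\<Sum>v\<in>verts Q. vtx v) \<in> kQ" by (intro pspan_closed pspan_sum) simp
  ultimately show "scal c x \<in> I" using l[OF x] by metis
qed

text \<open>The kernel of \<open>nf\<close> is an ideal that contains the generators \<open>s - \<phi>\<^sub>s\<close>. Conversely \<open>x - nf x\<close> is always in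
  the ideal, as each basic reduction changes an element by a multiple of some \<open>q (s - \<phi>\<^sub>s) r\<close>.\<close>

lemma I_eq_kernel: "I = {x \<in> kQ. nf x = 0}"
proof
  let ?J = "{x \<in> kQ. nf x = 0}"
  note lin = linmap_simps[OF linmap_nf]
  interpret J: ideal I P by (rule ideal_I)
  have "ideal ?J P"
  proof (rule idealI)
    show "ring P" by (rule ideal.axioms(2)[OF ideal_I])
    show "subgroup ?J (add_monoid P)"
    proof (rule group.subgroupI)
      show "group (add_monoid P)" by (rule J.a_group)
      show "?J \<noteq> {}" by (auto intro!: exI[of _ 0] simp: lin)
      fix x assume x: "x \<in> ?J"
      have "\<ominus>\<^bsub>P\<^esub> x = - x"
        using J.minus_equality[of "- x" x] x by simp
      then show "inv\<^bsub>add_monoid P\<^esub> x \<in> ?J" using x by (simp add: a_inv_def lin)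
    qed (auto simp: lin)
    fix a x assume a: "a \<in> ?J" and x: "x \<in> carrier P"
    show "x \<otimes>\<^bsub>P\<^esub> a \<in> ?J" "a \<otimes>\<^bsub>P\<^esub> x \<in> ?J"
      using a x star_nf(3)[of x a] star_nf(3)[of a x] by (simp_all add: pmul_in_pspan_qpaths star_linear)
  qed
  moreover have "path_elem s - \<phi> s \<in> ?J" if "s \<in> S" for s
  proof -
    have "\<phi> s \<in> kIrr" using \<phi>_pspan[OF that] by (rule pspan_mono[rotated]) blast
    then show ?thesis using that nf_S[OF that] by (simp add: lin pspan_Irr_paths S_paths)
  qed
  ultimately show "I \<subseteq> ?J" unfolding I_gen genideal_def by blast
  have red: "x - \<rho> x \<in> I" if "\<rho> \<in> reductions Q S \<phi>" for \<rho> x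
    using that
  proof (induction rule: reductions_induct)
    case id
    then show ?case by (simp add: I_closed)
  next
    case (step \<rho> p q s r)
    have "path_elem s - \<phi> s \<in> I"
      unfolding I_gen genideal_def using step.hyps(2) by blast
    then have "path_elem q \<cdot> (path_elem s - \<phi> s) \<cdot> path_elem r \<in> I"
      using step.hyps(3) by (intro I_closed) (simp_all add: factors_def)
    then have "path_elem p - replace Q \<phi> q s r \<in> I"
      by (simp add: factorsD(2)[OF step.hyps(3)] replace_def pmul_linear)
    then have "(x - \<rho> x) + scal (Poly_Mapping.lookup (\<rho> x) p) (path_elem p - replace Q \<phi> q s r) \<in> I"
      by (intro I_closed step.IH)
    moreover have "(x - \<rho> x) + scal c (path_elem p - y) = x - (\<rho> x + scal c (y - path_elem p))" for c y
      by (simp add: scal_diff)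
    ultimately show ?case by (simp add: reduce_at_eq)
  qed
  show "?J \<subseteq> I"
  proof
    fix x assume x: "x \<in> ?J"
    then obtain \<rho> where "\<rho> \<in> reductions Q S \<phi>" "\<rho> x = 0" using nf_as_reduction[of x] by auto
    then show "x \<in> I" using red[of \<rho> x] by simp
  qed
qed

text \<open>The cosets of \<open>I\<close> are the fibres of \<open>nf\<close>, by \<open>I_eq_kernel\<close>; \<open>cls z\<close> is the element of \<open>A\<close> that
  corresponds to \<open>z\<close>.\<close>

definition cls :: "('v, 'a, 'k) pelem \<Rightarrow> ('v, 'a, 'k) pelem set"
  where "cls z = {y \<in> kQ. nf y = z}"

lemma coset_cls:
  assumes "x \<in> kQ"
  shows "I +>\<^bsub>P\<^esub> x = cls (nf x)"
proof
  note lin = linmap_simps[OF linmap_nf]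
  show "I +>\<^bsub>P\<^esub> x \<subseteq> cls (nf x)"
    using assms by (auto simp: a_r_coset_def r_coset_def I_eq_kernel cls_def lin)
  show "cls (nf x) \<subseteq> I +>\<^bsub>P\<^esub> x"
  proof
    fix y assume "y \<in> cls (nf x)"
    then have "y - x \<in> I" using assms by (auto simp: I_eq_kernel cls_def lin)
    then show "y \<in> I +>\<^bsub>P\<^esub> x"
      unfolding a_r_coset_def r_coset_def by (auto intro!: bexI[of _ "y - x"])
  qed
qed

lemma coset_cls_Irr: "x \<in> kIrr \<Longrightarrow> I +>\<^bsub>P\<^esub> x = cls x"
  by (simp add: coset_cls pspan_Irr_paths)

lemma self_in_cls: "x \<in> kIrr \<Longrightarrow> x \<in> cls x"
  by (simp add: cls_def pspan_Irr_paths)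

lemma cls_inject: "x \<in> kIrr \<Longrightarrow> cls x = cls y \<longleftrightarrow> x = y"
  using self_in_cls[of x] by (auto simp: cls_def)

abbreviation "A \<equiv> quot_algebra P I"

lemma A_carrier: "carrier A = cls ` kIrr"
proof -
  have "carrier A = (\<lambda>x. I +>\<^bsub>P\<^esub> x) ` kQ"
    by (auto simp: quot_algebra_def ring.extend_def module.fields_def FactRing_def A_RCOSETS_def'
      a_r_coset_def r_coset_def)
  also have "\<dots> = cls ` kIrr"
  proof (intro subset_antisym subsetI)
    fix U assume "U \<in> (\<lambda>x. I +>\<^bsub>P\<^esub> x) ` kQ"
    then show "U \<in> cls ` kIrr" using coset_cls by auto
  next
    fix U assume "U \<in> cls ` kIrr"
    then obtain x where "x \<in> kIrr" "U = I +>\<^bsub>P\<^esub> x" by (auto simp: coset_cls_Irr)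
    then show "U \<in> (\<lambda>x. I +>\<^bsub>P\<^esub> x) ` kQ" by (auto simp: pspan_Irr_paths)
  qed
  finally show ?thesis .
qed

lemma cls_carrier: "x \<in> kIrr \<Longrightarrow> cls x \<in> carrier A"
  by (simp add: A_carrier)

lemma ideal_abelian_subgroup: "abelian_subgroup I P"
proof -
  interpret J: ideal I P by (rule ideal_I)
  show ?thesis by (rule J.abelian_subgroup_axioms)
qed

lemma A_mult: "x \<in> kIrr \<Longrightarrow> y \<in> kIrr \<Longrightarrow> cls x \<otimes>\<^bsub>A\<^esub> cls y = cls (x \<star> y)"
  using ideal.rcoset_mult_add[OF ideal_I, of x y]
  by (simp add: quot_algebra_def ring.extend_def module.fields_def FactRing_def pspan_Irr_paths
    coset_cls pmul_in_pspan_qpaths star_def)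

lemma A_add: "x \<in> kIrr \<Longrightarrow> y \<in> kIrr \<Longrightarrow> cls x \<oplus>\<^bsub>A\<^esub> cls y = cls (x + y)"
  using abelian_subgroup.a_rcos_sum[OF ideal_abelian_subgroup, of x y]
  by (simp add: quot_algebra_def ring.extend_def module.fields_def FactRing_def pspan_Irr_paths
    coset_cls linmap_simps[OF linmap_nf])

lemma A_zero: "\<zero>\<^bsub>A\<^esub> = cls 0"
  by (simp add: quot_algebra_def ring.extend_def module.fields_def FactRing_def I_eq_kernel cls_def)

lemma A_smult:
  assumes "x \<in> kIrr"
  shows "c \<odot>\<^bsub>A\<^esub> cls x = cls (scal c x)"
proof -
  have "c \<odot>\<^bsub>A\<^esub> cls x = (\<Union>y\<in>cls x. I +>\<^bsub>P\<^esub> scal c y)"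
    by (simp add: quot_algebra_def ring.extend_def module.fields_def)
  also have "\<dots> = (\<Union>y\<in>cls x. cls (scal c x))"
    by (intro SUP_cong refl) (simp add: cls_def coset_cls linmap_simps[OF linmap_nf])
  finally show ?thesis using self_in_cls[OF assms] by auto
qed

lemma A_abelian_monoid: "abelian_monoid A"
  by (rule abelian_monoidI) (auto simp: A_carrier A_add A_zero add_ac)

end

section \<open>Hochschild cohomology in terms of irreducible paths\<close>

context presented_algebra
begin

definition rep :: "('v, 'a, 'k) pelem set \<Rightarrow> ('v, 'a, 'k) pelem"
  where "rep U = (THE z. z \<in> kIrr \<and> U = cls z)"

lemma rep_cls [simp]: "z \<in> kIrr \<Longrightarrow> rep (cls z) = z"
  unfolding rep_def by (rule the_equality) (auto simp: cls_inject)

lemma tuples_1: "tuples A (Suc 0) = {[cls x] | x. x \<in> kIrr}"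
  and tuples_2: "tuples A (Suc (Suc 0)) = {[cls x, cls y] | x y. x \<in> kIrr \<and> y \<in> kIrr}"
  and tuples_3: "tuples A (Suc (Suc (Suc 0))) =
    {[cls x, cls y, cls z] | x y z. x \<in> kIrr \<and> y \<in> kIrr \<and> z \<in> kIrr}"
  by (auto simp: tuples_def A_carrier length_Suc_conv) blast+

text \<open>The cochains of \<open>A\<close> that correspond to linear and bilinear maps on the span of the irreducible
  paths.\<close>

definition cochain1 :: "(('v, 'a, 'k) pelem \<Rightarrow> ('v, 'a, 'k) pelem) \<Rightarrow> ('v, 'a, 'k) pelem set list \<Rightarrow> ('v, 'a, 'k) pelem set"
  where "cochain1 g = (\<lambda>as\<in>tuples A (Suc 0). cls (g (rep (as ! 0))))"

definition cochain2 :: "(('v, 'a, 'k) pelem \<Rightarrow> ('v, 'a, 'k) pelem \<Rightarrow> ('v, 'a, 'k) pelem)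
    \<Rightarrow> ('v, 'a, 'k) pelem set list \<Rightarrow> ('v, 'a, 'k) pelem set"
  where "cochain2 F = (\<lambda>as\<in>tuples A (Suc (Suc 0)). cls (F (rep (as ! 0)) (rep (as ! 1))))"

lemma cochain1_apply: "x \<in> kIrr \<Longrightarrow> cochain1 g [cls x] = cls (g x)"
  and cochain2_apply: "x \<in> kIrr \<Longrightarrow> y \<in> kIrr \<Longrightarrow> cochain2 F [cls x, cls y] = cls (F x y)"
  by (auto simp: cochain1_def cochain2_def tuples_1 tuples_2)

lemma cochain1_cochains:
  assumes "linmap g" "\<And>x. g x \<in> kIrr"
  shows "cochain1 g \<in> hoch_cochains A (Suc 0)"
  unfolding hoch_cochains_def tuples_1
proof (intro CollectI conjI ballI allI impI)
  show "cochain1 g \<in> {[cls x] | x. x \<in> kIrr} \<rightarrow>\<^sub>E carrier A"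
    using assms(2) by (auto simp: cochain1_def tuples_1 cls_carrier)
qed (auto simp: A_carrier A_add A_smult cochain1_apply assms(2) linmap_simps[OF assms(1)])

lemma cochain2_cochains:
  assumes "\<And>y. linmap (\<lambda>x. F x y)" "\<And>x. linmap (F x)" "\<And>x y. F x y \<in> kIrr"
  shows "cochain2 F \<in> hoch_cochains A (Suc (Suc 0))"
  unfolding hoch_cochains_def tuples_2
proof (intro CollectI conjI ballI allI impI)
  show "cochain2 F \<in> {[cls x, cls y] | x y. x \<in> kIrr \<and> y \<in> kIrr} \<rightarrow>\<^sub>E carrier A"
    using assms(3) by (auto simp: cochain2_def tuples_2 cls_carrier)
qed (auto simp: A_carrier A_add A_smult cochain2_apply assms(3) linmap_simps[OF assms(1)]
    linmap_simps[OF assms(2)] less_Suc_eq)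

lemma rep_Irr: "U \<in> carrier A \<Longrightarrow> rep U \<in> kIrr" and cls_rep: "U \<in> carrier A \<Longrightarrow> cls (rep U) = U"
  by (auto simp: A_carrier)

lemma cochain_slot_linear:
  assumes "f \<in> hoch_cochains A n" "as \<in> tuples A n" "i < n"
  shows "linmap (\<lambda>x. rep (f (as[i := cls (nf x)])))"
proof -
  let ?f = "\<lambda>U. f (as[i := U])"
  have val: "?f U \<in> carrier A" if "U \<in> carrier A" for U
  proof -
    have "as[i := U] \<in> tuples A n"
      using assms(2) that set_update_subset_insert[of as i U] by (auto simp: tuples_def)
    then show ?thesis using assms(1) by (auto simp: hoch_cochains_def)
  qed
  have lin: "?f (cls x \<oplus>\<^bsub>A\<^esub> cls y) = ?f (cls x) \<oplus>\<^bsub>A\<^esub> ?f (cls y)"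
    if "x \<in> kIrr" "y \<in> kIrr" for x y
    using assms that cls_carrier unfolding hoch_cochains_def by blast
  have smult: "?f (c \<odot>\<^bsub>A\<^esub> cls x) = c \<odot>\<^bsub>A\<^esub> ?f (cls x)" if "x \<in> kIrr" for x c
    using assms that cls_carrier unfolding hoch_cochains_def by blast
  have "rep (U \<oplus>\<^bsub>A\<^esub> V) = rep U + rep V" if "U \<in> carrier A" "V \<in> carrier A" for U V
    using that by (auto simp: A_carrier A_add)
  moreover have "rep (c \<odot>\<^bsub>A\<^esub> U) = scal c (rep U)" if "U \<in> carrier A" for U c
    using that by (auto simp: A_carrier A_smult)
  ultimately show ?thesis
    by (intro linmapI)
      (simp_all add: linmap_simps[OF linmap_nf] lin smult val cls_carrier flip: A_add A_smult)
qed

lemma cochains1_eq: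
  assumes f: "f \<in> hoch_cochains A (Suc 0)"
  shows "\<exists>g. linmap g \<and> (\<forall>x. g x \<in> kIrr) \<and> f = cochain1 g"
proof -
  define g where "g x = rep (f [cls (nf x)])" for x
  have "f [cls x] \<in> carrier A" if "x \<in> kIrr" for x
    using f that unfolding hoch_cochains_def tuples_1 by blast
  then have g: "g x \<in> kIrr" "cls (g x) = f [cls (nf x)]" for x
    unfolding g_def by (simp_all add: rep_Irr cls_rep)
  have "[cls 0] \<in> tuples A (Suc 0)" by (auto simp: tuples_1)
  from cochain_slot_linear[OF f this, of 0] have "linmap g" by (simp add: g_def[abs_def])
  moreover have "f = cochain1 g"
  proof (rule extensionalityI)
    show "f \<in> extensional (tuples A (Suc 0))" using f by (auto simp: hoch_cochains_def PiE_def)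
    show "cochain1 g \<in> extensional (tuples A (Suc 0))" by (simp add: cochain1_def)
    show "f as = cochain1 g as" if "as \<in> tuples A (Suc 0)" for as
      using that by (auto simp: tuples_1 cochain1_apply g)
  qed
  ultimately show ?thesis using g by blast
qed

lemma cochains2_eq:
  assumes f: "f \<in> hoch_cochains A (Suc (Suc 0))"
  shows "\<exists>F. (\<forall>y. linmap (\<lambda>x. F x y)) \<and> (\<forall>x. linmap (F x)) \<and> (\<forall>x y. F x y \<in> kIrr) \<and> f = cochain2 F"
proof -
  define F where "F x y = rep (f [cls (nf x), cls (nf y)])" for x y
  have "f [cls x, cls y] \<in> carrier A" if "x \<in> kIrr" "y \<in> kIrr" for x y
    using f that unfolding hoch_cochains_def tuples_2 by blast
  then have F: "F x y \<in> kIrr" "cls (F x y) = f [cls (nf x), cls (nf y)]" for x y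
    unfolding F_def by (simp_all add: rep_Irr cls_rep)
  have t: "[cls (nf z), cls (nf z)] \<in> tuples A (Suc (Suc 0))" for z by (auto simp: tuples_2)
  have "linmap (\<lambda>x. F x z)" "linmap (F z)" for z
    using cochain_slot_linear[OF f t, of 0 z] cochain_slot_linear[OF f t, of 1 z]
    by (simp_all add: F_def[abs_def])
  moreover have "f = cochain2 F"
  proof (rule extensionalityI)
    show "f \<in> extensional (tuples A (Suc (Suc 0)))" using f by (auto simp: hoch_cochains_def PiE_def)
    show "cochain2 F \<in> extensional (tuples A (Suc (Suc 0)))" by (simp add: cochain2_def)
    show "f as = cochain2 F as" if "as \<in> tuples A (Suc (Suc 0))" for as
      using that by (auto simp: tuples_2 cochain2_apply F)
  qed
  ultimately show ?thesis using F by blast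
qed

lemma hoch_diff_cochain1:
  assumes "linmap g" "\<And>x. g x \<in> kIrr"
  shows "hoch_diff A (Suc 0) (cochain1 g) = cochain2 (cob g)"
proof (rule extensionalityI)
  show "hoch_diff A (Suc 0) (cochain1 g) \<in> extensional (tuples A (Suc (Suc 0)))" by (simp add: hoch_diff_def)
  show "cochain2 (cob g) \<in> extensional (tuples A (Suc (Suc 0)))" by (simp add: cochain2_def)
  fix as assume as: "as \<in> tuples A (Suc (Suc 0))"
  then obtain x y where xy: "as = [cls x, cls y]" "x \<in> kIrr" "y \<in> kIrr" by (auto simp: tuples_2)
  interpret A: abelian_monoid A by (rule A_abelian_monoid)
  show "hoch_diff A (Suc 0) (cochain1 g) as = cochain2 (cob g) as"
    unfolding hoch_diff_def restrict_apply'[OF as] using xy assms(2)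
    by (simp add: lessThan_Suc cls_carrier A_mult A_add A_smult cochain1_apply cochain2_apply A.l_zero A.r_zero cob_def)
qed

lemma hoch_diff_cochain2:
  assumes "\<And>x y. F x y \<in> kIrr" "x \<in> kIrr" "y \<in> kIrr" "z \<in> kIrr"
  shows "hoch_diff A (Suc (Suc 0)) (cochain2 F) [cls x, cls y, cls z] =
    cls (x \<star> F y z - F (x \<star> y) z + F x (y \<star> z) - F x y \<star> z)"
proof -
  interpret A: abelian_monoid A by (rule A_abelian_monoid)
  have as: "[cls x, cls y, cls z] \<in> tuples A (Suc (Suc (Suc 0)))" using assms by (auto simp: tuples_3)
  show ?thesis
    unfolding hoch_diff_def restrict_apply'[OF as] using assms
    by (simp add: lessThan_Suc cls_carrier A_mult A_add A_smult cochain2_apply A.l_zero A.r_zero algebra_simps)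
qed

lemma hoch_cocycles_eq: "hoch_cocycles A (Suc (Suc 0)) = cochain2 ` Collect cocycle"
proof -
  have iff: "hoch_diff A (Suc (Suc 0)) (cochain2 F) = (\<lambda>as\<in>tuples A (Suc (Suc (Suc 0))). \<zero>\<^bsub>A\<^esub>) \<longleftrightarrow>
      (\<forall>x\<in>kIrr. \<forall>y\<in>kIrr. \<forall>z\<in>kIrr. x \<star> F y z - F (x \<star> y) z + F x (y \<star> z) - F x y \<star> z = 0)"
    (is "?L \<longleftrightarrow> ?R") if F: "\<And>x y. F x y \<in> kIrr" for F
  proof
    assume L: ?L
    show ?R
    proof (intro ballI)
      fix x y z :: "('v, 'a, 'k) pelem" assume i: "x \<in> kIrr" "y \<in> kIrr" "z \<in> kIrr"
      have "[cls x, cls y, cls z] \<in> tuples A (Suc (Suc (Suc 0)))" using i by (auto simp: tuples_3)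
      then have "cls (x \<star> F y z - F (x \<star> y) z + F x (y \<star> z) - F x y \<star> z) = cls 0"
        using fun_cong[OF L, of "[cls x, cls y, cls z]"] hoch_diff_cochain2[OF F i] by (simp add: A_zero)
      then show "x \<star> F y z - F (x \<star> y) z + F x (y \<star> z) - F x y \<star> z = 0"
        by (subst (asm) cls_inject) (intro pspan_closed star_Irr F)
    qed
  next
    assume R: ?R
    show ?L
    proof (rule extensionalityI)
      show "hoch_diff A (Suc (Suc 0)) (cochain2 F) \<in> extensional (tuples A (Suc (Suc (Suc 0))))"
        by (simp add: hoch_diff_def)
      fix as assume as: "as \<in> tuples A (Suc (Suc (Suc 0)))"
      then obtain x y z where "as = [cls x, cls y, cls z]" "x \<in> kIrr" "y \<in> kIrr" "z \<in> kIrr"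
        by (auto simp: tuples_3)
      then show "hoch_diff A (Suc (Suc 0)) (cochain2 F) as = (\<lambda>as\<in>tuples A (Suc (Suc (Suc 0))). \<zero>\<^bsub>A\<^esub>) as"
        using R as by (simp add: hoch_diff_cochain2[OF F] A_zero)
    qed simp
  qed
  show ?thesis
  proof (intro subset_antisym subsetI)
    fix f assume "f \<in> hoch_cocycles A (Suc (Suc 0))"
    then have f: "f \<in> hoch_cochains A (Suc (Suc 0))"
      "hoch_diff A (Suc (Suc 0)) f = (\<lambda>as\<in>tuples A (Suc (Suc (Suc 0))). \<zero>\<^bsub>A\<^esub>)"
      by (simp_all add: hoch_cocycles_def)
    from cochains2_eq[OF f(1)] obtain F where F: "\<forall>y. linmap (\<lambda>x. F x y)" "\<forall>x. linmap (F x)"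
      "\<And>x y. F x y \<in> kIrr" "f = cochain2 F" by blast
    have "cocycle F" unfolding cocycle_def using F iff[OF F(3)] f(2) by simp
    then show "f \<in> cochain2 ` Collect cocycle" using F(4) by blast
  next
    fix f assume "f \<in> cochain2 ` Collect cocycle"
    then obtain F where F: "cocycle F" "f = cochain2 F" by blast
    show "f \<in> hoch_cocycles A (Suc (Suc 0))"
      unfolding hoch_cocycles_def F(2)
      using cochain2_cochains[OF cocycleD(1-3)[OF F(1)]] iff[of F, OF cocycleD(3)[OF F(1)]] F(1)
      unfolding cocycle_def by simp
  qed
qed

lemma hoch_coboundaries_eq:
  "hoch_coboundaries A (Suc (Suc 0)) = {cochain2 (cob g) | g. linmap g \<and> (\<forall>x. g x \<in> kIrr)}"
proof (intro subset_antisym subsetI)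
  fix f assume "f \<in> hoch_coboundaries A (Suc (Suc 0))"
  then obtain f' where f': "f' \<in> hoch_cochains A (Suc 0)" "f = hoch_diff A (Suc 0) f'"
    by (auto simp: hoch_coboundaries_def)
  from cochains1_eq[OF f'(1)] obtain g where "linmap g" "\<forall>x. g x \<in> kIrr" "f' = cochain1 g" by blast
  then show "f \<in> {cochain2 (cob g) | g. linmap g \<and> (\<forall>x. g x \<in> kIrr)}"
    using f'(2) hoch_diff_cochain1 by blast
next
  fix f assume "f \<in> {cochain2 (cob g) | g. linmap g \<and> (\<forall>x. g x \<in> kIrr)}"
  then obtain g where g: "linmap g" "\<And>x. g x \<in> kIrr" "f = cochain2 (cob g)" by blast
  then have "f = hoch_diff A (Suc 0) (cochain1 g)" by (simp add: hoch_diff_cochain1)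
  with cochain1_cochains[OF g(1,2)] show "f \<in> hoch_coboundaries A (Suc (Suc 0))"
    unfolding hoch_coboundaries_def by simp
qed

definition Z where "Z = fun_module (hoch_cocycles A (Suc (Suc 0))) (tuples A (Suc (Suc 0))) A"

lemma carrier_Z: "carrier Z = cochain2 ` Collect cocycle"
  by (simp add: Z_def fun_module_def hoch_cocycles_eq)

lemma Z_add:
  assumes "\<And>x y. F x y \<in> kIrr" "\<And>x y. G x y \<in> kIrr"
  shows "cochain2 F \<oplus>\<^bsub>Z\<^esub> cochain2 G = cochain2 (\<lambda>x y. F x y + G x y)"
proof (rule extensionalityI)
  show "cochain2 F \<oplus>\<^bsub>Z\<^esub> cochain2 G \<in> extensional (tuples A (Suc (Suc 0)))"
    by (simp add: Z_def fun_module_def)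
  show "cochain2 (\<lambda>x y. F x y + G x y) \<in> extensional (tuples A (Suc (Suc 0)))" by (simp add: cochain2_def)
  fix as assume as: "as \<in> tuples A (Suc (Suc 0))"
  then show "(cochain2 F \<oplus>\<^bsub>Z\<^esub> cochain2 G) as = cochain2 (\<lambda>x y. F x y + G x y) as"
    by (auto simp: Z_def fun_module_def tuples_2 cochain2_apply A_add assms)
qed

lemma Z_smult:
  assumes "\<And>x y. F x y \<in> kIrr"
  shows "c \<odot>\<^bsub>Z\<^esub> cochain2 F = cochain2 (\<lambda>x y. scal c (F x y))"
proof (rule extensionalityI)
  show "c \<odot>\<^bsub>Z\<^esub> cochain2 F \<in> extensional (tuples A (Suc (Suc 0)))"
    by (simp add: Z_def fun_module_def)
  show "cochain2 (\<lambda>x y. scal c (F x y)) \<in> extensional (tuples A (Suc (Suc 0)))" by (simp add: cochain2_def)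
  fix as assume as: "as \<in> tuples A (Suc (Suc 0))"
  then show "(c \<odot>\<^bsub>Z\<^esub> cochain2 F) as = cochain2 (\<lambda>x y. scal c (F x y)) as"
    by (auto simp: Z_def fun_module_def tuples_2 cochain2_apply A_smult assms)
qed

lemma cochain2_eq_iff:
  assumes "\<And>x y. F x y \<in> kIrr"
  shows "cochain2 F = cochain2 G \<longleftrightarrow> (\<forall>x\<in>kIrr. \<forall>y\<in>kIrr. F x y = G x y)"
proof
  assume e: "cochain2 F = cochain2 G"
  show "\<forall>x\<in>kIrr. \<forall>y\<in>kIrr. F x y = G x y"
  proof (intro ballI)
    fix x y :: "('v, 'a, 'k) pelem" assume "x \<in> kIrr" "y \<in> kIrr"
    then have "cls (F x y) = cls (G x y)" using fun_cong[OF e, of "[cls x, cls y]"] by (simp add: cochain2_apply)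
    then show "F x y = G x y" using cls_inject[OF assms] by simp
  qed
next
  assume "\<forall>x\<in>kIrr. \<forall>y\<in>kIrr. F x y = G x y"
  then show "cochain2 F = cochain2 G"
    unfolding cochain2_def by (intro restrict_ext) (auto simp: tuples_2)
qed

definition cohom_rel where "cohom_rel = {(f, g). f \<in> carrier Z \<and> g \<in> carrier Z \<and>
  (\<exists>h\<in>hoch_coboundaries A (Suc (Suc 0)). f = g \<oplus>\<^bsub>Z\<^esub> h)}"

lemma HH_eq: "HH 2 A = quot_module Z cohom_rel"
  unfolding HH_def Let_def numeral_2_eq_2 Z_def[symmetric] cohom_rel_def[symmetric] ..

lemma cohom_rel_iff:
  assumes "cocycle F" "cocycle G"
  shows "(cochain2 F, cochain2 G) \<in> cohom_rel \<longleftrightarrow> cohomologous F G"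
proof -
  note F = cocycleD(3)[OF assms(1)] and G = cocycleD(3)[OF assms(2)]
  have eq: "cochain2 F = cochain2 G \<oplus>\<^bsub>Z\<^esub> cochain2 (cob g) \<longleftrightarrow>
      (\<forall>x\<in>kIrr. \<forall>y\<in>kIrr. F x y - G x y = cob g x y)" if "\<forall>x. g x \<in> kIrr" for g
  proof -
    have "cob g x y \<in> kIrr" for x y
      unfolding cob_def using that by (intro pspan_closed star_Irr) simp
    then have "cochain2 F = cochain2 G \<oplus>\<^bsub>Z\<^esub> cochain2 (cob g) \<longleftrightarrow>
        (\<forall>x\<in>kIrr. \<forall>y\<in>kIrr. F x y = G x y + cob g x y)"
      using Z_add[of G "cob g"] G cochain2_eq_iff[OF F] by simp
    then show ?thesis by (simp add: diff_eq_eq add.commute)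
  qed
  have "cochain2 F \<in> carrier Z" "cochain2 G \<in> carrier Z" using assms by (simp_all add: carrier_Z)
  then have "(cochain2 F, cochain2 G) \<in> cohom_rel \<longleftrightarrow>
      (\<exists>h\<in>hoch_coboundaries A (Suc (Suc 0)). cochain2 F = cochain2 G \<oplus>\<^bsub>Z\<^esub> h)"
    by (simp add: cohom_rel_def)
  also have "\<dots> \<longleftrightarrow> (\<exists>g. linmap g \<and> (\<forall>x. g x \<in> kIrr) \<and> cochain2 F = cochain2 G \<oplus>\<^bsub>Z\<^esub> cochain2 (cob g))"
    unfolding hoch_coboundaries_eq by blast
  also have "\<dots> \<longleftrightarrow> cohomologous F G"
    unfolding cohomologous_def by (intro ex_cong1 conj_cong refl) (rule eq)
  finally show ?thesis .
qed

lemma cohom_rel_eq: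
  "cohom_rel = {(cochain2 F, cochain2 G) | F G. cocycle F \<and> cocycle G \<and> cohomologous F G}"
proof -
  have "cohom_rel \<subseteq> carrier Z \<times> carrier Z" by (auto simp: cohom_rel_def)
  then show ?thesis using cohom_rel_iff unfolding carrier_Z by blast
qed

lemma cocycle_add: "cocycle F \<Longrightarrow> cocycle G \<Longrightarrow> cocycle (\<lambda>x y. F x y + G x y)"
  and cocycle_scal: "cocycle F \<Longrightarrow> cocycle (\<lambda>x y. scal c (F x y))"
proof -
  assume F: "cocycle F"
  show "cocycle (\<lambda>x y. scal c (F x y))"
    unfolding cocycle_def
  proof (intro conjI allI ballI)
    fix x y z :: "('v, 'a, 'k) pelem" assume "x \<in> kIrr" "y \<in> kIrr" "z \<in> kIrr"
    from arg_cong[OF cocycleD(4)[OF F this], of "scal c"]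
    show "x \<star> scal c (F y z) - scal c (F (x \<star> y) z) + scal c (F x (y \<star> z)) - scal c (F x y) \<star> z = 0"
      by (simp add: star_linear scal_add scal_diff)
  qed (intro linmap_scal pspan_closed cocycleD[OF F])+
  assume G: "cocycle G"
  show "cocycle (\<lambda>x y. F x y + G x y)"
    unfolding cocycle_def
  proof (intro conjI allI ballI)
    fix x y z :: "('v, 'a, 'k) pelem" assume i: "x \<in> kIrr" "y \<in> kIrr" "z \<in> kIrr"
    from cocycleD(4)[OF F i] cocycleD(4)[OF G i]
    show "x \<star> (F y z + G y z) - (F (x \<star> y) z + G (x \<star> y) z) + (F x (y \<star> z) + G x (y \<star> z)) - (F x y + G x y) \<star> z = 0"
      by (simp add: star_linear algebra_simps)
  qed (intro linmap_add pspan_closed cocycleD[OF F] cocycleD[OF G])+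
qed

lemma cohom_rel_congruence: "module_congruence Z cohom_rel"
  unfolding module_congruence_def
proof (intro conjI)
  have same: "cohomologous F G" if "cocycle F" "cochain2 F = cochain2 G" for F G
    using that cochain2_eq_iff[of F G, OF cocycleD(3)[OF that(1)]]
    by (intro cohomologousI[of "\<lambda>x. 0"]) (simp_all add: cob_def star_linear)
  show "equiv (carrier Z) cohom_rel"
  proof (rule equivI)
    show "cohom_rel \<subseteq> carrier Z \<times> carrier Z" by (auto simp: cohom_rel_def)
    show "refl_on (carrier Z) cohom_rel"
      unfolding carrier_Z cohom_rel_eq using cohomologous_refl by (intro refl_onI) blast
    show "sym cohom_rel"
      unfolding cohom_rel_eq using cohomologous_sym by (intro symI) blast
    show "trans cohom_rel"
    proof (rule transI)
      fix f1 f2 f3 assume "(f1, f2) \<in> cohom_rel" "(f2, f3) \<in> cohom_rel"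
      then obtain F G F' G' where FG: "f1 = cochain2 F" "f2 = cochain2 G" "cocycle F" "cocycle G" "cohomologous F G"
        and FG': "f2 = cochain2 F'" "f3 = cochain2 G'" "cocycle F'" "cocycle G'" "cohomologous F' G'"
        unfolding cohom_rel_eq by blast
      have "cohomologous G F'" using same[OF FG(4)] FG(2) FG'(1) by simp
      then have "cohomologous F G'" using FG(5) FG'(5) cohomologous_trans by blast
      then show "(f1, f3) \<in> cohom_rel" unfolding cohom_rel_eq using FG(1,3) FG'(2,4) by blast
    qed
  qed
  show "\<forall>(f1, f1')\<in>cohom_rel. \<forall>(f2, f2')\<in>cohom_rel. (f1 \<oplus>\<^bsub>Z\<^esub> f2, f1' \<oplus>\<^bsub>Z\<^esub> f2') \<in> cohom_rel"
  proof clarify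
    fix f1 f1' f2 f2' assume "(f1, f1') \<in> cohom_rel" "(f2, f2') \<in> cohom_rel"
    then obtain F G F' G' where FG: "f1 = cochain2 F" "f1' = cochain2 G" "cocycle F" "cocycle G" "cohomologous F G"
      and FG': "f2 = cochain2 F'" "f2' = cochain2 G'" "cocycle F'" "cocycle G'" "cohomologous F' G'"
      unfolding cohom_rel_eq by blast
    then show "(f1 \<oplus>\<^bsub>Z\<^esub> f2, f1' \<oplus>\<^bsub>Z\<^esub> f2') \<in> cohom_rel"
      by (simp add: Z_add cocycleD(3) cohom_rel_iff cocycle_add cohomologous_add)
  qed
  show "\<forall>c. \<forall>(f, f')\<in>cohom_rel. (c \<odot>\<^bsub>Z\<^esub> f, c \<odot>\<^bsub>Z\<^esub> f') \<in> cohom_rel"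
  proof clarify
    fix c f f' assume "(f, f') \<in> cohom_rel"
    then obtain F G where FG: "f = cochain2 F" "f' = cochain2 G" "cocycle F" "cocycle G" "cohomologous F G"
      unfolding cohom_rel_eq by blast
    then show "(c \<odot>\<^bsub>Z\<^esub> f, c \<odot>\<^bsub>Z\<^esub> f') \<in> cohom_rel"
      by (simp add: Z_smult cocycleD(3) cohom_rel_iff cocycle_scal cohomologous_scal)
  qed
qed


section \<open>The deformation space\<close>

text \<open>Well-defined on first-order deformations, by \<open>trivialization_unique\<close>.\<close>

definition triv_of where "triv_of \<psi> = (SOME D. trivialization D \<and> \<psi> = restrict D (pspan S))"

lemma triv_of:
  assumes "\<psi> \<in> first_order_deformations Q S \<phi>"
  shows "trivialization (triv_of \<psi>)" "\<psi> = restrict (triv_of \<psi>) (pspan S)"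
proof -
  from assms have "\<exists>D. trivialization D \<and> \<psi> = restrict D (pspan S)"
    by (simp add: first_order_deformations_iff)
  then have "trivialization (triv_of \<psi>) \<and> \<psi> = restrict (triv_of \<psi>) (pspan S)"
    unfolding triv_of_def by (rule someI_ex)
  then show "trivialization (triv_of \<psi>)" "\<psi> = restrict (triv_of \<psi>) (pspan S)" by blast+
qed

lemma triv_of_restrict: "trivialization D \<Longrightarrow> triv_of (restrict D (pspan S)) = D"
  using triv_of[of "restrict D (pspan S)"] trivialization_unique first_order_deformations_iff by metis

lemma deformation_homs_sel:
  "carrier (deformation_homs Q S) = bimod_hom Q (pspan S) kIrr"
  "ring.zero (deformation_homs Q S) = (\<lambda>x\<in>pspan S. 0)"
  "add (deformation_homs Q S) \<psi> \<psi>' = (\<lambda>x\<in>pspan S. \<psi> x + \<psi>' x)"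
  "module.smult (deformation_homs Q S) c \<psi> = (\<lambda>x\<in>pspan S. scal c (\<psi> x))"
  by (simp_all add: deformation_homs_def fun_module_def)

lemma deformation_add:
  assumes "trivialization D" "trivialization D'"
  shows "restrict D (pspan S) \<oplus>\<^bsub>deformation_homs Q S\<^esub> restrict D' (pspan S) = restrict (\<lambda>x. D x + D' x) (pspan S)"
    "c \<odot>\<^bsub>deformation_homs Q S\<^esub> restrict D (pspan S) = restrict (\<lambda>x. scal c (D x)) (pspan S)"
  by (auto simp: deformation_homs_sel intro!: restrict_ext)

lemma first_order_deformations_submodule:
  "submodule (first_order_deformations Q S \<phi>) (ring_of_type_algebra :: 'k ring) (deformation_homs Q S)"
proof -
  let ?M = "deformation_homs Q S :: ('k, ('v, 'a, 'k) pelem \<Rightarrow> ('v, 'a, 'k) pelem) module"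
  let ?H = "first_order_deformations Q S \<phi>"
  have add: "\<psi> \<oplus>\<^bsub>?M\<^esub> \<psi>' \<in> ?H" if "\<psi> \<in> ?H" "\<psi>' \<in> ?H" for \<psi> \<psi>'
  proof -
    from that obtain D D' where D: "trivialization D" "\<psi> = restrict D (pspan S)"
      "trivialization D'" "\<psi>' = restrict D' (pspan S)" unfolding first_order_deformations_iff by blast
    then show ?thesis
      using trivialization_linear(1)[OF D(1,3)] deformation_add(1)[OF D(1,3)]
      unfolding first_order_deformations_iff by blast
  qed
  have smult: "c \<odot>\<^bsub>?M\<^esub> \<psi> \<in> ?H" if "\<psi> \<in> ?H" for c \<psi>
  proof -
    from that obtain D where D: "trivialization D" "\<psi> = restrict D (pspan S)"
      unfolding first_order_deformations_iff by blast
    then show ?thesis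
      using trivialization_linear(2)[OF D(1,1)] deformation_add(2)[OF D(1,1)]
      unfolding first_order_deformations_iff by blast
  qed
  have inv: "inv\<^bsub>add_monoid ?M\<^esub> \<psi> = (- 1) \<odot>\<^bsub>?M\<^esub> \<psi>" if \<psi>: "\<psi> \<in> ?H" for \<psi>
    unfolding m_inv_def
  proof (rule the_equality)
    have c: "(- 1) \<odot>\<^bsub>?M\<^esub> \<psi> \<in> carrier ?M"
      using smult[OF \<psi>] unfolding first_order_deformations_def by blast
    have z: "\<psi> \<oplus>\<^bsub>?M\<^esub> ((- 1) \<odot>\<^bsub>?M\<^esub> \<psi>) = \<zero>\<^bsub>?M\<^esub>" "((- 1) \<odot>\<^bsub>?M\<^esub> \<psi>) \<oplus>\<^bsub>?M\<^esub> \<psi> = \<zero>\<^bsub>?M\<^esub>"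
      by (auto simp: deformation_homs_sel intro!: restrict_ext)
    from c z show "(- 1) \<odot>\<^bsub>?M\<^esub> \<psi> \<in> carrier (add_monoid ?M) \<and>
        \<psi> \<otimes>\<^bsub>add_monoid ?M\<^esub> ((- 1) \<odot>\<^bsub>?M\<^esub> \<psi>) = \<one>\<^bsub>add_monoid ?M\<^esub> \<and>
        ((- 1) \<odot>\<^bsub>?M\<^esub> \<psi>) \<otimes>\<^bsub>add_monoid ?M\<^esub> \<psi> = \<one>\<^bsub>add_monoid ?M\<^esub>" by simp
    fix \<psi>' assume a: "\<psi>' \<in> carrier (add_monoid ?M) \<and>
        \<psi> \<otimes>\<^bsub>add_monoid ?M\<^esub> \<psi>' = \<one>\<^bsub>add_monoid ?M\<^esub> \<and> \<psi>' \<otimes>\<^bsub>add_monoid ?M\<^esub> \<psi> = \<one>\<^bsub>add_monoid ?M\<^esub>"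
    then have e: "\<psi>' \<in> extensional (pspan S)" "(\<lambda>x\<in>pspan S. \<psi> x + \<psi>' x) = (\<lambda>x\<in>pspan S. 0)"
      by (auto simp: deformation_homs_sel bimod_hom_def PiE_def)
    show "\<psi>' = (- 1) \<odot>\<^bsub>?M\<^esub> \<psi>"
      unfolding deformation_homs_sel
    proof (rule extensionalityI[OF e(1)])
      fix x :: "('v, 'a, 'k) pelem" assume "x \<in> pspan S"
      then show "\<psi>' x = (\<lambda>x\<in>pspan S. scal (- 1) (\<psi> x)) x"
        using fun_cong[OF e(2), of x] by (simp add: eq_neg_iff_add_eq_0 add.commute)
    qed simp
  qed
  have "subgroup ?H (add_monoid ?M)"
  proof (rule subgroup.intro)
    show "?H \<subseteq> carrier (add_monoid ?M)" by (auto simp: first_order_deformations_def)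
    have "\<zero>\<^bsub>?M\<^esub> = restrict (\<lambda>x. 0) (pspan S)" by (simp add: deformation_homs_sel)
    then show "\<one>\<^bsub>add_monoid ?M\<^esub> \<in> ?H"
      using trivialization_zero by (auto simp: first_order_deformations_iff)
  qed (simp_all add: add inv smult)
  then show ?thesis using smult by (auto simp: submodule_def submodule_axioms_def)
qed

lemma deformation_equiv_iff:
  assumes D: "trivialization D" "trivialization D'"
  shows "(restrict D (pspan S), restrict D' (pspan S)) \<in> deformation_equiv Q S \<phi> \<longleftrightarrow>
    (cochain2 (\<lambda>x y. D (nf x \<cdot> nf y)), cochain2 (\<lambda>x y. D' (nf x \<cdot> nf y))) \<in> cohom_rel"
  unfolding cohom_rel_iff[OF trivialization_cocycle[OF D(1)] trivialization_cocycle[OF D(2)]]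
  using equiv_imp_cohomologous[OF D] cohomologous_imp_equiv[OF D finite_verts] cohomologous_sym by blast

text \<open>The class of a deformation is that of the cocycle \<open>(x, y) \<mapsto> D (x y)\<close> for its trivialization \<open>D\<close>. This is
  linear in the deformation and onto by \<open>cocycle_cohomologous_trivialization\<close>, and two deformations
  have the same class if and only if they are equivalent.\<close>

theorem HH2_deformations:
  "module_congruence (deformation_space Q S \<phi>) (deformation_equiv Q S \<phi>)"
  "\<exists>h. linear_iso (HH 2 A) (quot_module (deformation_space Q S \<phi>) (deformation_equiv Q S \<phi>)) h"
proof -
  let ?N = "deformation_space Q S \<phi> :: ('k, ('v, 'a, 'k) pelem \<Rightarrow> ('v, 'a, 'k) pelem) module"
  let ?F = "\<lambda>D. cochain2 (\<lambda>x y. D (nf x \<cdot> nf y))"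
  have N: "carrier ?N = (\<lambda>D. restrict D (pspan S)) ` Collect trivialization"
    by (auto simp: deformation_space_def first_order_deformations_iff)
  have ops: "add ?N = add (deformation_homs Q S)" "module.smult ?N = module.smult (deformation_homs Q S)"
    by (simp_all add: deformation_space_def)
  note triv = trivialization_linear triv_of_restrict deformation_add
  have prems: "\<And>x. x \<in> carrier ?N \<Longrightarrow> ?F (triv_of x) \<in> carrier Z"
    "\<And>x y. x \<in> carrier ?N \<Longrightarrow> y \<in> carrier ?N \<Longrightarrow>
      ?F (triv_of (x \<oplus>\<^bsub>?N\<^esub> y)) = ?F (triv_of x) \<oplus>\<^bsub>Z\<^esub> ?F (triv_of y)"
    "\<And>c x. x \<in> carrier ?N \<Longrightarrow> ?F (triv_of (c \<odot>\<^bsub>?N\<^esub> x)) = c \<odot>\<^bsub>Z\<^esub> ?F (triv_of x)"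
    "\<And>x y. x \<in> carrier ?N \<Longrightarrow> y \<in> carrier ?N \<Longrightarrow> x \<oplus>\<^bsub>?N\<^esub> y \<in> carrier ?N"
    "\<And>c x. x \<in> carrier ?N \<Longrightarrow> c \<odot>\<^bsub>?N\<^esub> x \<in> carrier ?N"
    unfolding N ops carrier_Z
    by (auto simp: triv Z_add Z_smult trivializationD(2) trivialization_cocycle)
  have rel: "deformation_equiv Q S \<phi> =
      {(x, y). x \<in> carrier ?N \<and> y \<in> carrier ?N \<and> (?F (triv_of x), ?F (triv_of y)) \<in> cohom_rel}"
  proof -
    have sub: "\<psi> \<in> carrier ?N \<and> \<psi>' \<in> carrier ?N" if "(\<psi>, \<psi>') \<in> deformation_equiv Q S \<phi>" for \<psi> \<psi>'
      using that by (auto simp: deformation_equiv_def deformation_space_def)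
    have "(\<psi>, \<psi>') \<in> deformation_equiv Q S \<phi> \<longleftrightarrow> (?F (triv_of \<psi>), ?F (triv_of \<psi>')) \<in> cohom_rel"
      if "\<psi> \<in> carrier ?N" "\<psi>' \<in> carrier ?N" for \<psi> \<psi>'
      using that unfolding N by (auto simp: deformation_equiv_iff triv)
    with sub show ?thesis by blast
  qed
  have surj: "\<exists>x\<in>carrier ?N. (z, ?F (triv_of x)) \<in> cohom_rel" if "z \<in> carrier Z" for z
  proof -
    from that obtain F where F: "z = cochain2 F" "cocycle F" by (auto simp: carrier_Z)
    from cocycle_cohomologous_trivialization[OF F(2) finite_verts] obtain D where
      D: "trivialization D" "cohomologous F (\<lambda>x y. D (nf x \<cdot> nf y))" by blast
    then have "(z, ?F D) \<in> cohom_rel"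
      unfolding F(1) by (simp add: cohom_rel_iff F(2) trivialization_cocycle)
    then show ?thesis using D(1) unfolding N by (auto simp: triv intro!: bexI[of _ D])
  qed
  show "module_congruence ?N (deformation_equiv Q S \<phi>)"
    "\<exists>h. linear_iso (HH 2 A) (quot_module ?N (deformation_equiv Q S \<phi>)) h"
    unfolding HH_eq
    by (rule quot_module_iso[OF cohom_rel_congruence, where F = "\<lambda>x. ?F (triv_of x)", OF prems rel surj]; assumption)+
qed

end

theorem corollary7p46:
  fixes Q :: "('v, 'a) pre_digraph"
    and I :: "('v, 'a, 'k::field_char_0) pelem set"
    and S :: "('v, 'a) qpath set"
    and \<phi> :: "('v, 'a) qpath \<Rightarrow> ('v, 'a, 'k) pelem"
  assumes "fin_digraph Q"
    and "ideal I (path_algebra Q)"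
    and "reduction_system Q S \<phi>"
    and "diamond Q S \<phi> I"
  shows "submodule (first_order_deformations Q S \<phi>) (ring_of_type_algebra :: 'k ring)
      (deformation_homs Q S)
    \<and> module_congruence (deformation_space Q S \<phi>) (deformation_equiv Q S \<phi>)
    \<and> (\<exists>h. linear_iso (HH 2 (quot_algebra (path_algebra Q) I))
        (quot_module (deformation_space Q S \<phi>) (deformation_equiv Q S \<phi>)) h)"
proof -
  interpret fin_digraph Q by fact
  have "red_system Q S \<phi>"
    by unfold_locales (rule assms(3))
  then have "complete_red_system Q S \<phi>"
    using assms(4) by (intro complete_red_system.intro complete_red_system_axioms.intro) (simp_all add: diamond_def)
  then have "presented_algebra Q S \<phi> I"
    using assms(2,4) finite_verts
    by (intro presented_algebra.intro field_red_system.intro presented_algebra_axioms.intro)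
      (simp_all add: diamond_def)
  then interpret presented_algebra Q S \<phi> I .
  show ?thesis
    using first_order_deformations_submodule HH2_deformations by (intro conjI)
qed

end
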